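(* For each $N\ge1$ let $E_N$ be a countable set, let $\{\eta^N_t:t\ge0\}$ be an irreducible, positive recurrent continuous time Markov chain on $E_N$ with generator $L_N$, unique stationary probability measure $\mu_N$, and holding rates integrable with respect to $\mu_N$. Let $\mathscr E^1_N,\dots,\mathscr E^\kappa_N$, $\kappa\ge2$, be disjoint subsets of $E_N$ with union $\mathscr E_N$, and let $S=\{1,\dots,\kappa\}$. Fix $x\ne y$ in $S$ and consider the variational problem $$\inf_f\sup_h\big\{2\langle f,L_Nh\rangle_{\mu_N}-\langle h,(-L_N)h\rangle_{\mu_N}\big\},$$ where the infimum is carried over all functions $f:E_N\to\mathbb R$ which are equal to $1$ on $\mathscr E^y_N$, $0$ on $\mathscr E_N\setminus(\mathscr E^x_N\cup\mathscr E^y_N)$, and which are constant on $\mathscr E^x_N$, while the supremum is carried over all functions $h:E_N\to\mathbb R$ which are equal to $0$ on $\mathscr E_N\setminus(\mathscr E^x_N\cup\mathscr E^y_N)$ and which are constant over $\mathscr E^y_N$, $\mathscr E^x_N$, with possibly different values at each set. Then the optimal function $h$ associated to the optimal function $f$ is such that $$h(\eta)=\frac{r_N(\mathscr E^x_N,\mathscr E^y_N)}{r_N(\mathscr E^x_N,\breve{\mathscr E}^x_N)}\quad\text{for all }\eta\in\mathscr E^x_N .$$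
   Context: The jump rates satisfy $R_N(\eta,\xi)\ge0$ for $\eta\ne\xi$, $-\infty<R_N(\eta,\eta)\le0$ and $\sum_{\xi}R_N(\eta,\xi)=0$. The generator acts on bounded functions as $(L_Nf)(\eta)=\sum_{\xi\in E_N}R_N(\eta,\xi)\{f(\xi)-f(\eta)\}$, and $\eta^N_t$ is the associated minimal right-continuous Markov process. The holding rates are $\lambda_N(\eta)=-R_N(\eta,\eta)$, and integrability means $\sum_\eta\lambda_N(\eta)\mu_N(\eta)<\infty$. The scalar product is $\langle f,g\rangle_{\mu_N}=\sum_\eta f(\eta)g(\eta)\mu_N(\eta)$. No reversibility is assumed. "The optimal $f$" refers to the function attaining the infimum, and "the optimal $h$ associated to $f$" to the function attaining the inner supremum for that $f$. Trace process: let $\mathcal T_t=\int_0^t\mathbf 1\{\eta^N_s\in\mathscr E_N\}\,ds$ and $\mathcal S_t=\sup\{s\ge0:\mathcal T_s\le t\}$; the trace of $\eta^N_t$ on $\mathscr E_N$ is the $\mathscr E_N$-valued Markov process $\eta^N_{\mathcal S_t}$, whose jump rates are denoted by $R^{\mathscr E}_N(\eta,\xi)$. Let $\breve{\mathscr E}^x_N=\mathscr E_N\setminus\mathscr E^x_N$ and $$r_N(\mathscr E^x_N,\mathscr E^y_N)=\frac1{\mu_N(\mathscr E^x_N)}\sum_{\eta\in\mathscr E^x_N}\mu_N(\eta)\sum_{\xi\in\mathscr E^y_N}R^{\mathscr E}_N(\eta,\xi),\qquad r_N(\mathscr E^x_N,\breve{\mathscr E}^x_N)=\sum_{z\ne x}r_N(\mathscr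 E^x_N,\mathscr E^z_N).$$
   Formalization: The sign is corrected: for the displayed functional the optimal h on E^x is minus r(x,y)/r(x,breve x). Functions f, h are taken bounded, and if E^x and E^y exhaust the union, where h is unique only up to constants, some optimal h has this value. *)

theory Defs
  imports "HOL-Probability.Probability"
begin

section \<open>Continuous time Markov chains on a countable set\<close>

definition rate_matrix :: "'a set \<Rightarrow> ('a \<Rightarrow> 'a \<Rightarrow> real) \<Rightarrow> bool" where
  "rate_matrix E R \<longleftrightarrow>
     (\<forall>\<eta>\<in>E. \<forall>\<xi>\<in>E. \<eta> \<noteq> \<xi> \<longrightarrow> 0 \<le> R \<eta> \<xi>) \<and>
     (\<forall>\<eta>\<in>E. R \<eta> \<eta> \<le> 0) \<and>
     (\<forall>\<eta>\<in>E. (R \<eta> has_sum 0) E)"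

definition holding_rate :: "('a \<Rightarrow> 'a \<Rightarrow> real) \<Rightarrow> 'a \<Rightarrow> real" where
  "holding_rate R \<eta> = - R \<eta> \<eta>"

definition jump_prob :: "('a \<Rightarrow> 'a \<Rightarrow> real) \<Rightarrow> 'a \<Rightarrow> 'a \<Rightarrow> real" where
  "jump_prob R \<eta> \<xi> = (if \<eta> = \<xi> then 0 else R \<eta> \<xi> / holding_rate R \<eta>)"

definition generator :: "'a set \<Rightarrow> ('a \<Rightarrow> 'a \<Rightarrow> real) \<Rightarrow> ('a \<Rightarrow> real) \<Rightarrow> 'a \<Rightarrow> real" where
  "generator E R f \<eta> = (\<Sum>\<^sub>\<infinity>\<xi>\<in>E. R \<eta> \<xi> * (f \<xi> - f \<eta>))"

definition irreducible_rates :: "'a set \<Rightarrow> ('a \<Rightarrow> 'a \<Rightarrow> real) \<Rightarrow> bool" where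
  "irreducible_rates E R \<longleftrightarrow>
     (\<forall>\<eta>\<in>E. \<forall>\<xi>\<in>E. (\<eta>, \<xi>) \<in> {(a, b). a \<in> E \<and> b \<in> E \<and> 0 < R a b}\<^sup>*)"

text \<open>
  The process is given by its embedded jump chain \<open>Y 0, Y 1, \<dots>\<close> and its successive holding
  times \<open>T 0, T 1, \<dots>\<close>; \<open>P \<eta>\<close> is the law under which it starts from \<open>\<eta>\<close>.  Under \<open>P \<eta>\<close> the
  sequence \<open>Y\<close> is the discrete time Markov chain with transition probabilities \<open>jump_prob R\<close>
  and, given \<open>Y\<close>, the \<open>T i\<close> are independent exponential variables of rates
  \<open>holding_rate R (Y i)\<close>.  The last clause of \<open>jump_hold_chain\<close> is the joint law of
  \<open>(Y 0, T 0), \<dots>, (Y n, T n)\<close>.  (No such real-valued \<open>T\<close> exists if some state is absorbing;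
  an irreducible chain with at least two states has no absorbing state.)
\<close>

definition jump_hold_chain ::
  "'a set \<Rightarrow> ('a \<Rightarrow> 'a \<Rightarrow> real) \<Rightarrow> ('a \<Rightarrow> 'w measure) \<Rightarrow>
   (nat \<Rightarrow> 'w \<Rightarrow> 'a) \<Rightarrow> (nat \<Rightarrow> 'w \<Rightarrow> real) \<Rightarrow> bool" where
  "jump_hold_chain E R P Y T \<longleftrightarrow>
     (\<forall>\<eta>\<in>E. prob_space (P \<eta>) \<and>
        (\<forall>n. Y n \<in> P \<eta> \<rightarrow>\<^sub>M count_space E) \<and>
        (\<forall>n. T n \<in> borel_measurable (P \<eta>)) \<and>
        (\<forall>n x t. (\<forall>i\<le>n. x i \<in> E \<and> 0 \<le> t i) \<longrightarrow>
           measure (P \<eta>) {\<omega> \<in> space (P \<eta>). \<forall>i\<le>n. Y i \<omega> = x i \<and> t i < T i \<omega>} =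
             (if x 0 = \<eta> then 1 else 0) *
             (\<Prod>i<n. jump_prob R (x i) (x (Suc i))) *
             (\<Prod>i\<le>n. exp (- holding_rate R (x i) * t i))))"

text \<open>
  The minimal right-continuous process: it sits at \<open>Y n\<close> during
  \<open>[T 0 + \<dots> + T (n - 1), T 0 + \<dots> + T n)\<close>, and in the cemetery state \<open>None\<close> from the explosion
  time on.
\<close>

definition process_at ::
  "(nat \<Rightarrow> 'w \<Rightarrow> 'a) \<Rightarrow> (nat \<Rightarrow> 'w \<Rightarrow> real) \<Rightarrow> real \<Rightarrow> 'w \<Rightarrow> 'a option" where
  "process_at Y T t \<omega> =
     (if \<exists>n. t < (\<Sum>i\<le>n. T i \<omega>) then Some (Y (LEAST n. t < (\<Sum>i\<le>n. T i \<omega>)) \<omega>) else None)"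

text \<open>First return to \<open>\<eta>\<close> after the first jump; it is \<open>\<infinity>\<close> if there is no return.\<close>

definition return_time ::
  "(nat \<Rightarrow> 'w \<Rightarrow> 'a) \<Rightarrow> (nat \<Rightarrow> 'w \<Rightarrow> real) \<Rightarrow> 'a \<Rightarrow> 'w \<Rightarrow> ennreal" where
  "return_time Y T \<eta> \<omega> = (INF t\<in>{t. T 0 \<omega> \<le> t \<and> process_at Y T t \<omega> = Some \<eta>}. ennreal t)"

definition positive_recurrent ::
  "'a set \<Rightarrow> ('a \<Rightarrow> 'w measure) \<Rightarrow> (nat \<Rightarrow> 'w \<Rightarrow> 'a) \<Rightarrow> (nat \<Rightarrow> 'w \<Rightarrow> real) \<Rightarrow> bool" where
  "positive_recurrent E P Y T \<longleftrightarrow> (\<forall>\<eta>\<in>E. (\<integral>\<^sup>+\<omega>. return_time Y T \<eta> \<omega> \<partial>P \<eta>) < \<infinity>)"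

definition stationary_distribution ::
  "'a set \<Rightarrow> ('a \<Rightarrow> 'w measure) \<Rightarrow> (nat \<Rightarrow> 'w \<Rightarrow> 'a) \<Rightarrow> (nat \<Rightarrow> 'w \<Rightarrow> real) \<Rightarrow> 'a pmf \<Rightarrow> bool" where
  "stationary_distribution E P Y T \<mu> \<longleftrightarrow>
     set_pmf \<mu> \<subseteq> E \<and>
     (\<forall>t\<ge>0. \<forall>\<xi>\<in>E.
        ((\<lambda>\<eta>. pmf \<mu> \<eta> * measure (P \<eta>) {\<omega> \<in> space (P \<eta>). process_at Y T t \<omega> = Some \<xi>})
           has_sum pmf \<mu> \<xi>) E)"

section \<open>Trace process\<close>

definition time_in ::
  "(nat \<Rightarrow> 'w \<Rightarrow> 'a) \<Rightarrow> (nat \<Rightarrow> 'w \<Rightarrow> real) \<Rightarrow> 'a set \<Rightarrow> real \<Rightarrow> 'w \<Rightarrow> real" where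
  "time_in Y T D t \<omega> =
     (\<integral>s\<in>{0..t}. indicator (Some ` D) (process_at Y T s \<omega>) \<partial>lborel)"

text \<open>The value is \<open>None\<close> if the total time spent in \<open>D\<close> does not exceed \<open>t\<close>.\<close>

definition trace_at ::
  "(nat \<Rightarrow> 'w \<Rightarrow> 'a) \<Rightarrow> (nat \<Rightarrow> 'w \<Rightarrow> real) \<Rightarrow> 'a set \<Rightarrow> real \<Rightarrow> 'w \<Rightarrow> 'a option" where
  "trace_at Y T D t \<omega> =
     (if bdd_above {s. 0 \<le> s \<and> time_in Y T D s \<omega> \<le> t}
      then process_at Y T (Sup {s. 0 \<le> s \<and> time_in Y T D s \<omega> \<le> t}) \<omega> else None)"

text \<open>
  Jump rate from \<open>\<eta>\<close> to \<open>\<xi> \<noteq> \<eta>\<close>: the derivative at time \<open>0\<close> of the transition probability.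
  Diagonal values are never used.
\<close>

definition trace_rate ::
  "('a \<Rightarrow> 'w measure) \<Rightarrow> (nat \<Rightarrow> 'w \<Rightarrow> 'a) \<Rightarrow> (nat \<Rightarrow> 'w \<Rightarrow> real) \<Rightarrow> 'a set \<Rightarrow> 'a \<Rightarrow> 'a \<Rightarrow> real"
  where
  "trace_rate P Y T D \<eta> \<xi> =
     Lim (at_right 0)
       (\<lambda>t. measure (P \<eta>) {\<omega> \<in> space (P \<eta>). trace_at Y T D t \<omega> = Some \<xi>} / t)"

definition mean_rate ::
  "('a \<Rightarrow> 'w measure) \<Rightarrow> (nat \<Rightarrow> 'w \<Rightarrow> 'a) \<Rightarrow> (nat \<Rightarrow> 'w \<Rightarrow> real) \<Rightarrow> 'a pmf \<Rightarrow>
   'a set \<Rightarrow> 'a set \<Rightarrow> 'a set \<Rightarrow> real" where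
  "mean_rate P Y T \<mu> D A B =
     (\<Sum>\<^sub>\<infinity>\<eta>\<in>A. pmf \<mu> \<eta> * (\<Sum>\<^sub>\<infinity>\<xi>\<in>B. trace_rate P Y T D \<eta> \<xi>)) / measure_pmf.prob \<mu> A"

section \<open>The variational problem\<close>

definition scalar_product :: "'a set \<Rightarrow> 'a pmf \<Rightarrow> ('a \<Rightarrow> real) \<Rightarrow> ('a \<Rightarrow> real) \<Rightarrow> real" where
  "scalar_product E \<mu> f g = (\<Sum>\<^sub>\<infinity>\<eta>\<in>E. f \<eta> * g \<eta> * pmf \<mu> \<eta>)"

definition objective ::
  "'a set \<Rightarrow> ('a \<Rightarrow> 'a \<Rightarrow> real) \<Rightarrow> 'a pmf \<Rightarrow> ('a \<Rightarrow> real) \<Rightarrow> ('a \<Rightarrow> real) \<Rightarrow> real" where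
  "objective E R \<mu> f h =
     2 * scalar_product E \<mu> f (generator E R h)
     - scalar_product E \<mu> h (\<lambda>\<eta>. - generator E R h \<eta>)"

text \<open>
  Below \<open>D\<close> is the union of all the sets, \<open>A\<close> plays the role of the set indexed by \<open>x\<close> and \<open>B\<close>
  that of the set indexed by \<open>y\<close>.  The functions are bounded, as the generator acts on bounded
  functions; if the holding rates are integrable all the series in \<open>objective\<close> then converge
  absolutely.

  Sign: in the reversible case \<open>objective\<close> is \<open>- 2 * D(f, h) - D(h, h)\<close> with \<open>D\<close> the Dirichlet form,
  so the maximizer is \<open>h = - f\<close>.  If \<open>B\<close> and \<open>D - (A \<union> B)\<close> are nonempty, the \<open>h\<close> belonging to the optimal \<open>f\<close> equals \<open>- 1\<close> on
  \<open>B\<close> and is nonpositive on \<open>A\<close>; replacing \<open>h\<close> by \<open>- h\<close> amounts to replacing \<open>\<langle>f, L h\<rangle>\<close> by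
  \<open>\<langle>f, - L h\<rangle>\<close>.  If \<open>D = A \<union> B\<close>, then \<open>objective\<close> does not change when a constant is added to
  \<open>h\<close>, and the optimal \<open>h\<close> is determined only up to such a constant.
\<close>

definition outer_functions :: "'a set \<Rightarrow> 'a set \<Rightarrow> 'a set \<Rightarrow> 'a set \<Rightarrow> ('a \<Rightarrow> real) set" where
  "outer_functions E D A B =
     {f. bounded (f ` E) \<and> (\<forall>\<eta>\<in>B. f \<eta> = 1) \<and> (\<forall>\<eta>\<in>D - (A \<union> B). f \<eta> = 0) \<and>
         (\<exists>a. \<forall>\<eta>\<in>A. f \<eta> = a)}"

definition inner_functions :: "'a set \<Rightarrow> 'a set \<Rightarrow> 'a set \<Rightarrow> 'a set \<Rightarrow> ('a \<Rightarrow> real) set" where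
  "inner_functions E D A B =
     {h. bounded (h ` E) \<and> (\<forall>\<eta>\<in>D - (A \<union> B). h \<eta> = 0) \<and>
         (\<exists>a. \<forall>\<eta>\<in>A. h \<eta> = a) \<and> (\<exists>b. \<forall>\<eta>\<in>B. h \<eta> = b)}"

definition inner_value ::
  "'a set \<Rightarrow> ('a \<Rightarrow> 'a \<Rightarrow> real) \<Rightarrow> 'a pmf \<Rightarrow> 'a set \<Rightarrow> 'a set \<Rightarrow> 'a set \<Rightarrow> ('a \<Rightarrow> real) \<Rightarrow> ereal" where
  "inner_value E R \<mu> D A B f = (SUP h\<in>inner_functions E D A B. ereal (objective E R \<mu> f h))"

definition optimal_f ::
  "'a set \<Rightarrow> ('a \<Rightarrow> 'a \<Rightarrow> real) \<Rightarrow> 'a pmf \<Rightarrow> 'a set \<Rightarrow> 'a set \<Rightarrow> 'a set \<Rightarrow> ('a \<Rightarrow> real) \<Rightarrow> bool" where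
  "optimal_f E R \<mu> D A B f \<longleftrightarrow>
     f \<in> outer_functions E D A B \<and>
     inner_value E R \<mu> D A B f = (INF g\<in>outer_functions E D A B. inner_value E R \<mu> D A B g)"

definition optimal_h ::
  "'a set \<Rightarrow> ('a \<Rightarrow> 'a \<Rightarrow> real) \<Rightarrow> 'a pmf \<Rightarrow> 'a set \<Rightarrow> 'a set \<Rightarrow> 'a set \<Rightarrow>
   ('a \<Rightarrow> real) \<Rightarrow> ('a \<Rightarrow> real) \<Rightarrow> bool" where
  "optimal_h E R \<mu> D A B f h \<longleftrightarrow>
     h \<in> inner_functions E D A B \<and> ereal (objective E R \<mu> f h) = inner_value E R \<mu> D A B f"

end

theory Submission
  imports Defs
begin

text \<open>
  Let \<open>V\<close> be the bounded function that is harmonic off \<open>D\<close>, equal to \<open>1\<close> on \<open>B\<close>, \<open>0\<close> on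
  \<open>D - (A \<union> B)\<close>, and equal on \<open>A\<close> to the constant \<open>a\<close> for which the total flux
  \<open>\<Sum>\<eta>\<in>A. \<mu> \<eta> * L V \<eta>\<close> vanishes, and let \<open>V'\<close> be the same function for the adjoint chain.
  Stationarity gives \<open>\<langle>V', L V\<rangle> = \<langle>V, L' V'\<rangle>\<close>, so that both functions have the same flux out of \<open>B\<close>;
  hence \<open>f = (V + V') / 2\<close> and \<open>h = - V\<close> form a saddle point: the objective does not depend on \<open>f\<close> at
  \<open>h = - V\<close>, and for this \<open>f\<close> it is a concave quadratic functional of \<open>h\<close> with critical point
  \<open>- V\<close>.  The second derivative in \<open>h\<close> is a Dirichlet form, which by irreducibility vanishes only
  on constants; this gives uniqueness of \<open>h\<close> if \<open>D - (A \<union> B)\<close> is nonempty.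

  Splitting \<open>V\<close> according to the place where \<open>D\<close> is hit, the flux condition determines \<open>a\<close> as the
  quotient of the probability fluxes from \<open>A\<close> to \<open>B\<close> and from \<open>A\<close> to \<open>D - A\<close>.  These are the mean
  rates of the trace process, because its jump rate from \<open>\<eta>\<close> to \<open>\<xi>\<close> is the holding rate
  of \<open>\<eta>\<close> times the probability that the first return to \<open>D\<close> takes place at \<open>\<xi>\<close>: up to an event
  of probability \<open>o t\<close>, the trace is at \<open>\<xi>\<close> at time \<open>t\<close> iff the first holding time is at most \<open>t\<close>
  and the first return is at \<open>\<xi>\<close>.
\<close>

section \<open>Expectations and sums\<close>

lemma bounded_real_image_iff:
  fixes f :: "'a \<Rightarrow> real"
  shows "bounded (f ` S) \<longleftrightarrow> (\<exists>B. \<forall>x\<in>S. \<bar>f x\<bar> \<le> B)"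
  by (auto simp: bounded_iff)

lemma bounded_times_comp:
  fixes f g :: "'a \<Rightarrow> real"
  assumes "bounded (f ` S)" "bounded (g ` S)"
  shows "bounded ((\<lambda>x. f x * g x) ` S)"
proof -
  obtain B C where B: "\<And>x. x \<in> S \<Longrightarrow> \<bar>f x\<bar> \<le> B" and C: "\<And>x. x \<in> S \<Longrightarrow> \<bar>g x\<bar> \<le> C"
    using assms unfolding bounded_real_image_iff by blast
  have "\<bar>f x * g x\<bar> \<le> B * C" if "x \<in> S" for x
    using mult_mono[OF B[OF that] C[OF that]] B[OF that] by (simp add: abs_mult)
  thus ?thesis unfolding bounded_real_image_iff by blast
qed

lemma bounded_const_comp [simp]: "bounded ((\<lambda>x. c) ` S)"
  by (rule bounded_subset[of "{c}"]) auto

lemma bounded_indicator_comp [simp]: "bounded ((indicator A :: 'a \<Rightarrow> real) ` S)"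
  unfolding bounded_real_image_iff by (intro exI[of _ 1]) (auto simp: indicator_def)

lemmas bounded_comps = bounded_plus_comp bounded_minus_comp bounded_times_comp

lemma pmf_integrable_bounded:
  fixes f :: "'a \<Rightarrow> real"
  assumes "bounded (f ` set_pmf p)"
  shows "integrable (measure_pmf p) f"
proof -
  obtain B where "\<And>x. x \<in> set_pmf p \<Longrightarrow> \<bar>f x\<bar> \<le> B"
    using assms unfolding bounded_real_image_iff by blast
  thus ?thesis
    by (intro measure_pmf.integrable_const_bound[where B = B]) (auto simp: AE_measure_pmf_iff)
qed

lemma pmf_expectation_abs_le:
  fixes f :: "'a \<Rightarrow> real"
  assumes "\<And>x. x \<in> set_pmf p \<Longrightarrow> \<bar>f x\<bar> \<le> B"
  shows "\<bar>measure_pmf.expectation p f\<bar> \<le> B"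
proof -
  have i: "integrable (measure_pmf p) f"
    by (rule pmf_integrable_bounded) (use assms bounded_real_image_iff in blast)
  have "measure_pmf.expectation p f \<le> B"
    by (rule measure_pmf.integral_le_const[OF i]) (use assms in \<open>force simp: AE_measure_pmf_iff\<close>)
  moreover have "- B \<le> measure_pmf.expectation p f"
    by (rule measure_pmf.integral_ge_const[OF i]) (use assms in \<open>force simp: AE_measure_pmf_iff\<close>)
  ultimately show ?thesis by linarith
qed

lemma pmf_expectation_cong:
  assumes "\<And>x. x \<in> set_pmf p \<Longrightarrow> f x = (g x :: real)"
  shows "measure_pmf.expectation p f = measure_pmf.expectation p g"
  using assms by (intro integral_cong_AE) (auto simp: AE_measure_pmf_iff)

text \<open>For nonnegative functions the iterated integral formula for \<open>bind_pmf\<close>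
  holds at the level of \<open>nn_integral\<close>; boundedness makes every integral finite, so it
  can be read back as an identity of expectations.\<close>

lemma pmf_expectation_bind_nonneg:
  fixes f :: "'b \<Rightarrow> real"
  assumes bdd: "bounded (f ` set_pmf (bind_pmf p q))"
    and nn: "\<And>x. x \<in> set_pmf (bind_pmf p q) \<Longrightarrow> 0 \<le> f x"
  shows "measure_pmf.expectation (bind_pmf p q) f =
    measure_pmf.expectation p (\<lambda>x. measure_pmf.expectation (q x) f)"
proof -
  obtain B where B: "\<And>x. x \<in> set_pmf (bind_pmf p q) \<Longrightarrow> \<bar>f x\<bar> \<le> B"
    using bdd unfolding bounded_real_image_iff by blast
  have int: "integrable (measure_pmf (q x)) f" if "x \<in> set_pmf p" for x
    by (rule pmf_integrable_bounded)
      (use that B in \<open>force simp: bounded_real_image_iff\<close>)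
  have nnq: "AE y in q x. 0 \<le> f y" if "x \<in> set_pmf p" for x
    using that nn by (auto simp: AE_measure_pmf_iff)
  have inner: "(\<integral>\<^sup>+y. f y \<partial>q x) = ennreal (measure_pmf.expectation (q x) f)"
    if "x \<in> set_pmf p" for x
    by (rule nn_integral_eq_integral[OF int[OF that] nnq[OF that]])
  have le: "\<bar>measure_pmf.expectation (q x) f\<bar> \<le> B" if "x \<in> set_pmf p" for x
    by (rule pmf_expectation_abs_le) (use that B in auto)
  have "(\<integral>\<^sup>+y. f y \<partial>bind_pmf p q) = (\<integral>\<^sup>+x. \<integral>\<^sup>+y. f y \<partial>q x \<partial>p)"
    by simp
  also have "\<dots> = (\<integral>\<^sup>+x. ennreal (measure_pmf.expectation (q x) f) \<partial>p)"
    by (intro nn_integral_cong_AE) (simp add: AE_measure_pmf_iff inner)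
  also have "\<dots> = ennreal (measure_pmf.expectation p (\<lambda>x. measure_pmf.expectation (q x) f))"
  proof (rule nn_integral_eq_integral)
    show "integrable (measure_pmf p) (\<lambda>x. measure_pmf.expectation (q x) f)"
      by (rule pmf_integrable_bounded) (use le in \<open>auto simp: bounded_real_image_iff\<close>)
    show "AE x in p. 0 \<le> measure_pmf.expectation (q x) f"
      using nnq by (auto simp: AE_measure_pmf_iff intro!: integral_nonneg_AE)
  qed
  also have "(\<integral>\<^sup>+y. f y \<partial>bind_pmf p q) = ennreal (measure_pmf.expectation (bind_pmf p q) f)"
    by (rule nn_integral_eq_integral[OF pmf_integrable_bounded[OF bdd]])
      (use nn in \<open>auto simp: AE_measure_pmf_iff\<close>)
  finally show ?thesis
  proof (subst (asm) ennreal_inj)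
    show "0 \<le> measure_pmf.expectation (bind_pmf p q) f"
      by (rule integral_nonneg_AE) (use nn in \<open>auto simp: AE_measure_pmf_iff\<close>)
    show "0 \<le> measure_pmf.expectation p (\<lambda>x. measure_pmf.expectation (q x) f)"
      using nnq by (auto simp: AE_measure_pmf_iff intro!: integral_nonneg_AE)
  qed
qed

lemma pmf_expectation_bind_bounded:
  fixes f :: "'b \<Rightarrow> real"
  assumes bdd: "bounded (f ` set_pmf (bind_pmf p q))"
  shows "measure_pmf.expectation (bind_pmf p q) f =
    measure_pmf.expectation p (\<lambda>x. measure_pmf.expectation (q x) f)"
proof -
  obtain B where B: "\<And>x. x \<in> set_pmf (bind_pmf p q) \<Longrightarrow> \<bar>f x\<bar> \<le> B"
    using bdd unfolding bounded_real_image_iff by blast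
  have int: "integrable (measure_pmf (q x)) f" if "x \<in> set_pmf p" for x
    by (rule pmf_integrable_bounded)
      (use that B in \<open>force simp: bounded_real_image_iff\<close>)
  have le: "\<bar>measure_pmf.expectation (q x) f\<bar> \<le> B" if "x \<in> set_pmf p" for x
    by (rule pmf_expectation_abs_le) (use that B in auto)
  have int2: "integrable (measure_pmf p) (\<lambda>x. measure_pmf.expectation (q x) f)"
    by (rule pmf_integrable_bounded) (use le in \<open>auto simp: bounded_real_image_iff\<close>)
  \<comment> \<open>Adding the bound \<open>B\<close> makes the function nonnegative; the constant
    then drops out of both sides because all laws involved are probabilities.\<close>
  have "measure_pmf.expectation (bind_pmf p q) (\<lambda>y. f y + B) =
      measure_pmf.expectation p (\<lambda>x. measure_pmf.expectation (q x) (\<lambda>y. f y + B))"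
  proof (rule pmf_expectation_bind_nonneg)
    show "bounded ((\<lambda>y. f y + B) ` set_pmf (bind_pmf p q))"
      using bdd by (intro bounded_comps) auto
    show "0 \<le> f x + B" if "x \<in> set_pmf (bind_pmf p q)" for x
      using B[OF that] by linarith
  qed
  also have "\<dots> = measure_pmf.expectation p (\<lambda>x. measure_pmf.expectation (q x) f + B)"
    by (rule pmf_expectation_cong) (simp add: int)
  also have "\<dots> = measure_pmf.expectation p (\<lambda>x. measure_pmf.expectation (q x) f) + B"
    by (simp add: int2)
  finally show ?thesis
    by (simp add: pmf_integrable_bounded[OF bdd])
qed

text \<open>Bridge between Bochner integrals over a counting measure and the unordered sums
  \<open>has_sum\<close> in which rates, generator and scalar product are expressed.\<close>

lemma integrable_count_space_has_sum:
  fixes f :: "'a \<Rightarrow> real"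
  assumes "integrable (count_space A) f"
  shows "(f has_sum integral\<^sup>L (count_space A) f) A"
proof -
  have "Infinite_Set_Sum.abs_summable_on f A"
    using assms by (simp add: Infinite_Set_Sum.abs_summable_on_def)
  moreover from this have "f summable_on A"
    unfolding abs_summable_equivalent[symmetric] by (rule abs_summable_summable)
  ultimately show ?thesis
    using infsetsum_infsum[of f A] by (simp add: infsetsum_def has_sum_infsum)
qed

lemma nonneg_has_sum_integrable:
  fixes f :: "'a \<Rightarrow> real"
  assumes "\<And>x. x \<in> A \<Longrightarrow> 0 \<le> f x" "f summable_on A"
  shows "integrable (count_space A) f"
proof -
  have "(\<lambda>x. norm (f x)) summable_on A"
    using assms by (subst summable_on_cong[of A _ f]) auto
  thus ?thesis
    unfolding abs_summable_equivalent Infinite_Set_Sum.abs_summable_on_def .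
qed

lemma nonneg_has_sum_nn_integral:
  fixes f :: "'a \<Rightarrow> real"
  assumes "\<And>x. x \<in> A \<Longrightarrow> 0 \<le> f x" "(f has_sum s) A"
  shows "(\<integral>\<^sup>+x. f x \<partial>count_space A) = ennreal s"
proof -
  have int: "integrable (count_space A) f"
    using assms by (intro nonneg_has_sum_integrable) (auto intro: has_sum_imp_summable)
  have "integral\<^sup>L (count_space A) f = s"
    using integrable_count_space_has_sum[OF int] assms(2) by (rule has_sum_unique)
  moreover have "(\<integral>\<^sup>+x. f x \<partial>count_space A) = ennreal (integral\<^sup>L (count_space A) f)"
    by (rule nn_integral_eq_integral[OF int]) (use assms in \<open>auto intro!: AE_I2\<close>)
  ultimately show ?thesis by simp
qed

lemma pmf_expectation_has_sum:
  fixes f :: "'a \<Rightarrow> real"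
  assumes "integrable (measure_pmf p) f" "set_pmf p \<subseteq> A"
  shows "((\<lambda>x. pmf p x * f x) has_sum measure_pmf.expectation p f) A"
proof -
  have "integrable (count_space UNIV) (\<lambda>x. pmf p x * f x)"
    using assms(1) by (simp add: measure_pmf_eq_density integrable_density pmf_nonneg)
  moreover have "integral\<^sup>L (count_space UNIV) (\<lambda>x. pmf p x * f x) = measure_pmf.expectation p f"
    unfolding measure_pmf_eq_density[of p] by (subst integral_density) (auto simp: pmf_nonneg)
  ultimately have "((\<lambda>x. pmf p x * f x) has_sum measure_pmf.expectation p f) UNIV"
    using integrable_count_space_has_sum[of UNIV "\<lambda>x. pmf p x * f x"] by simp
  thus ?thesis
    by (rule iffD1[OF has_sum_cong_neutral, rotated -1])
      (use assms(2) in \<open>auto simp: set_pmf_iff\<close>)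
qed

text \<open>Meant for unbounded functions, where \<open>pmf_integrable_bounded\<close> is of no
  help: it turns summability of the holding rates against the stationary law into
  integrability.\<close>

lemma pmf_integrable_summable:
  fixes f :: "'a \<Rightarrow> real"
  assumes "(\<lambda>x. pmf p x * f x) summable_on A" "set_pmf p \<subseteq> A" "\<And>x. x \<in> A \<Longrightarrow> 0 \<le> f x"
  shows "integrable (measure_pmf p) f"
proof -
  have "(\<lambda>x. pmf p x * f x) summable_on A \<longleftrightarrow> (\<lambda>x. pmf p x * f x) summable_on UNIV"
    by (rule summable_on_cong_neutral) (use assms(2) in \<open>auto simp: set_pmf_iff\<close>)
  moreover have "0 \<le> pmf p x * f x" for x
    using assms(2) assms(3)[of x] by (cases "x \<in> set_pmf p") (auto simp: set_pmf_iff subset_iff)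
  ultimately have "integrable (count_space UNIV) (\<lambda>x. pmf p x * f x)"
    using assms(1) by (intro nonneg_has_sum_integrable) auto
  thus ?thesis by (simp add: measure_pmf_eq_density integrable_density pmf_nonneg)
qed

lemma (in finite_measure) measure_has_sum:
  assumes "countable I" "\<And>i. i \<in> I \<Longrightarrow> X i \<in> sets M" "disjoint_family_on X I"
  shows "((\<lambda>i. measure M (X i)) has_sum measure M (\<Union>i\<in>I. X i)) I"
proof -
  have e: "(\<integral>\<^sup>+i. ennreal (measure M (X i)) \<partial>count_space I) = ennreal (measure M (\<Union>i\<in>I. X i))"
    using emeasure_UN_countable[OF assms(2,1,3)] by (simp add: emeasure_eq_measure)
  have "integrable (count_space I) (\<lambda>i. measure M (X i))"
    by (rule integrableI_nn_integral_finite[OF _ _ e]) auto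
  from integrable_count_space_has_sum[OF this]
  have "((\<lambda>i. measure M (X i)) has_sum integral\<^sup>L (count_space I) (\<lambda>i. measure M (X i))) I" .
  also have "integral\<^sup>L (count_space I) (\<lambda>i. measure M (X i)) = measure M (\<Union>i\<in>I. X i)"
    by (subst integral_eq_nn_integral) (auto simp: e)
  finally show ?thesis .
qed

section \<open>Stationary chains and harmonic extensions\<close>

locale transition_kernel =
  fixes J :: "'a \<Rightarrow> 'a pmf"
begin

definition K :: "('a \<Rightarrow> real) \<Rightarrow> 'a \<Rightarrow> real" where
  "K g \<eta> = measure_pmf.expectation (J \<eta>) g"

text \<open>Expected value of \<open>g\<close> at the first entrance into \<open>D\<close>, where
  only entrances at one of the times \<open>0, ..., n - 1\<close> count and a start in
  \<open>D\<close> is an entrance at time 0. The payoff \<open>g\<close> is general because it later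
  carries an exponential discount besides an indicator.\<close>

primrec hit_within :: "'a set \<Rightarrow> ('a \<Rightarrow> real) \<Rightarrow> nat \<Rightarrow> 'a \<Rightarrow> real" where
  "hit_within D g 0 = (\<lambda>\<eta>. 0)"
| "hit_within D g (Suc n) = (\<lambda>\<eta>. if \<eta> \<in> D then g \<eta> else K (hit_within D g n) \<eta>)"

text \<open>For payoffs with values in the unit interval the sequence is increasing and bounded, so
  the limit exists. Paths that never enter \<open>D\<close> contribute 0.\<close>

definition hit :: "'a set \<Rightarrow> ('a \<Rightarrow> real) \<Rightarrow> 'a \<Rightarrow> real" where
  "hit D g \<eta> = lim (\<lambda>n. hit_within D g n \<eta>)"

lemma hit_within_bounds:
  fixes g :: "'a \<Rightarrow> real"
  assumes g: "\<And>\<eta>. 0 \<le> g \<eta>" "\<And>\<eta>. g \<eta> \<le> 1"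
  shows "0 \<le> hit_within D g n \<eta> \<and> hit_within D g n \<eta> \<le> 1"
proof (induction n arbitrary: \<eta>)
  case (Suc n)
  have "0 \<le> K (hit_within D g n) \<eta>"
    unfolding K_def using Suc by (intro integral_nonneg_AE) auto
  moreover have "\<bar>K (hit_within D g n) \<eta>\<bar> \<le> 1"
    unfolding K_def using Suc by (intro pmf_expectation_abs_le) auto
  ultimately show ?case using g by auto
qed auto

lemma hit_within_mono:
  fixes g :: "'a \<Rightarrow> real"
  assumes g: "\<And>\<eta>. 0 \<le> g \<eta>" "\<And>\<eta>. g \<eta> \<le> 1"
  shows "hit_within D g n \<eta> \<le> hit_within D g (Suc n) \<eta>"
proof (induction n arbitrary: \<eta>)
  case 0
  show ?case using hit_within_bounds[of g D "Suc 0" \<eta>] g by simp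
next
  case (Suc n)
  have int: "integrable (measure_pmf (J \<eta>)) (hit_within D g k)" for k
    by (rule pmf_integrable_bounded)
      (use hit_within_bounds[OF g] in \<open>auto simp: bounded_real_image_iff intro!: exI[of _ 1]\<close>)
  have "K (hit_within D g n) \<eta> \<le> K (hit_within D g (Suc n)) \<eta>"
    unfolding K_def by (rule integral_mono[OF int int]) (rule Suc)
  thus ?case by simp
qed

lemma hit_within_LIMSEQ:
  fixes g :: "'a \<Rightarrow> real"
  assumes g: "\<And>\<eta>. 0 \<le> g \<eta>" "\<And>\<eta>. g \<eta> \<le> 1"
  shows "(\<lambda>n. hit_within D g n \<eta>) \<longlonglongrightarrow> hit D g \<eta>"
proof -
  have "incseq (\<lambda>n. hit_within D g n \<eta>)"
    by (rule incseq_SucI) (rule hit_within_mono[OF g])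
  moreover have "bdd_above (range (\<lambda>n. hit_within D g n \<eta>))"
    using hit_within_bounds[OF g] by (auto intro!: bdd_aboveI[of _ 1])
  ultimately have "convergent (\<lambda>n. hit_within D g n \<eta>)"
    by (metis LIMSEQ_incseq_SUP convergentI)
  thus ?thesis
    unfolding hit_def convergent_LIMSEQ_iff .
qed

lemma hit_bounds:
  fixes g :: "'a \<Rightarrow> real"
  assumes g: "\<And>\<eta>. 0 \<le> g \<eta>" "\<And>\<eta>. g \<eta> \<le> 1"
  shows "0 \<le> hit D g \<eta>" "hit D g \<eta> \<le> 1"
proof -
  show "0 \<le> hit D g \<eta>"
    by (rule LIMSEQ_le_const[OF hit_within_LIMSEQ[of g]]) (use g hit_within_bounds[of g] in auto)
  show "hit D g \<eta> \<le> 1"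
    by (rule LIMSEQ_le_const2[OF hit_within_LIMSEQ[of g]]) (use g hit_within_bounds[of g] in auto)
qed

lemma K_hit_within_LIMSEQ:
  fixes g :: "'a \<Rightarrow> real"
  assumes g: "\<And>\<eta>. 0 \<le> g \<eta>" "\<And>\<eta>. g \<eta> \<le> 1"
  shows "(\<lambda>n. K (hit_within D g n) \<eta>) \<longlonglongrightarrow> K (hit D g) \<eta>"
  unfolding K_def
proof (rule integral_dominated_convergence[where w = "\<lambda>_. 1"])
  show "AE \<xi> in J \<eta>. (\<lambda>n. hit_within D g n \<xi>) \<longlonglongrightarrow> hit D g \<xi>"
    using hit_within_LIMSEQ[OF g] by auto
  show "AE \<xi> in J \<eta>. norm (hit_within D g n \<xi>) \<le> 1" for n
    using hit_within_bounds[OF g] by auto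
qed auto

text \<open>Limit of the recursion for \<open>hit_within\<close>; dominated convergence with the
  constant 1 moves the limit inside \<open>K\<close>.\<close>

lemma hit_eq:
  fixes g :: "'a \<Rightarrow> real"
  assumes g: "\<And>\<eta>. 0 \<le> g \<eta>" "\<And>\<eta>. g \<eta> \<le> 1"
  shows "hit D g \<eta> = (if \<eta> \<in> D then g \<eta> else K (hit D g) \<eta>)"
proof -
  have "(\<lambda>n. hit_within D g (Suc n) \<eta>) \<longlonglongrightarrow> hit D g \<eta>"
    using hit_within_LIMSEQ[OF g] by (rule LIMSEQ_Suc)
  moreover have "(\<lambda>n. hit_within D g (Suc n) \<eta>) \<longlonglongrightarrow> (if \<eta> \<in> D then g \<eta> else K (hit D g) \<eta>)"
    using K_hit_within_LIMSEQ[OF g] by auto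
  ultimately show ?thesis by (rule LIMSEQ_unique)
qed

definition hit_prob :: "'a set \<Rightarrow> 'a set \<Rightarrow> 'a \<Rightarrow> real" where
  "hit_prob D B = hit D (indicator B)"

lemma hit_prob_bounds: "0 \<le> hit_prob D B \<eta>" "hit_prob D B \<eta> \<le> 1"
  unfolding hit_prob_def by (rule hit_bounds; simp add: indicator_def)+

lemma bounded_hit_prob [simp]: "bounded (hit_prob D B ` A)"
  unfolding bounded_real_image_iff
  by (intro exI[of _ 1]) (use hit_prob_bounds in \<open>auto simp: abs_le_iff intro: order_trans[of _ 0]\<close>)

lemma hit_prob_on: "\<eta> \<in> D \<Longrightarrow> hit_prob D B \<eta> = indicator B \<eta>"
  unfolding hit_prob_def by (subst hit_eq) (auto simp: indicator_def)

lemma K_hit_prob_off: "\<eta> \<notin> D \<Longrightarrow> K (hit_prob D B) \<eta> = hit_prob D B \<eta>"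
  unfolding hit_prob_def
  by (rule trans[OF _ hit_eq[symmetric]]) (auto simp: indicator_def)

end

text \<open>The assumption \<open>connected\<close> is irreducibility stated through functions that
  are constant along jumps. In this form it is what a vanishing Dirichlet form calls for, and it
  passes easily to the reversed chain.\<close>

locale stationary_chain = transition_kernel J
  for m :: "'a pmf" and J :: "'a \<Rightarrow> 'a pmf" +
  assumes stationary: "bind_pmf m J = m"
    and connected: "\<And>v::'a \<Rightarrow> real. (\<And>\<eta> \<xi>. \<eta> \<in> set_pmf m \<Longrightarrow> \<xi> \<in> set_pmf (J \<eta>) \<Longrightarrow> v \<xi> = v \<eta>) \<Longrightarrow>
      \<exists>c. \<forall>\<eta>\<in>set_pmf m. v \<eta> = c"
begin

section \<open>The bilinear form of a stationary chain and uniqueness of harmonic extensions\<close>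

abbreviation "S \<equiv> set_pmf m"

text \<open>The pairing of \<open>f\<close> with \<open>(K - 1) g\<close> in the space of
  \<open>m\<close>. It is not symmetric in general. For the embedded jump chain it equals, up to a
  constant factor, the pairing of \<open>f\<close> with the generator applied to \<open>g\<close>
  under the stationary law of the process.\<close>

definition form :: "('a \<Rightarrow> real) \<Rightarrow> ('a \<Rightarrow> real) \<Rightarrow> real" where
  "form f g = measure_pmf.expectation m (\<lambda>\<eta>. f \<eta> * (K g \<eta> - g \<eta>))"

lemma J_subset: "\<eta> \<in> S \<Longrightarrow> set_pmf (J \<eta>) \<subseteq> S"
  using arg_cong[OF stationary, of set_pmf] by auto

lemma integrable_J:
  fixes g :: "'a \<Rightarrow> real"
  assumes "bounded (g ` S)" "\<eta> \<in> S"
  shows "integrable (measure_pmf (J \<eta>)) g"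
  by (rule pmf_integrable_bounded, rule bounded_subset[OF assms(1)])
    (use J_subset assms in blast)

lemma K_abs_le:
  assumes "\<And>\<xi>. \<xi> \<in> S \<Longrightarrow> \<bar>g \<xi>\<bar> \<le> B" "\<eta> \<in> S"
  shows "\<bar>K g \<eta>\<bar> \<le> B"
  unfolding K_def by (rule pmf_expectation_abs_le) (use assms J_subset in blast)

lemma bounded_K [intro]: "bounded (g ` S) \<Longrightarrow> bounded (K g ` S)"
  unfolding bounded_real_image_iff using K_abs_le by blast

lemma K_cong: "(\<And>\<xi>. \<xi> \<in> S \<Longrightarrow> f \<xi> = g \<xi>) \<Longrightarrow> \<eta> \<in> S \<Longrightarrow> K f \<eta> = K g \<eta>"
  unfolding K_def by (rule pmf_expectation_cong) (use J_subset in blast)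

lemma K_add: "bounded (f ` S) \<Longrightarrow> bounded (g ` S) \<Longrightarrow> \<eta> \<in> S \<Longrightarrow>
    K (\<lambda>\<xi>. f \<xi> + g \<xi>) \<eta> = K f \<eta> + K g \<eta>"
  by (simp add: K_def integrable_J)

lemma K_diff: "bounded (f ` S) \<Longrightarrow> bounded (g ` S) \<Longrightarrow> \<eta> \<in> S \<Longrightarrow>
    K (\<lambda>\<xi>. f \<xi> - g \<xi>) \<eta> = K f \<eta> - K g \<eta>"
  by (simp add: K_def integrable_J)

lemma K_scale: "K (\<lambda>\<xi>. c * f \<xi>) \<eta> = c * K f \<eta>"
  by (simp add: K_def)

lemma K_const [simp]: "K (\<lambda>\<xi>. c) \<eta> = c"
  by (simp add: K_def)

lemma K_mono:
  assumes "bounded (f ` S)" "bounded (g ` S)" "\<And>\<xi>. \<xi> \<in> S \<Longrightarrow> f \<xi> \<le> g \<xi>" "\<eta> \<in> S"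
  shows "K f \<eta> \<le> K g \<eta>"
  unfolding K_def
  by (rule integral_mono_AE)
    (use assms J_subset in \<open>auto simp: integrable_J AE_measure_pmf_iff\<close>)

lemma expectation_K: "bounded (g ` S) \<Longrightarrow>
    measure_pmf.expectation m (K g) = measure_pmf.expectation m g"
  using pmf_expectation_bind_bounded[of g m J] by (simp add: stationary K_def[abs_def])

lemma form_add_left:
  assumes "bounded (f ` S)" "bounded (f' ` S)" "bounded (g ` S)"
  shows "form (\<lambda>\<eta>. f \<eta> + f' \<eta>) g = form f g + form f' g"
  unfolding form_def distrib_right
  by (rule Bochner_Integration.integral_add; intro pmf_integrable_bounded bounded_comps bounded_K assms)

lemma form_scale_left: "form (\<lambda>\<eta>. c * f \<eta>) g = c * form f g"
  by (simp add: form_def mult.assoc)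

lemma form_add_right:
  assumes "bounded (f ` S)" "bounded (g ` S)" "bounded (g' ` S)"
  shows "form f (\<lambda>\<eta>. g \<eta> + g' \<eta>) = form f g + form f g'"
proof -
  have "form f (\<lambda>\<eta>. g \<eta> + g' \<eta>) =
      measure_pmf.expectation m (\<lambda>\<eta>. f \<eta> * (K g \<eta> - g \<eta>) + f \<eta> * (K g' \<eta> - g' \<eta>))"
    unfolding form_def by (rule pmf_expectation_cong) (simp add: K_add assms algebra_simps)
  also have "\<dots> = form f g + form f g'"
    unfolding form_def
    by (rule Bochner_Integration.integral_add; intro pmf_integrable_bounded bounded_comps bounded_K assms)
  finally show ?thesis .
qed

lemma form_scale_right: "form f (\<lambda>\<eta>. c * g \<eta>) = c * form f g"
proof -
  have "form f (\<lambda>\<eta>. c * g \<eta>) = measure_pmf.expectation m (\<lambda>\<eta>. c * (f \<eta> * (K g \<eta> - g \<eta>)))"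
    unfolding form_def K_scale by (rule pmf_expectation_cong) (simp add: algebra_simps)
  thus ?thesis by (simp add: form_def)
qed

text \<open>Expand the square under \<open>J\<close>. Integrated against \<open>m\<close>, the
  contributions of \<open>K\<close> applied to the squared function and of the squared function
  itself cancel by stationarity, and only the cross term is left.\<close>

lemma form_self:
  assumes f: "bounded (f ` S)"
  shows "form f f = - (1/2) *
    measure_pmf.expectation m (\<lambda>\<eta>. measure_pmf.expectation (J \<eta>) (\<lambda>\<xi>. (f \<xi> - f \<eta>)\<^sup>2))"
proof -
  let ?f2 = "\<lambda>\<eta>. f \<eta> * f \<eta>"
  have f2: "bounded (?f2 ` S)" using f by (intro bounded_comps)
  note int = pmf_integrable_bounded bounded_comps bounded_K f f2
  have "measure_pmf.expectation (J \<eta>) (\<lambda>\<xi>. (f \<xi> - f \<eta>)\<^sup>2) =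
      K ?f2 \<eta> - ?f2 \<eta> - 2 * (f \<eta> * (K f \<eta> - f \<eta>))" if "\<eta> \<in> S" for \<eta>
  proof -
    have "measure_pmf.expectation (J \<eta>) (\<lambda>\<xi>. (f \<xi> - f \<eta>)\<^sup>2) =
        measure_pmf.expectation (J \<eta>) (\<lambda>\<xi>. (f \<xi> * f \<xi> + (- 2 * f \<eta>) * f \<xi>) + f \<eta> * f \<eta>)"
      by (simp add: power2_eq_square algebra_simps)
    also have "\<dots> = K ?f2 \<eta> + (- 2 * f \<eta>) * K f \<eta> + f \<eta> * f \<eta>"
      unfolding K_def using that f f2 by (simp add: integrable_J)
    finally show ?thesis by (simp add: algebra_simps)
  qed
  hence "measure_pmf.expectation m (\<lambda>\<eta>. measure_pmf.expectation (J \<eta>) (\<lambda>\<xi>. (f \<xi> - f \<eta>)\<^sup>2)) =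
      measure_pmf.expectation m (\<lambda>\<eta>. K ?f2 \<eta> - ?f2 \<eta> - 2 * (f \<eta> * (K f \<eta> - f \<eta>)))"
    by (rule pmf_expectation_cong)
  also have "\<dots> = measure_pmf.expectation m (\<lambda>\<eta>. K ?f2 \<eta> - ?f2 \<eta>) -
      measure_pmf.expectation m (\<lambda>\<eta>. 2 * (f \<eta> * (K f \<eta> - f \<eta>)))"
    by (rule Bochner_Integration.integral_diff) (intro int bounded_const_comp)+
  also have "\<dots> = measure_pmf.expectation m (K ?f2) - measure_pmf.expectation m ?f2 - 2 * form f f"
    unfolding form_def
    by (subst Bochner_Integration.integral_diff) (intro int, intro int, simp)
  also have "\<dots> = - 2 * form f f"
    using expectation_K[OF f2] by simp
  finally show ?thesis by simp
qed

lemma form_self_nonpos: "bounded (f ` S) \<Longrightarrow> form f f \<le> 0"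
  by (simp add: form_self integral_nonneg_AE)

text \<open>By \<open>form_self\<close> a nonnegative double integral vanishes, so \<open>f\<close>
  takes the same value at both ends of every possible jump, and \<open>connected\<close>
  applies.\<close>

lemma form_self_eq_0_imp_const:
  assumes f: "bounded (f ` S)" and z: "form f f = 0"
  shows "\<exists>c. \<forall>\<eta>\<in>S. f \<eta> = c"
proof (rule connected)
  fix \<eta> \<xi> assume \<eta>: "\<eta> \<in> S" and \<xi>: "\<xi> \<in> set_pmf (J \<eta>)"
  let ?V = "\<lambda>\<eta>. measure_pmf.expectation (J \<eta>) (\<lambda>\<xi>. (f \<xi> - f \<eta>)\<^sup>2)"
  obtain B where B: "\<And>x. x \<in> S \<Longrightarrow> \<bar>f x\<bar> \<le> B"
    using f unfolding bounded_real_image_iff by blast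
  have sq: "\<bar>(f \<xi> - f \<eta>)\<^sup>2\<bar> \<le> (2 * B)\<^sup>2" if "\<xi> \<in> S" "\<eta> \<in> S" for \<xi> \<eta>
  proof -
    have "\<bar>f \<xi> - f \<eta>\<bar> \<le> 2 * B"
      using B[OF that(1)] B[OF that(2)] by linarith
    hence "\<bar>f \<xi> - f \<eta>\<bar>\<^sup>2 \<le> (2 * B)\<^sup>2"
      by (rule power_mono) simp
    thus ?thesis by simp
  qed
  have "integrable (measure_pmf m) ?V"
  proof (rule pmf_integrable_bounded)
    show "bounded (?V ` S)"
      unfolding bounded_real_image_iff
      by (intro exI[of _ "(2 * B)\<^sup>2"] ballI pmf_expectation_abs_le sq) (use J_subset in auto)
  qed
  moreover have "measure_pmf.expectation m ?V = 0"
    using form_self[OF f] z by simp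
  ultimately have "AE \<eta> in m. ?V \<eta> = 0"
    by (subst (asm) integral_nonneg_eq_0_iff_AE) (auto intro!: AE_I2 integral_nonneg_AE)
  hence "?V \<eta> = 0"
    using \<eta> by (simp add: AE_measure_pmf_iff)
  moreover have "integrable (measure_pmf (J \<eta>)) (\<lambda>\<xi>. (f \<xi> - f \<eta>)\<^sup>2)"
    by (rule pmf_integrable_bounded) (use sq J_subset \<eta> bounded_real_image_iff in blast)
  ultimately have "AE \<xi> in J \<eta>. (f \<xi> - f \<eta>)\<^sup>2 = 0"
    by (subst (asm) integral_nonneg_eq_0_iff_AE) auto
  thus "f \<xi> = f \<eta>"
    using \<xi> by (simp add: AE_measure_pmf_iff)
qed

text \<open>An energy argument in place of a maximum principle: in \<open>v * (K v - v)\<close> the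
  first factor vanishes on \<open>D\<close> and the second off \<open>D\<close>, so
  \<open>form v v = 0\<close>. Hence \<open>v\<close> is constant, and the constant is 0 since
  \<open>D\<close> meets the support.\<close>

lemma harmonic_off_unique:
  assumes v: "bounded (v ` S)" and D: "D \<inter> S \<noteq> {}"
    and zero: "\<And>\<eta>. \<eta> \<in> S \<inter> D \<Longrightarrow> v \<eta> = 0"
    and harmonic: "\<And>\<eta>. \<eta> \<in> S - D \<Longrightarrow> K v \<eta> = v \<eta>"
    and \<eta>: "\<eta> \<in> S"
  shows "v \<eta> = 0"
proof -
  have "form v v = measure_pmf.expectation m (\<lambda>\<eta>. 0)"
    unfolding form_def by (rule pmf_expectation_cong) (use zero harmonic in force)
  hence "form v v = 0" by simp
  from form_self_eq_0_imp_const[OF v this] D zero \<eta> show ?thesis by fastforce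
qed

end

text \<open>Drawing the second coordinate and then the pair conditionally on it restores the joint
  law. This is what defines the transitions of the reversed chain.\<close>

lemma pmf_disintegration:
  fixes Q :: "('a \<times> 'b) pmf"
  shows "bind_pmf (map_pmf snd Q) (\<lambda>b. cond_pmf Q {z. b = snd z}) = Q"
proof (rule bind_cond_pmf_cancel)
  fix x y assume xy: "x \<in> set_pmf (map_pmf snd Q)" "y \<in> set_pmf Q" "x = snd y"
  have *: "{z. x = snd z} = snd -` {x}" "{x'. x' = snd y} = {x}" using xy(3) by auto
  show "measure Q {z. x = snd z} = measure (map_pmf snd Q) {x. x = snd y}"
    unfolding * by simp
qed force+

section \<open>Time reversal, hitting probabilities, equilibrium potentials and the saddle
  point\<close>

context stationary_chain
begin

text \<open>The chain \<open>J'\<close> is the time reversal: its transition law from a state is the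
  conditional law of the present state given the next one, in stationarity. Its kernel is the
  adjoint of \<open>K\<close> with respect to \<open>m\<close>.\<close>

lemma dual_chain:
  obtains J' where "stationary_chain m J'"
    and "\<And>f g. bounded (f ` S) \<Longrightarrow> bounded (g ` S) \<Longrightarrow> form f g = stationary_chain.form m J' g f"
proof -
  \<comment> \<open>Joint law of two consecutive states of the stationary chain; both marginals are
    \<open>m\<close>.\<close>
  define Q where "Q = bind_pmf m (\<lambda>\<eta>. map_pmf (Pair \<eta>) (J \<eta>))"
  have fst_Q: "map_pmf fst Q = m"
    by (simp add: Q_def map_bind_pmf pmf.map_comp o_def map_pmf_const bind_return_pmf')
  have snd_Q: "map_pmf snd Q = m"
    by (simp add: Q_def map_bind_pmf pmf.map_comp o_def stationary)
  have set_Q: "set_pmf Q = {(\<eta>, \<xi>). \<eta> \<in> S \<and> \<xi> \<in> set_pmf (J \<eta>)}"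
    by (auto simp: Q_def)
  define J' where "J' = (\<lambda>\<xi>. map_pmf fst (cond_pmf Q {z. \<xi> = snd z}))"
  have dis: "bind_pmf m (\<lambda>b. cond_pmf Q {z. b = snd z}) = Q"
    using pmf_disintegration[of Q] by (simp add: snd_Q)
  have ne: "set_pmf Q \<inter> {z. \<xi> = snd z} \<noteq> {}" if "\<xi> \<in> S" for \<xi>
    using that snd_Q by (metis (mono_tags, lifting) IntI empty_iff imageE mem_Collect_eq set_map_pmf)
  have stat': "bind_pmf m J' = m"
    unfolding J'_def map_bind_pmf[symmetric] dis fst_Q ..
  have chain': "stationary_chain m J'"
  proof
    show "bind_pmf m J' = m" by (fact stat')
    fix v :: "'a \<Rightarrow> real"
    assume v: "\<And>\<eta> \<xi>. \<eta> \<in> S \<Longrightarrow> \<xi> \<in> set_pmf (J' \<eta>) \<Longrightarrow> v \<xi> = v \<eta>"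
    show "\<exists>c. \<forall>\<eta>\<in>S. v \<eta> = c"
    \<comment> \<open>Every jump of \<open>J\<close> is a jump of \<open>J'\<close> in the opposite
      direction, so a function constant along the jumps of \<open>J'\<close> is constant along those
      of \<open>J\<close>.\<close>
    proof (rule connected)
      fix \<eta> \<xi> assume *: "\<eta> \<in> S" "\<xi> \<in> set_pmf (J \<eta>)"
      hence \<xi>: "\<xi> \<in> S" using J_subset by blast
      have "\<eta> \<in> set_pmf (J' \<xi>)"
        using * by (force simp: J'_def set_cond_pmf[OF ne[OF \<xi>]] set_Q)
      from v[OF \<xi> this] show "v \<xi> = v \<eta>" by simp
    qed
  qed
  interpret dual: stationary_chain m J' by (fact chain')
  \<comment> \<open>The expectation of \<open>f (fst z) * g (snd z)\<close> under \<open>Q\<close>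
    is computed twice, by conditioning on the first and on the second coordinate.\<close>
  have adj: "measure_pmf.expectation m (\<lambda>\<eta>. f \<eta> * K g \<eta>) =
      measure_pmf.expectation m (\<lambda>\<eta>. g \<eta> * dual.K f \<eta>)"
    if f: "bounded (f ` S)" and g: "bounded (g ` S)" for f g
  proof -
    let ?F = "\<lambda>z. f (fst z) * g (snd z)"
    have fz: "bounded ((\<lambda>z. f (fst z)) ` set_pmf Q)"
      using f by (rule bounded_subset) (auto simp: set_Q)
    have gz: "bounded ((\<lambda>z. g (snd z)) ` set_pmf Q)"
      using g by (rule bounded_subset) (use J_subset in \<open>fastforce simp: set_Q\<close>)
    have F: "bounded (?F ` set_pmf Q)"
      using fz gz by (rule bounded_times_comp)
    have "measure_pmf.expectation Q ?F =
        measure_pmf.expectation m (\<lambda>\<eta>. measure_pmf.expectation (map_pmf (Pair \<eta>) (J \<eta>)) ?F)"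
      unfolding Q_def by (rule pmf_expectation_bind_bounded) (use F Q_def in simp)
    also have "\<dots> = measure_pmf.expectation m (\<lambda>\<eta>. f \<eta> * K g \<eta>)"
      by (simp add: K_def)
    finally have 1: "measure_pmf.expectation Q ?F = \<dots>" .
    have "measure_pmf.expectation Q ?F =
        measure_pmf.expectation m (\<lambda>\<xi>. measure_pmf.expectation (cond_pmf Q {z. \<xi> = snd z}) ?F)"
      using pmf_expectation_bind_bounded[of ?F m "\<lambda>b. cond_pmf Q {z. b = snd z}"] F
      by (simp add: dis)
    also have "\<dots> = measure_pmf.expectation m (\<lambda>\<eta>. g \<eta> * dual.K f \<eta>)"
    proof (rule pmf_expectation_cong)
      fix \<xi> assume \<xi>: "\<xi> \<in> S"
      have "measure_pmf.expectation (cond_pmf Q {z. \<xi> = snd z}) ?F =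
          measure_pmf.expectation (cond_pmf Q {z. \<xi> = snd z}) (\<lambda>z. g \<xi> * f (fst z))"
        by (rule pmf_expectation_cong) (simp add: set_cond_pmf[OF ne[OF \<xi>]])
      thus "measure_pmf.expectation (cond_pmf Q {z. \<xi> = snd z}) ?F = g \<xi> * dual.K f \<xi>"
        unfolding dual.K_def unfolding J'_def by simp
    qed
    finally show ?thesis using 1 by simp
  qed
  have "form f g = dual.form g f"
    if f: "bounded (f ` S)" and g: "bounded (g ` S)" for f g
  proof -
    have "form f g = measure_pmf.expectation m (\<lambda>\<eta>. f \<eta> * K g \<eta>) -
        measure_pmf.expectation m (\<lambda>\<eta>. f \<eta> * g \<eta>)"
      unfolding form_def right_diff_distrib
      by (rule Bochner_Integration.integral_diff;
          intro pmf_integrable_bounded bounded_comps bounded_K f g)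
    moreover have "dual.form g f = measure_pmf.expectation m (\<lambda>\<eta>. g \<eta> * dual.K f \<eta>) -
        measure_pmf.expectation m (\<lambda>\<eta>. g \<eta> * f \<eta>)"
      unfolding dual.form_def right_diff_distrib
      by (rule Bochner_Integration.integral_diff;
          intro pmf_integrable_bounded bounded_comps dual.bounded_K f g)
    ultimately show ?thesis
      using adj[OF f g] by (simp add: mult.commute)
  qed
  with chain' that show thesis by blast
qed

text \<open>Both sides are bounded, harmonic off \<open>D\<close> and equal on \<open>D\<close>, so
  \<open>harmonic_off_unique\<close> applies to their difference.\<close>

lemma hit_prob_Un:
  assumes "B \<inter> C = {}" "D \<inter> S \<noteq> {}" "\<eta> \<in> S"
  shows "hit_prob D (B \<union> C) \<eta> = hit_prob D B \<eta> + hit_prob D C \<eta>"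
proof -
  let ?v = "\<lambda>\<eta>. hit_prob D (B \<union> C) \<eta> - (hit_prob D B \<eta> + hit_prob D C \<eta>)"
  have "?v \<eta> = 0"
  proof (rule harmonic_off_unique)
    show "bounded (?v ` S)" by (intro bounded_comps bounded_hit_prob)
    show "?v \<eta> = 0" if "\<eta> \<in> S \<inter> D" for \<eta>
      using that assms(1) by (auto simp: hit_prob_on indicator_def)
    show "K ?v \<eta> = ?v \<eta>" if "\<eta> \<in> S - D" for \<eta>
      using that by (subst K_diff; (intro bounded_comps bounded_hit_prob)?)
        (simp_all add: K_add K_hit_prob_off)
  qed (use assms in auto)
  thus ?thesis by simp
qed

lemma hit_prob_empty:
  assumes "D \<inter> S \<noteq> {}" "\<eta> \<in> S"
  shows "hit_prob D {} \<eta> = 0"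
  using hit_prob_Un[of "{}" "{}" D \<eta>] assms by simp

lemma hit_prob_UN:
  assumes "finite I" "disjoint_family_on X I" "D \<inter> S \<noteq> {}" "\<eta> \<in> S"
  shows "hit_prob D (\<Union>i\<in>I. X i) \<eta> = (\<Sum>i\<in>I. hit_prob D (X i) \<eta>)"
  using assms(1,2)
proof (induction I)
  case empty
  thus ?case using hit_prob_empty assms(3,4) by simp
next
  case (insert i I)
  have "X i \<inter> (\<Union>i\<in>I. X i) = {}"
    using insert.hyps insert.prems by (auto simp: disjoint_family_on_def)
  moreover have "disjoint_family_on X I"
    using insert.prems by (auto simp: disjoint_family_on_def)
  ultimately show ?case
    using insert assms(3,4) by (simp add: hit_prob_Un)
qed

text \<open>This says that \<open>D\<close> is hit almost surely. Recurrence enters through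
  uniqueness of the bounded harmonic extension, since the constant 1 has the same values on
  \<open>D\<close>.\<close>

lemma hit_prob_self:
  assumes "D \<inter> S \<noteq> {}" "\<eta> \<in> S"
  shows "hit_prob D D \<eta> = 1"
proof -
  let ?v = "\<lambda>\<eta>. hit_prob D D \<eta> - 1"
  have "?v \<eta> = 0"
  proof (rule harmonic_off_unique)
    show "bounded (?v ` S)" by (intro bounded_comps bounded_hit_prob bounded_const_comp)
    show "K ?v \<eta> = ?v \<eta>" if "\<eta> \<in> S - D" for \<eta>
      using that by (subst K_diff) (simp_all add: K_hit_prob_off)
  qed (use assms in \<open>auto simp: hit_prob_on\<close>)
  thus ?thesis by simp
qed

text \<open>Probability that the stationary chain starts in \<open>A\<close> and that its next visit
  to \<open>D\<close>, after at least one step, takes place in \<open>B\<close>. The outer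
  \<open>K\<close> performs the first step, so that a start in \<open>D\<close> is not itself
  counted as the visit.\<close>

definition flux :: "'a set \<Rightarrow> 'a set \<Rightarrow> 'a set \<Rightarrow> real" where
  "flux D A B = measure_pmf.expectation m (\<lambda>\<eta>. indicator A \<eta> * K (hit_prob D B) \<eta>)"

text \<open>The potential with value 1 on \<open>B\<close>, 0 on the rest of \<open>D\<close>
  outside \<open>A\<close>, and on \<open>A\<close> the constant that makes the total flux out of
  \<open>A\<close> vanish. If the denominator is 0, the convention for division makes this constant
  0.\<close>

definition equilibrium :: "'a set \<Rightarrow> 'a set \<Rightarrow> 'a set \<Rightarrow> 'a \<Rightarrow> real" where
  "equilibrium D A B \<eta> = hit_prob D B \<eta> + flux D A B / flux D A (D - A) * hit_prob D A \<eta>"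

lemma bounded_equilibrium [simp]: "bounded (equilibrium D A B ` S)"
  unfolding equilibrium_def by (intro bounded_comps bounded_hit_prob bounded_const_comp)

lemma flux_nonneg: "0 \<le> flux D A B"
  unfolding flux_def K_def using hit_prob_bounds
  by (intro integral_nonneg_AE AE_I2 mult_nonneg_nonneg) auto

lemma integrable_flux: "integrable (measure_pmf m) (\<lambda>\<eta>. indicator A \<eta> * K (hit_prob D B) \<eta>)"
  by (intro pmf_integrable_bounded bounded_comps bounded_K) auto

text \<open>Needed in the degenerate case of the quotient in \<open>equilibrium\<close>: if the flux
  from \<open>A\<close> to \<open>D - A\<close> is 0, then so is the flux from \<open>A\<close> to
  \<open>B\<close>.\<close>

lemma flux_mono:
  assumes "B \<subseteq> C" "D \<inter> S \<noteq> {}"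
  shows "flux D A B \<le> flux D A C"
  unfolding flux_def
proof (rule integral_mono_AE[OF integrable_flux integrable_flux])
  have "hit_prob D B \<xi> \<le> hit_prob D C \<xi>" if "\<xi> \<in> S" for \<xi>
  proof -
    have "hit_prob D (B \<union> (C - B)) \<xi> = hit_prob D B \<xi> + hit_prob D (C - B) \<xi>"
      using assms that by (intro hit_prob_Un) auto
    moreover have "B \<union> (C - B) = C" using assms by auto
    ultimately show ?thesis using hit_prob_bounds(1)[of D "C - B" \<xi>] by simp
  qed
  hence "K (hit_prob D B) \<eta> \<le> K (hit_prob D C) \<eta>" if "\<eta> \<in> S" for \<eta>
    using that by (intro K_mono) auto
  thus "AE \<eta> in m. indicator A \<eta> * K (hit_prob D B) \<eta> \<le> indicator A \<eta> * K (hit_prob D C) \<eta>"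
    by (auto simp: AE_measure_pmf_iff indicator_def)
qed

lemma flux_UN:
  assumes "finite I" "disjoint_family_on X I" "D \<inter> S \<noteq> {}"
  shows "flux D A (\<Union>i\<in>I. X i) = (\<Sum>i\<in>I. flux D A (X i))"
proof -
  have "flux D A (\<Union>i\<in>I. X i) =
      measure_pmf.expectation m (\<lambda>\<eta>. \<Sum>i\<in>I. indicator A \<eta> * K (hit_prob D (X i)) \<eta>)"
    unfolding flux_def
  proof (rule pmf_expectation_cong)
    fix \<eta> assume \<eta>: "\<eta> \<in> S"
    have "K (hit_prob D (\<Union>i\<in>I. X i)) \<eta> = K (\<lambda>\<xi>. \<Sum>i\<in>I. hit_prob D (X i) \<xi>) \<eta>"
      using hit_prob_UN[OF assms] \<eta> by (rule K_cong)
    also have "\<dots> = (\<Sum>i\<in>I. K (hit_prob D (X i)) \<eta>)"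
      unfolding K_def using \<eta> by (intro Bochner_Integration.integral_sum integrable_J) auto
    finally show "indicator A \<eta> * K (hit_prob D (\<Union>i\<in>I. X i)) \<eta> =
        (\<Sum>i\<in>I. indicator A \<eta> * K (hit_prob D (X i)) \<eta>)"
      by (simp add: sum_distrib_left)
  qed
  also have "\<dots> = (\<Sum>i\<in>I. flux D A (X i))"
    unfolding flux_def by (intro Bochner_Integration.integral_sum integrable_flux)
  finally show ?thesis .
qed

lemma equilibrium_on:
  assumes "A \<inter> B = {}" "\<eta> \<in> D"
  shows "equilibrium D A B \<eta> =
    indicator B \<eta> + flux D A B / flux D A (D - A) * indicator A \<eta>"
  using assms by (simp add: equilibrium_def hit_prob_on)

lemma K_equilibrium:
  assumes "\<eta> \<in> S"
  shows "K (equilibrium D A B) \<eta> =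
    K (hit_prob D B) \<eta> + flux D A B / flux D A (D - A) * K (hit_prob D A) \<eta>"
proof -
  have "bounded ((\<lambda>\<eta>. flux D A B / flux D A (D - A) * hit_prob D A \<eta>) ` S)"
    by (intro bounded_comps) auto
  thus ?thesis
    unfolding equilibrium_def[abs_def] using assms by (subst K_add) (simp_all only: K_scale bounded_hit_prob)
qed

lemma K_equilibrium_off: "\<eta> \<in> S - D \<Longrightarrow> K (equilibrium D A B) \<eta> = equilibrium D A B \<eta>"
  by (simp add: K_equilibrium K_hit_prob_off) (simp add: equilibrium_def)

text \<open>Since \<open>D\<close> is hit almost surely, a return to \<open>A\<close> has
  probability one minus that of a return to \<open>D - A\<close>. On \<open>A\<close>, with
  \<open>a\<close> the value of the potential there, \<open>K V - V\<close> thus becomes the return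
  probability to \<open>B\<close> minus \<open>a\<close> times that to \<open>D - A\<close>;
  integrating gives zero by the choice of \<open>a\<close>.\<close>

lemma equilibrium_flux_zero:
  assumes AB: "A \<inter> B = {}" "A \<subseteq> D" "B \<subseteq> D" "D \<subseteq> S"
  shows "form (indicator A) (equilibrium D A B) = 0"
proof (cases "D = {}")
  case True
  thus ?thesis using AB by (simp add: form_def)
next
  case False
  hence D: "D \<inter> S \<noteq> {}" using AB by auto
  define a where "a = flux D A B / flux D A (D - A)"
  have "form (indicator A) (equilibrium D A B) =
      measure_pmf.expectation m (\<lambda>\<eta>. indicator A \<eta> * K (hit_prob D B) \<eta> -
        a * (indicator A \<eta> * K (hit_prob D (D - A)) \<eta>))"
    unfolding form_def
  proof (rule pmf_expectation_cong)
    fix \<eta> assume \<eta>: "\<eta> \<in> S"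
    have "hit_prob D A \<xi> = 1 - hit_prob D (D - A) \<xi>" if "\<xi> \<in> S" for \<xi>
    proof -
      have "hit_prob D (A \<union> (D - A)) \<xi> = hit_prob D A \<xi> + hit_prob D (D - A) \<xi>"
        using D that by (intro hit_prob_Un) auto
      moreover have "A \<union> (D - A) = D" using AB by auto
      ultimately show ?thesis using hit_prob_self[OF D that] by simp
    qed
    hence "K (hit_prob D A) \<eta> = K (\<lambda>\<xi>. 1 - hit_prob D (D - A) \<xi>) \<eta>"
      using \<eta> by (intro K_cong)
    also have "\<dots> = 1 - K (hit_prob D (D - A)) \<eta>"
      using \<eta> by (subst K_diff) auto
    finally have KA: "K (hit_prob D A) \<eta> = 1 - K (hit_prob D (D - A)) \<eta>" .
    have "equilibrium D A B \<eta> = a" if "\<eta> \<in> A"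
      using equilibrium_on[of A B \<eta> D] that AB by (simp add: a_def indicator_def subset_iff disjoint_iff)
    thus "indicator A \<eta> * (K (equilibrium D A B) \<eta> - equilibrium D A B \<eta>) =
        indicator A \<eta> * K (hit_prob D B) \<eta> - a * (indicator A \<eta> * K (hit_prob D (D - A)) \<eta>)"
      using \<eta> by (cases "\<eta> \<in> A") (simp_all add: K_equilibrium KA a_def[symmetric] algebra_simps)
  qed
  also have "\<dots> = flux D A B - a * flux D A (D - A)"
    unfolding flux_def
    by (subst Bochner_Integration.integral_diff) (simp_all add: integrable_flux)
  also have "\<dots> = 0"
  proof (cases "flux D A (D - A) = 0")
    case True
    moreover have "flux D A B \<le> flux D A (D - A)"
      using AB D by (intro flux_mono) auto
    ultimately show ?thesis using flux_nonneg[of D A B] by simp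
  qed (simp add: a_def)
  finally show ?thesis .
qed

text \<open>The factor \<open>K V - V\<close> vanishes off \<open>D\<close>, the function
  \<open>k\<close> vanishes on \<open>D - (A \<union> B)\<close>, and on \<open>A\<close> the
  constant \<open>\<alpha>\<close> multiplies a flux equal to 0. So only the value on
  \<open>B\<close> survives.\<close>

lemma form_equilibrium:
  assumes AB: "A \<inter> B = {}" "A \<subseteq> D" "B \<subseteq> D" "D \<subseteq> S"
    and k: "\<And>\<eta>. \<eta> \<in> A \<Longrightarrow> k \<eta> = \<alpha>" "\<And>\<eta>. \<eta> \<in> B \<Longrightarrow> k \<eta> = \<beta>"
      "\<And>\<eta>. \<eta> \<in> D - (A \<union> B) \<Longrightarrow> k \<eta> = 0"
  shows "form k (equilibrium D A B) = \<beta> * form (indicator B) (equilibrium D A B)"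
proof -
  let ?V = "equilibrium D A B"
  have "form k ?V = form (\<lambda>\<eta>. \<alpha> * indicator A \<eta> + \<beta> * indicator B \<eta>) ?V"
    unfolding form_def
  proof (rule pmf_expectation_cong)
    fix \<eta> assume "\<eta> \<in> S"
    thus "k \<eta> * (K ?V \<eta> - ?V \<eta>) =
        (\<alpha> * indicator A \<eta> + \<beta> * indicator B \<eta>) * (K ?V \<eta> - ?V \<eta>)"
      using AB k K_equilibrium_off[of \<eta> D A B]
      by (cases "\<eta> \<in> A"; cases "\<eta> \<in> B"; cases "\<eta> \<in> D") (auto simp: indicator_def)
  qed
  also have "\<dots> = \<alpha> * form (indicator A) ?V + \<beta> * form (indicator B) ?V"
    by (subst form_add_left) (simp_all add: form_scale_left bounded_times_comp)
  finally show ?thesis using equilibrium_flux_zero[OF AB] by simp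
qed

text \<open>The fourth conclusion is the vanishing, at \<open>h0\<close> and in the direction
  \<open>h\<close>, of the first variation of \<open>2 * form f0 h + form h h\<close>. The fifth
  says that at \<open>h0\<close> this functional does not depend on the admissible
  \<open>f\<close>.\<close>

lemma saddle_point:
  assumes AB: "A \<inter> B = {}" "A \<subseteq> D" "B \<subseteq> D" "D \<subseteq> S"
  obtains f0 h0 where "f0 \<in> outer_functions S D A B" "h0 \<in> inner_functions S D A B"
    "\<And>\<eta>. \<eta> \<in> A \<Longrightarrow> h0 \<eta> = - (flux D A B / flux D A (D - A))"
    "\<And>h. h \<in> inner_functions S D A B \<Longrightarrow>
       2 * form f0 h + form h h0 + form h0 h = 0"
    "\<And>f. f \<in> outer_functions S D A B \<Longrightarrow> form f h0 = form f0 h0"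
proof -
  obtain J' where J': "stationary_chain m J'"
    and adj: "\<And>f g. bounded (f ` S) \<Longrightarrow> bounded (g ` S) \<Longrightarrow>
      form f g = stationary_chain.form m J' g f"
    using dual_chain by blast
  interpret dual: stationary_chain m J' by (fact J')
  define V where "V = equilibrium D A B"
  define V' where "V' = dual.equilibrium D A B"
  define f0 where "f0 = (\<lambda>\<eta>. (1/2) * V \<eta> + (1/2) * V' \<eta>)"
  define h0 where "h0 = (\<lambda>\<eta>. (-1) * V \<eta>)"
  define a where "a = flux D A B / flux D A (D - A)"
  define a' where "a' = dual.flux D A B / dual.flux D A (D - A)"
  have V_bdd [simp]: "bounded (V ` S)" "bounded (V' ` S)"
    by (simp_all add: V_def V'_def)
  have V_on: "V \<eta> = indicator B \<eta> + a * indicator A \<eta>"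
      "V' \<eta> = indicator B \<eta> + a' * indicator A \<eta>" if "\<eta> \<in> D" for \<eta>
    using equilibrium_on[of A B \<eta> D] dual.equilibrium_on[of A B \<eta> D] that AB
    by (simp_all add: V_def V'_def a_def a'_def)
  have f0: "bounded (f0 ` S)" unfolding f0_def by (intro bounded_comps) auto
  have h0: "bounded (h0 ` S)" unfolding h0_def by (intro bounded_comps) auto
  have V_A: "V \<eta> = a" if "\<eta> \<in> A" for \<eta>
    using V_on(1)[of \<eta>] that AB by (simp add: indicator_def subset_iff disjoint_iff)
  have V'_A: "V' \<eta> = a'" if "\<eta> \<in> A" for \<eta>
    using V_on(2)[of \<eta>] that AB by (simp add: indicator_def subset_iff disjoint_iff)
  have V_B: "V \<eta> = 1" "V' \<eta> = 1" if "\<eta> \<in> B" for \<eta>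
  proof -
    have "\<eta> \<in> D" "\<eta> \<notin> A" using that AB by auto
    thus "V \<eta> = 1" "V' \<eta> = 1" using V_on[of \<eta>] that by (simp_all add: indicator_def)
  qed
  have V_C: "V \<eta> = 0" "V' \<eta> = 0" if "\<eta> \<in> D - (A \<union> B)" for \<eta>
    using V_on[of \<eta>] that AB by (auto simp: indicator_def)
  have f0_outer: "f0 \<in> outer_functions S D A B"
    using f0 V_A V'_A V_B V_C unfolding outer_functions_def
    by (auto simp: f0_def intro!: exI[of _ "(1/2) * a + (1/2) * a'"])
  have h0_inner: "h0 \<in> inner_functions S D A B"
    using h0 V_A V_B V_C unfolding inner_functions_def
    by (auto simp: h0_def)
  have *: "form V' V = form (indicator B) V"
    using form_equilibrium[OF AB, of V' a' 1] V'_A V_B V_C by (auto simp: V_def)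
  have **: "dual.form V V' = dual.form (indicator B) V'"
    using dual.form_equilibrium[OF AB, of V a 1] V_A V_B V_C by (auto simp: V'_def)
  \<comment> \<open>Both one-sided fluxes out of \<open>B\<close> are equal to \<open>form V' V\<close>.\<close>
  have flux_eq: "form (indicator B) V = dual.form (indicator B) V'"
    using * ** adj[of V' V] by simp
  \<comment> \<open>Twice \<open>f0\<close> is \<open>V + V'\<close>. The term
    \<open>form V h\<close> cancels \<open>form h0 h\<close>; adjointness turns
    \<open>form V' h\<close> into \<open>\<beta>\<close> times the reversed flux out of
    \<open>B\<close>, and this cancels \<open>form h h0\<close> by \<open>flux_eq\<close>.\<close>
  have crit: "2 * form f0 h + form h h0 + form h0 h = 0" if h: "h \<in> inner_functions S D A B" for h
  proof -
    obtain \<alpha> \<beta> where h': "bounded (h ` S)" "\<And>\<eta>. \<eta> \<in> A \<Longrightarrow> h \<eta> = \<alpha>" "\<And>\<eta>. \<eta> \<in> B \<Longrightarrow> h \<eta> = \<beta>"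
        "\<And>\<eta>. \<eta> \<in> D - (A \<union> B) \<Longrightarrow> h \<eta> = 0"
      using h unfolding inner_functions_def by auto
    have "form f0 h = (1/2) * form V h + (1/2) * form V' h"
      unfolding f0_def using h'(1)
      by (subst form_add_left; (intro bounded_times_comp bounded_const_comp V_bdd)?)
        (simp_all only: form_scale_left)
    moreover have "form V' h = \<beta> * dual.form (indicator B) V'"
      using adj[of V' h] h'(1) dual.form_equilibrium[OF AB h'(2,3,4)] by (simp add: V'_def)
    moreover have "form h h0 = - (\<beta> * form (indicator B) V)"
      unfolding h0_def form_scale_right using form_equilibrium[OF AB h'(2,3,4)] by (simp add: V_def)
    moreover have "form h0 h = - form V h"
      unfolding h0_def form_scale_left by simp
    ultimately show ?thesis using flux_eq by simp
  qed
  have outer: "form f h0 = - form (indicator B) V" if f: "f \<in> outer_functions S D A B" for f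
  proof -
    obtain \<alpha> where "bounded (f ` S)" "\<And>\<eta>. \<eta> \<in> A \<Longrightarrow> f \<eta> = \<alpha>" "\<And>\<eta>. \<eta> \<in> B \<Longrightarrow> f \<eta> = 1"
        "\<And>\<eta>. \<eta> \<in> D - (A \<union> B) \<Longrightarrow> f \<eta> = 0"
      using f unfolding outer_functions_def by auto
    thus ?thesis
      unfolding h0_def form_scale_right using form_equilibrium[OF AB, of f \<alpha> 1] by (simp add: V_def)
  qed
  have val: "h0 \<eta> = - (flux D A B / flux D A (D - A))" if "\<eta> \<in> A" for \<eta>
    using V_A[OF that] by (simp add: h0_def a_def)
  have indep: "form f h0 = form f0 h0" if "f \<in> outer_functions S D A B" for f
    using outer[OF that] outer[OF f0_outer] by simp
  show thesis
    by (rule that[OF f0_outer h0_inner val crit indep])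
qed

text \<open>At \<open>h0\<close> every admissible \<open>f\<close> gives the same value
  \<open>c\<close>, so all inner suprema are at least \<open>c\<close>; for \<open>f0\<close>
  concavity makes \<open>c\<close> the maximum. Hence the infimum is \<open>c\<close>, every optimal
  \<open>f\<close> has inner supremum \<open>c\<close>, and \<open>h0\<close> attains it. Uniqueness
  is proved for an arbitrary optimal \<open>f\<close>, not only for \<open>f0\<close>.\<close>

lemma variational_problem:
  assumes AB: "A \<inter> B = {}" "A \<subseteq> D" "B \<subseteq> D" "D \<subseteq> S" and Z: "Z > 0"
    and obj: "\<And>f h. bounded (f ` S) \<Longrightarrow> bounded (h ` S) \<Longrightarrow>
      objective S R \<mu> f h = Z * (2 * form f h + form h h)"
  shows "\<exists>f. optimal_f S R \<mu> D A B f"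
    and "optimal_f S R \<mu> D A B f \<Longrightarrow>
      \<exists>h. optimal_h S R \<mu> D A B f h \<and> (\<forall>\<eta>\<in>A. h \<eta> = - (flux D A B / flux D A (D - A)))"
    and "optimal_f S R \<mu> D A B f \<Longrightarrow> D - (A \<union> B) \<noteq> {} \<Longrightarrow> optimal_h S R \<mu> D A B f h \<Longrightarrow>
      \<forall>\<eta>\<in>A. h \<eta> = - (flux D A B / flux D A (D - A))"
proof -
  obtain f0 h0 where f0: "f0 \<in> outer_functions S D A B" and h0: "h0 \<in> inner_functions S D A B"
    and h0_A: "\<And>\<eta>. \<eta> \<in> A \<Longrightarrow> h0 \<eta> = - (flux D A B / flux D A (D - A))"
    and crit: "\<And>h. h \<in> inner_functions S D A B \<Longrightarrow> 2 * form f0 h + form h h0 + form h0 h = 0"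
    and outer: "\<And>f. f \<in> outer_functions S D A B \<Longrightarrow> form f h0 = form f0 h0"
    by (rule saddle_point[OF AB]) (assumption | rule that)+
  let ?obj = "objective S R \<mu>" and ?val = "inner_value S R \<mu> D A B"
  define c where "c = ?obj f0 h0"
  have bdd_outer: "bounded (f ` S)" if "f \<in> outer_functions S D A B" for f
    using that by (simp add: outer_functions_def)
  have bdd_inner: "bounded (h ` S)" if "h \<in> inner_functions S D A B" for h
    using that by (simp add: inner_functions_def)
  have obj_h0: "?obj f h0 = c" if "f \<in> outer_functions S D A B" for f
    using outer[OF that] by (simp add: c_def obj bdd_outer bdd_inner that f0 h0)
  \<comment> \<open>The quadratic functional along a line; it is used at \<open>t = 1\<close> for
    the end point and at \<open>t = 1/2\<close> for the midpoint.\<close>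
  have expand: "form (\<lambda>\<eta>. h1 \<eta> + t * h2 \<eta>) (\<lambda>\<eta>. h1 \<eta> + t * h2 \<eta>) =
      form h1 h1 + t * (form h1 h2 + form h2 h1) + t\<^sup>2 * form h2 h2"
    if h1: "bounded (h1 ` S)" and h2: "bounded (h2 ` S)" for h1 h2 t
  proof -
    have b1: "bounded ((\<lambda>\<eta>. t * h2 \<eta>) ` S)"
      by (rule bounded_times_comp[OF bounded_const_comp h2])
    have b2: "bounded ((\<lambda>\<eta>. h1 \<eta> + t * h2 \<eta>) ` S)"
      by (rule bounded_plus_comp[OF h1 b1])
    show ?thesis
      unfolding form_add_left[OF h1 b1 b2] form_add_right[OF h1 h1 b1] form_add_right[OF b1 h1 b1]
        form_scale_left form_scale_right
      by (simp add: power2_eq_square algebra_simps)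
  qed
  have inner_add: "(\<lambda>\<eta>. h1 \<eta> + t * h2 \<eta>) \<in> inner_functions S D A B"
    if h1: "h1 \<in> inner_functions S D A B" and h2: "h2 \<in> inner_functions S D A B" for h1 h2 t
  proof -
    have "bounded ((\<lambda>\<eta>. h1 \<eta> + t * h2 \<eta>) ` S)"
      by (intro bounded_comps bounded_const_comp bdd_inner h1 h2)
    moreover obtain a1 b1 where "\<forall>\<eta>\<in>A. h1 \<eta> = a1" "\<forall>\<eta>\<in>B. h1 \<eta> = b1"
      using h1 unfolding inner_functions_def by blast
    moreover obtain a2 b2 where "\<forall>\<eta>\<in>A. h2 \<eta> = a2" "\<forall>\<eta>\<in>B. h2 \<eta> = b2"
      using h2 unfolding inner_functions_def by blast
    moreover have "\<forall>\<eta>\<in>D - (A \<union> B). h1 \<eta> = 0 \<and> h2 \<eta> = 0"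
      using h1 h2 unfolding inner_functions_def by blast
    ultimately show ?thesis
      unfolding inner_functions_def
      by (intro CollectI conjI exI[of _ "a1 + t * a2"] exI[of _ "b1 + t * b2"]) simp_all
  qed
  have obj_le: "?obj f0 h \<le> c" if h: "h \<in> inner_functions S D A B" for h
  proof -
    \<comment> \<open>Around the critical point \<open>h0\<close> the linear terms disappear, and
      the objective differs from \<open>c\<close> by \<open>Z * form ?k ?k\<close>, which is not
      positive.\<close>
    let ?k = "\<lambda>\<eta>. h \<eta> + (-1) * h0 \<eta>"
    have k: "?k \<in> inner_functions S D A B" by (rule inner_add[OF h h0])
    note b = bdd_inner[OF h] bdd_inner[OF h0] bdd_inner[OF k] bdd_outer[OF f0]
    have "h = (\<lambda>\<eta>. h0 \<eta> + 1 * ?k \<eta>)" by auto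
    hence hh: "form h h = form h0 h0 + (form h0 ?k + form ?k h0) + form ?k ?k"
      using expand[OF b(2,3), of 1] by simp
    have "form f0 h = form f0 h0 + form f0 ?k"
      using form_add_right[OF b(4,2,3)] by simp
    hence "2 * form f0 h + form h h = 2 * form f0 h0 + form h0 h0 + form ?k ?k"
      using crit[OF k] hh by linarith
    also have "\<dots> \<le> 2 * form f0 h0 + form h0 h0"
      using form_self_nonpos[OF b(3)] by simp
    finally show ?thesis
      using Z b by (simp add: c_def obj)
  qed
  have val_ge: "ereal c \<le> ?val f" if "f \<in> outer_functions S D A B" for f
    unfolding inner_value_def obj_h0[OF that, symmetric] using h0 by (rule SUP_upper)
  have val_f0: "?val f0 = ereal c"
  proof (rule antisym)
    show "?val f0 \<le> ereal c"
      unfolding inner_value_def using obj_le by (intro SUP_least) auto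
  qed (rule val_ge[OF f0])
  have inf: "(INF g\<in>outer_functions S D A B. ?val g) = ereal c"
    by (rule antisym[OF INF_lower2[OF f0] INF_greatest]) (simp add: val_f0, rule val_ge)
  show "\<exists>f. optimal_f S R \<mu> D A B f"
    using f0 val_f0 inf unfolding optimal_f_def by (intro exI[of _ f0]) simp
  have val: "f \<in> outer_functions S D A B \<and> ?val f = ereal c" if "optimal_f S R \<mu> D A B f"
    using that inf unfolding optimal_f_def by simp
  show "\<exists>h. optimal_h S R \<mu> D A B f h \<and> (\<forall>\<eta>\<in>A. h \<eta> = - (flux D A B / flux D A (D - A)))"
    if "optimal_f S R \<mu> D A B f"
    using val[OF that] obj_h0 h0 h0_A unfolding optimal_h_def by (intro exI[of _ h0]) simp
  show "\<forall>\<eta>\<in>A. h \<eta> = - (flux D A B / flux D A (D - A))"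
    if f: "optimal_f S R \<mu> D A B f" and C: "D - (A \<union> B) \<noteq> {}" and h: "optimal_h S R \<mu> D A B f h"
  proof -
    have h': "h \<in> inner_functions S D A B" "?obj f h = c"
      using h val[OF f] by (auto simp: optimal_h_def)
    let ?k = "\<lambda>\<eta>. h \<eta> + (-1) * h0 \<eta>"
    \<comment> \<open>Strict concavity at the midpoint: \<open>h\<close> and \<open>h0\<close> both
      attain \<open>c\<close>, so \<open>u + form ?k ?k = 0\<close>, and the midpoint exceeds
      \<open>c\<close> by \<open>- Z/4 * form ?k ?k\<close>. As it cannot exceed \<open>c\<close>,
      the form vanishes on \<open>?k\<close>.\<close>
    let ?mid = "\<lambda>\<eta>. h0 \<eta> + (1/2) * ?k \<eta>"
    have k: "?k \<in> inner_functions S D A B" by (rule inner_add[OF h'(1) h0])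
    have mid: "?mid \<in> inner_functions S D A B" by (rule inner_add[OF h0 k])
    note b = bdd_inner[OF h'(1)] bdd_inner[OF h0] bdd_inner[OF k] bdd_inner[OF mid]
    have bf: "bounded (f ` S)" using val[OF f] bdd_outer by blast
    have "ereal (?obj f ?mid) \<le> ?val f"
      unfolding inner_value_def using mid by (rule SUP_upper)
    hence mid_le: "?obj f ?mid \<le> c" using val[OF f] by simp
    have "h = (\<lambda>\<eta>. h0 \<eta> + 1 * ?k \<eta>)" by auto
    hence hh: "form h h = form h0 h0 + (form h0 ?k + form ?k h0) + form ?k ?k"
      using expand[OF b(2,3), of 1] by simp
    have fh: "form f h = form f h0 + form f ?k"
      using form_add_right[OF bf b(2,3)] by simp
    have hm: "form ?mid ?mid = form h0 h0 + (1/2) * (form h0 ?k + form ?k h0) + (1/2)\<^sup>2 * form ?k ?k"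
      by (rule expand[OF b(2,3)])
    have bk: "bounded ((\<lambda>\<eta>. (1/2) * ?k \<eta>) ` S)"
      using b(3) by (intro bounded_times_comp) auto
    have fm: "form f ?mid = form f h0 + (1/2) * form f ?k"
      using form_add_right[OF bf b(2) bk] by (simp only: form_scale_right)
    have c1: "c = Z * (2 * form f h + form h h)"
      using h'(2) obj[OF bf b(1)] by simp
    have c2: "c = Z * (2 * form f h0 + form h0 h0)"
      using obj_h0[of f] val[OF f] obj[OF bf b(2)] by simp
    have c3: "Z * (2 * form f ?mid + form ?mid ?mid) \<le> c"
      using mid_le obj[OF bf b(4)] by simp
    define u where "u = 2 * form f ?k + (form h0 ?k + form ?k h0)"
    have e1: "u + form ?k ?k = 0"
    proof -
      have "Z * (2 * form f h + form h h) = Z * (2 * form f h0 + form h0 h0)"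
        using c1 c2 by linarith
      hence "2 * form f h + form h h = 2 * form f h0 + form h0 h0"
        using Z by simp
      thus ?thesis using hh fh unfolding u_def by linarith
    qed
    have "Z * (2 * form f ?mid + form ?mid ?mid) = Z * (2 * form f h0 + form h0 h0) +
        Z * (1/2 * u + 1/4 * form ?k ?k)"
      unfolding hm fm u_def by (simp add: algebra_simps power2_eq_square)
    hence "Z * (1/2 * u + 1/4 * form ?k ?k) \<le> 0" using c3 c2 by linarith
    hence "1/2 * u + 1/4 * form ?k ?k \<le> 0" using Z by (simp add: mult_le_0_iff)
    hence "form ?k ?k = 0"
      using e1 form_self_nonpos[OF b(3)] by linarith
    then obtain d where d: "\<And>\<eta>. \<eta> \<in> S \<Longrightarrow> ?k \<eta> = d"
      using form_self_eq_0_imp_const[OF b(3)] by blast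
    \<comment> \<open>The difference of two maximizers is constant; a point of \<open>D\<close>
      outside \<open>A\<close> and \<open>B\<close>, where both vanish, forces the constant to be
      0.\<close>
    obtain \<zeta> where "\<zeta> \<in> D - (A \<union> B)" using C by blast
    hence "?k \<zeta> = 0" "\<zeta> \<in> S" using k AB(4) unfolding inner_functions_def by auto
    hence "d = 0" using d[of \<zeta>] by simp
    show ?thesis
    proof
      fix \<eta> assume \<eta>: "\<eta> \<in> A"
      hence "\<eta> \<in> S" using AB by blast
      from d[OF this] \<open>d = 0\<close> show "h \<eta> = - (flux D A B / flux D A (D - A))"
        using h0_A[OF \<eta>] by simp
    qed
  qed
qed

end

section \<open>Paths of the process and of its trace\<close>

abbreviation jump_time :: "(nat \<Rightarrow> 'w \<Rightarrow> real) \<Rightarrow> nat \<Rightarrow> 'w \<Rightarrow> real" where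
  "jump_time T n \<omega> \<equiv> (\<Sum>i<n. T i \<omega>)"

text \<open>Replaces the least index in \<open>process_at\<close> by quantifiers over natural
  numbers, a form from which measurability can be read off.\<close>

lemma process_at_mem_iff:
  "process_at Y T s \<omega> \<in> Some ` G \<longleftrightarrow>
    (\<exists>n. s < (\<Sum>i\<le>n. T i \<omega>) \<and> (\<forall>m<n. \<not> s < (\<Sum>i\<le>m. T i \<omega>)) \<and> Y n \<omega> \<in> G)"
  (is "_ \<longleftrightarrow> (\<exists>n. ?P n \<and> (\<forall>m<n. \<not> ?P m) \<and> _)")
proof
  assume "process_at Y T s \<omega> \<in> Some ` G"
  hence ex: "\<exists>n. ?P n" and G: "Y (LEAST n. ?P n) \<omega> \<in> G"
    by (auto simp: process_at_def split: if_splits)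
  from ex have "?P (LEAST n. ?P n)" by (rule LeastI_ex)
  moreover have "\<forall>m<(LEAST n. ?P n). \<not> ?P m" using not_less_Least by blast
  ultimately show "\<exists>n. ?P n \<and> (\<forall>m<n. \<not> ?P m) \<and> Y n \<omega> \<in> G" using G by blast
next
  assume "\<exists>n. ?P n \<and> (\<forall>m<n. \<not> ?P m) \<and> Y n \<omega> \<in> G"
  then obtain n where n: "?P n" "\<forall>m<n. \<not> ?P m" "Y n \<omega> \<in> G" by blast
  have "(LEAST n. ?P n) = n"
    by (rule Least_equality) (use n in \<open>auto simp: not_less[symmetric]\<close>)
  thus "process_at Y T s \<omega> \<in> Some ` G"
    using n by (auto simp: process_at_def)
qed

lemma process_at_eq_Some_iff: "process_at Y T s \<omega> = Some \<xi> \<longleftrightarrow> process_at Y T s \<omega> \<in> Some ` {\<xi>}"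
  by auto

lemma process_at_cases:
  assumes "process_at Y T s \<omega> = Some \<xi>" "0 \<le> s"
  obtains n where "jump_time T n \<omega> \<le> s" "s < jump_time T (Suc n) \<omega>" "Y n \<omega> = \<xi>"
proof -
  obtain n where n: "s < (\<Sum>i\<le>n. T i \<omega>)" "\<forall>m<n. \<not> s < (\<Sum>i\<le>m. T i \<omega>)" "Y n \<omega> = \<xi>"
    using assms(1) unfolding process_at_eq_Some_iff process_at_mem_iff by auto
  have "jump_time T n \<omega> \<le> s"
  proof (cases n)
    case (Suc k)
    thus ?thesis using n(2) by (auto simp: lessThan_Suc_atMost not_less)
  qed (use assms in simp)
  thus thesis using n that by (simp add: lessThan_Suc_atMost)
qed

lemma jump_time_mono:
  assumes "\<And>i. 0 < T i \<omega>" "k \<le> n"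
  shows "jump_time T k \<omega> \<le> jump_time T n \<omega>"
  by (rule sum_mono2) (use assms in \<open>auto intro: less_imp_le\<close>)

lemma process_at_eqI:
  assumes pos: "\<And>i. 0 < T i \<omega>" and "jump_time T n \<omega> \<le> s" "s < jump_time T (Suc n) \<omega>"
  shows "process_at Y T s \<omega> = Some (Y n \<omega>)"
proof -
  have "\<not> s < (\<Sum>i\<le>m. T i \<omega>)" if "m < n" for m
    using jump_time_mono[where T = T and \<omega> = \<omega>, OF pos, of "Suc m" n] that assms(2)
    by (simp add: lessThan_Suc_atMost)
  thus ?thesis
    unfolding process_at_eq_Some_iff process_at_mem_iff using assms(3)
    by (auto simp: lessThan_Suc_atMost)
qed

text \<open>Negative times are not excluded here; \<open>time_in_eq_measure\<close> cuts the set
  down to \<open>{0..s}\<close>.\<close>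

definition occupied ::
  "(nat \<Rightarrow> 'w \<Rightarrow> 'a) \<Rightarrow> (nat \<Rightarrow> 'w \<Rightarrow> real) \<Rightarrow> 'a set \<Rightarrow> 'w \<Rightarrow> real set" where
  "occupied Y T D \<omega> = {s. process_at Y T s \<omega> \<in> Some ` D}"

lemma occupied_measurable [measurable]: "occupied Y T D \<omega> \<in> sets borel"
proof -
  have "occupied Y T D \<omega> = {s \<in> space borel. \<exists>n. s < (\<Sum>i\<le>n. T i \<omega>) \<and>
      (\<forall>m<n. \<not> s < (\<Sum>i\<le>m. T i \<omega>)) \<and> Y n \<omega> \<in> D}"
    by (auto simp: occupied_def process_at_mem_iff)
  also have "\<dots> \<in> sets borel" by measurable
  finally show ?thesis .
qed

section \<open>The clock \<open>time_in\<close> and its generalized inverse\<close>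

lemma time_in_eq_measure: "time_in Y T D s \<omega> = measure lborel ({0..s} \<inter> occupied Y T D \<omega>)"
proof -
  have "time_in Y T D s \<omega> = (\<integral>u. indicator ({0..s} \<inter> occupied Y T D \<omega>) u \<partial>lborel)"
    unfolding time_in_def set_lebesgue_integral_def
    by (rule Bochner_Integration.integral_cong) (auto simp: indicator_def occupied_def)
  thus ?thesis by simp
qed

lemma fmeasurable_Icc: "{a..b::real} \<in> fmeasurable lborel"
  by (rule fmeasurableI) (auto simp: emeasure_lborel_Icc_eq)

lemma fmeasurable_Icc_Int_occupied: "{a..b} \<inter> occupied Y T D \<omega> \<in> fmeasurable lborel"
  by (rule fmeasurable_Int_fmeasurable[OF fmeasurable_Icc]) auto

lemma time_in_mono: "s \<le> s' \<Longrightarrow> time_in Y T D s \<omega> \<le> time_in Y T D s' \<omega>"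
  unfolding time_in_eq_measure
  by (rule measure_mono_fmeasurable[OF _ _ fmeasurable_Icc_Int_occupied]) auto

lemma time_in_lipschitz:
  assumes "0 \<le> s" "s \<le> s'"
  shows "time_in Y T D s' \<omega> \<le> time_in Y T D s \<omega> + (s' - s)"
proof -
  have "time_in Y T D s' \<omega> \<le> measure lborel ({0..s} \<inter> occupied Y T D \<omega> \<union> {s..s'})"
    unfolding time_in_eq_measure
    by (rule measure_mono_fmeasurable)
      (use fmeasurable_Icc_Int_occupied fmeasurable_Icc in \<open>auto intro!: fmeasurable.Un\<close>)
  also have "\<dots> \<le> measure lborel ({0..s} \<inter> occupied Y T D \<omega>) + measure lborel {s..s'}"
    by (rule measure_Un_le) auto
  finally show ?thesis using assms by (simp add: time_in_eq_measure)
qed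

lemma time_in_le:
  assumes "0 \<le> a" "{0..s} \<inter> occupied Y T D \<omega> \<subseteq> {0..a}"
  shows "time_in Y T D s \<omega> \<le> a"
proof -
  have "measure lborel ({0..s} \<inter> occupied Y T D \<omega>) \<le> measure lborel {0..a}"
    using assms(2) by (rule measure_mono_fmeasurable) (auto simp: fmeasurable_Icc)
  thus ?thesis using assms by (simp add: time_in_eq_measure)
qed

text \<open>By monotonicity of the clock, integer times suffice; the case distinction in
  \<open>trace_at\<close> thus becomes a countable condition on the path.\<close>

lemma bdd_above_time_in_iff:
  assumes "0 \<le> t"
  shows "bdd_above {s. 0 \<le> s \<and> time_in Y T D s \<omega> \<le> t} \<longleftrightarrow> (\<exists>n::nat. t < time_in Y T D n \<omega>)"
proof
  assume "bdd_above {s. 0 \<le> s \<and> time_in Y T D s \<omega> \<le> t}"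
  then obtain b where b: "\<And>s. 0 \<le> s \<Longrightarrow> time_in Y T D s \<omega> \<le> t \<Longrightarrow> s \<le> b"
    unfolding bdd_above_def by auto
  obtain n :: nat where "b < n" using reals_Archimedean2 by blast
  hence "t < time_in Y T D n \<omega>" using b[of n] by (meson linorder_not_le of_nat_0_le_iff)
  thus "\<exists>n::nat. t < time_in Y T D n \<omega>" ..
next
  assume "\<exists>n::nat. t < time_in Y T D n \<omega>"
  then obtain n :: nat where n: "t < time_in Y T D n \<omega>" ..
  show "bdd_above {s. 0 \<le> s \<and> time_in Y T D s \<omega> \<le> t}"
  proof (rule bdd_aboveI)
    fix s assume "s \<in> {s. 0 \<le> s \<and> time_in Y T D s \<omega> \<le> t}"
    thus "s \<le> n" using n time_in_mono[of n s Y T D \<omega>] by (cases "s \<le> n") auto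
  qed
qed

text \<open>The clock is continuous, being Lipschitz, so the supremum belongs to the set. Level sets
  of the inverse clock are thereby level sets of the clock at a fixed time, which gives
  measurability of the trace.\<close>

lemma le_Sup_time_in_iff:
  assumes t: "0 \<le> t" and bdd: "bdd_above {s. 0 \<le> s \<and> time_in Y T D s \<omega> \<le> t}" and s: "0 \<le> s"
  shows "s \<le> Sup {s. 0 \<le> s \<and> time_in Y T D s \<omega> \<le> t} \<longleftrightarrow> time_in Y T D s \<omega> \<le> t"
proof
  let ?A = "{s. 0 \<le> s \<and> time_in Y T D s \<omega> \<le> t}"
  assume le: "s \<le> Sup ?A"
  have ne: "?A \<noteq> {}"
    using t by (auto simp: time_in_eq_measure intro!: exI[of _ 0] order_trans[OF time_in_le[of 0 0, unfolded time_in_eq_measure]])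
  show "time_in Y T D s \<omega> \<le> t"
  proof (rule field_le_epsilon)
    fix e :: real assume e: "0 < e"
    have "s - e < Sup ?A" using le e by linarith
    then obtain u where u: "u \<in> ?A" "s - e < u" using less_cSupD[OF ne] by blast
    show "time_in Y T D s \<omega> \<le> t + e"
    proof (cases "s \<le> u")
      case True
      thus ?thesis using time_in_mono[of s u Y T D \<omega>] u e by auto
    next
      case False
      thus ?thesis using time_in_lipschitz[of u s Y T D \<omega>] u by auto
    qed
  qed
next
  assume "time_in Y T D s \<omega> \<le> t"
  thus "s \<le> Sup {s. 0 \<le> s \<and> time_in Y T D s \<omega> \<le> t}"
    using s bdd by (intro cSup_upper) auto
qed

lemma trace_at_eqI:
  assumes "0 \<le> \<sigma>" "time_in Y T D \<sigma> \<omega> \<le> t" "\<And>s. \<sigma> < s \<Longrightarrow> t < time_in Y T D s \<omega>"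
  shows "trace_at Y T D t \<omega> = process_at Y T \<sigma> \<omega>"
proof -
  have "{s. 0 \<le> s \<and> time_in Y T D s \<omega> \<le> t} = {0..\<sigma>}"
  proof (intro equalityI subsetI)
    fix s assume "s \<in> {s. 0 \<le> s \<and> time_in Y T D s \<omega> \<le> t}"
    thus "s \<in> {0..\<sigma>}" using assms(3)[of s] by (cases "\<sigma> < s") auto
  next
    fix s assume "s \<in> {0..\<sigma>}"
    thus "s \<in> {s. 0 \<le> s \<and> time_in Y T D s \<omega> \<le> t}"
      using time_in_mono[of s \<sigma> Y T D \<omega>] assms(2) by auto
  qed
  thus ?thesis using assms(1) by (simp add: trace_at_def)
qed

text \<open>The first return in terms of the jump chain alone; index 0 is excluded so that a start
  in \<open>D\<close> is not a return.\<close>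

definition returns_at :: "(nat \<Rightarrow> 'w \<Rightarrow> 'a) \<Rightarrow> 'a set \<Rightarrow> nat \<Rightarrow> 'w \<Rightarrow> bool" where
  "returns_at Y D n \<omega> \<longleftrightarrow> 0 < n \<and> Y n \<omega> \<in> D \<and> (\<forall>i. 0 < i \<and> i < n \<longrightarrow> Y i \<omega> \<notin> D)"

lemma ex_returns_at:
  assumes "0 < n" "Y n \<omega> \<in> D"
  shows "\<exists>n. returns_at Y D n \<omega>"
proof -
  let ?P = "\<lambda>n. 0 < n \<and> Y n \<omega> \<in> D"
  have "?P (LEAST n. ?P n)" by (rule LeastI[of ?P n]) (use assms in simp)
  moreover have "\<not> ?P i" if "i < (LEAST n. ?P n)" for i using that by (rule not_less_Least)
  ultimately have "returns_at Y D (LEAST n. ?P n) \<omega>" unfolding returns_at_def by blast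
  thus ?thesis by blast
qed

section \<open>Paths with positive holding times: the trace up to the first return\<close>

context
  fixes Y :: "nat \<Rightarrow> 'w \<Rightarrow> 'a" and T :: "nat \<Rightarrow> 'w \<Rightarrow> real" and \<omega> :: 'w
  assumes pos: "\<And>i. 0 < T i \<omega>"
begin

lemma occupied_first:
  assumes "Y 0 \<omega> \<in> D"
  shows "{0..<T 0 \<omega>} \<subseteq> occupied Y T D \<omega>"
proof
  fix s assume "s \<in> {0..<T 0 \<omega>}"
  hence "process_at Y T s \<omega> = Some (Y 0 \<omega>)"
    by (intro process_at_eqI[where T = T and \<omega> = \<omega>, OF pos]) auto
  thus "s \<in> occupied Y T D \<omega>" using assms by (simp add: occupied_def)
qed

lemma time_in_first:
  assumes "Y 0 \<omega> \<in> D" "0 \<le> s" "s \<le> T 0 \<omega>"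
  shows "s \<le> time_in Y T D s \<omega>"
proof -
  have "measure lborel {0..<s} \<le> measure lborel ({0..s} \<inter> occupied Y T D \<omega>)"
    by (rule measure_mono_fmeasurable[OF _ _ fmeasurable_Icc_Int_occupied])
      (use occupied_first[OF assms(1)] assms in auto)
  thus ?thesis using assms by (simp add: time_in_eq_measure)
qed

lemma trace_at_before_first_jump:
  assumes "Y 0 \<omega> \<in> D" "0 \<le> t" "t < T 0 \<omega>"
  shows "trace_at Y T D t \<omega> = Some (Y 0 \<omega>)"
proof -
  have "trace_at Y T D t \<omega> = process_at Y T t \<omega>"
  proof (rule trace_at_eqI)
    show "time_in Y T D t \<omega> \<le> t" using assms by (intro time_in_le) auto
    fix s assume "t < s"
    \<comment> \<open>The clock is only known to run at unit speed until the first jump; truncating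
      there still leaves a value above \<open>t\<close>.\<close>
    hence "min s (T 0 \<omega>) \<le> time_in Y T D (min s (T 0 \<omega>)) \<omega>"
      using assms by (intro time_in_first) auto
    also have "\<dots> \<le> time_in Y T D s \<omega>" by (rule time_in_mono) simp
    finally show "t < time_in Y T D s \<omega>" using assms \<open>t < s\<close> by linarith
  qed (use assms in simp)
  also have "\<dots> = Some (Y 0 \<omega>)"
    using process_at_eqI[where T = T and \<omega> = \<omega>, OF pos, of 0 t] assms by simp
  finally show ?thesis .
qed

lemma occupied_excursion:
  assumes "\<And>i. 0 < i \<Longrightarrow> i < n \<Longrightarrow> Y i \<omega> \<notin> D" "u \<in> occupied Y T D \<omega>" "0 \<le> u" "T 0 \<omega> \<le> u"
  shows "jump_time T n \<omega> \<le> u"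
proof -
  obtain k where k: "jump_time T k \<omega> \<le> u" "u < jump_time T (Suc k) \<omega>" "Y k \<omega> \<in> D"
    using assms(2,3) unfolding occupied_def by (auto elim: process_at_cases)
  have "k \<noteq> 0" using k(2) assms(4) by (intro notI) simp
  hence "n \<le> k" using assms(1)[of k] k(3) by (cases "k < n") auto
  thus ?thesis
    using jump_time_mono[where T = T and \<omega> = \<omega>, OF pos, of n k] k(1) by linarith
qed

text \<open>During the excursion the clock stands still at \<open>T 0\<close>. At time
  \<open>a\<close> the path is back in \<open>D\<close>, and the clock runs again at unit speed
  throughout the sojourn there.\<close>

lemma trace_at_after_return:
  assumes Y0: "Y 0 \<omega> \<in> D" and t: "T 0 \<omega> \<le> t" and n: "returns_at Y D n \<omega>" and "t < T n \<omega>"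
  shows "trace_at Y T D t \<omega> = Some (Y n \<omega>)"
proof -
  define a where "a = jump_time T n \<omega>"
  have n': "0 < n" "Y n \<omega> \<in> D" "\<And>i. 0 < i \<Longrightarrow> i < n \<Longrightarrow> Y i \<omega> \<notin> D"
    using n by (auto simp: returns_at_def)
  have a: "T 0 \<omega> \<le> a"
    using jump_time_mono[where T = T and \<omega> = \<omega>, OF pos, of 1 n] n' by (simp add: a_def)
  have aT: "jump_time T (Suc n) \<omega> = a + T n \<omega>" by (simp add: a_def)
  \<comment> \<open>The real time at which the clock shows \<open>t\<close>. As \<open>T 0\<close>
    is positive, the assumption \<open>t < T n\<close> keeps it inside the sojourn at the point of
    return.\<close>
  define \<sigma> where "\<sigma> = a + (t - T 0 \<omega>)"
  have \<sigma>: "a \<le> \<sigma>" "\<sigma> < a + T n \<omega>" "0 \<le> \<sigma>"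
    using t assms(4) pos[of 0] a by (auto simp: \<sigma>_def)
  have "trace_at Y T D t \<omega> = process_at Y T \<sigma> \<omega>"
  proof (rule trace_at_eqI)
    have "{0..\<sigma>} \<inter> occupied Y T D \<omega> \<subseteq> {0..T 0 \<omega>} \<union> {a..\<sigma>}"
      using occupied_excursion[OF n'(3)] by (fastforce simp: a_def)
    hence "measure lborel ({0..\<sigma>} \<inter> occupied Y T D \<omega>) \<le> measure lborel ({0..T 0 \<omega>} \<union> {a..\<sigma>})"
      by (rule measure_mono_fmeasurable) (auto intro!: fmeasurable.Un fmeasurable_Icc)
    also have "\<dots> \<le> measure lborel {0..T 0 \<omega>} + measure lborel {a..\<sigma>}"
      by (rule measure_Un_le) auto
    also have "\<dots> = t" using pos[of 0] \<sigma> by (simp add: less_imp_le \<sigma>_def)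
    finally show "time_in Y T D \<sigma> \<omega> \<le> t" by (simp add: time_in_eq_measure)
    fix s assume s: "\<sigma> < s"
    define s' where "s' = min s (a + T n \<omega>)"
    have s': "\<sigma> < s'" "s' \<le> s" "s' \<le> a + T n \<omega>" using s \<sigma> by (auto simp: s'_def)
    have "{a..<s'} \<subseteq> occupied Y T D \<omega>"
    proof
      fix u assume "u \<in> {a..<s'}"
      hence "process_at Y T u \<omega> = Some (Y n \<omega>)"
        using s' aT by (intro process_at_eqI[where T = T and \<omega> = \<omega>, OF pos]) (auto simp: a_def)
      thus "u \<in> occupied Y T D \<omega>" using n' by (auto simp: occupied_def)
    qed
    hence "{0..<T 0 \<omega>} \<union> {a..<s'} \<subseteq> {0..s} \<inter> occupied Y T D \<omega>"
      using occupied_first[OF Y0] s' \<sigma> a pos[of 0] by auto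
    hence "measure lborel ({0..<T 0 \<omega>} \<union> {a..<s'}) \<le> time_in Y T D s \<omega>"
      unfolding time_in_eq_measure
      by (rule measure_mono_fmeasurable) (auto simp: fmeasurable_Icc_Int_occupied)
    moreover have "measure lborel ({0..<T 0 \<omega>} \<union> {a..<s'}) =
        measure lborel {0..<T 0 \<omega>} + measure lborel {a..<s'}"
      by (rule measure_Union) (use a pos[of 0] s' \<sigma> in \<open>auto simp: less_imp_le\<close>)
    moreover have "\<dots> = T 0 \<omega> + (s' - a)" using pos[of 0] s' \<sigma> by simp
    ultimately show "t < time_in Y T D s \<omega>" using s' by (simp add: \<sigma>_def)
  qed (fact \<sigma>)
  also have "\<dots> = Some (Y n \<omega>)"
    using \<sigma> aT by (intro process_at_eqI[where T = T and \<omega> = \<omega>, OF pos]) (auto simp: a_def)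
  finally show ?thesis .
qed

text \<open>Without a return the clock never exceeds \<open>T 0\<close>, so the set in the
  definition of \<open>trace_at\<close> is unbounded and the value is \<open>None\<close>.\<close>

lemma trace_at_no_return:
  assumes t: "T 0 \<omega> \<le> t" and none: "\<nexists>n. returns_at Y D n \<omega>"
  shows "trace_at Y T D t \<omega> = None"
proof -
  have off: "Y i \<omega> \<notin> D" if "0 < i" for i using ex_returns_at that none by metis
  have "time_in Y T D s \<omega> \<le> T 0 \<omega>" for s
  proof (rule time_in_le)
    show "{0..s} \<inter> occupied Y T D \<omega> \<subseteq> {0..T 0 \<omega>}"
    proof
      fix u assume u: "u \<in> {0..s} \<inter> occupied Y T D \<omega>"
      then obtain k where k: "jump_time T k \<omega> \<le> u" "u < jump_time T (Suc k) \<omega>" "Y k \<omega> \<in> D"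
        unfolding occupied_def by (auto elim: process_at_cases)
      hence "k = 0" using off[of k] by auto
      thus "u \<in> {0..T 0 \<omega>}" using k u by simp
    qed
  qed (use pos in \<open>simp add: less_imp_le\<close>)
  hence "\<not> t < time_in Y T D s \<omega>" for s using t by (meson linorder_not_less order_trans)
  thus ?thesis
    using bdd_above_time_in_iff[of t Y T D \<omega>] t pos[of 0] by (simp add: trace_at_def)
qed

text \<open>Upper inclusion for \<open>jump_rate_limit\<close>: the first return is at
  \<open>\<xi>\<close> unless the sojourn at the point of return is also at most \<open>t\<close>,
  and then a second short holding time has occurred.\<close>

lemma trace_at_SomeD:
  assumes Y0: "Y 0 \<omega> \<in> D" "Y 0 \<omega> \<noteq> \<xi>" and t: "0 \<le> t" and tr: "trace_at Y T D t \<omega> = Some \<xi>"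
  shows "T 0 \<omega> \<le> t \<and> (\<exists>n. returns_at Y D n \<omega> \<and> (Y n \<omega> = \<xi> \<or> T n \<omega> \<le> t))"
proof -
  have T0: "T 0 \<omega> \<le> t" using trace_at_before_first_jump[OF Y0(1) t] tr Y0(2) by force
  then obtain n where n: "returns_at Y D n \<omega>" using trace_at_no_return tr by fastforce
  have "Y n \<omega> = \<xi>" if "t < T n \<omega>"
    using trace_at_after_return[OF Y0(1) T0 n that] tr by simp
  thus ?thesis using T0 n by (meson not_less)
qed

lemma process_at_after_jump:
  assumes "T 0 \<omega> \<le> t" "t < T 1 \<omega>"
  shows "process_at Y T t \<omega> = Some (Y 1 \<omega>)"
  by (rule process_at_eqI[where T = T and \<omega> = \<omega>, OF pos]) (use assms pos[of 0] in auto)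

lemma process_at_SomeD:
  assumes "process_at Y T t \<omega> = Some \<xi>" "0 \<le> t" "T 0 \<omega> \<le> t"
  shows "Y 1 \<omega> = \<xi> \<or> T 1 \<omega> \<le> t"
proof -
  obtain k where k: "jump_time T k \<omega> \<le> t" "t < jump_time T (Suc k) \<omega>" "Y k \<omega> = \<xi>"
    using assms(1,2) by (rule process_at_cases)
  have "k \<noteq> 0" using k(2) assms(3) by (intro notI) simp
  hence "k = 1 \<or> 2 \<le> k" by auto
  moreover have "T 1 \<omega> \<le> t" if "2 \<le> k"
    using jump_time_mono[where T = T and \<omega> = \<omega>, OF pos that] k(1) pos[of 0]
    by (simp add: numeral_2_eq_2)
  ultimately show ?thesis using k(3) by auto
qed

end

section \<open>The law of the first return\<close>

locale jump_hold_process =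
  fixes E :: "'a set" and R :: "'a \<Rightarrow> 'a \<Rightarrow> real" and P :: "'a \<Rightarrow> 'w measure"
    and Y :: "nat \<Rightarrow> 'w \<Rightarrow> 'a" and T :: "nat \<Rightarrow> 'w \<Rightarrow> real"
  assumes countable_E: "countable E"
    and rates: "rate_matrix E R"
    and chain: "jump_hold_chain E R P Y T"
begin

abbreviation rate :: "'a \<Rightarrow> real" where "rate \<equiv> holding_rate R"

text \<open>Outside \<open>E\<close> a point mass is used, to make the kernel total.\<close>

definition J :: "'a \<Rightarrow> 'a pmf" where
  "J \<eta> = (if \<eta> \<in> E then embed_pmf (\<lambda>\<xi>. if \<xi> \<in> E then jump_prob R \<eta> \<xi> else 0) else return_pmf \<eta>)"

sublocale transition_kernel J .

definition prefix :: "'a \<Rightarrow> nat \<Rightarrow> (nat \<Rightarrow> 'a) \<Rightarrow> (nat \<Rightarrow> real) \<Rightarrow> 'w set" where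
  "prefix \<eta> k x t = {\<omega> \<in> space (P \<eta>). \<forall>i\<le>k. Y i \<omega> = x i \<and> t i < T i \<omega>}"

lemma prob_space_P: "\<eta> \<in> E \<Longrightarrow> prob_space (P \<eta>)"
  using chain by (simp add: jump_hold_chain_def)

lemma Y_in_E: "\<eta> \<in> E \<Longrightarrow> \<omega> \<in> space (P \<eta>) \<Longrightarrow> Y n \<omega> \<in> E"
proof -
  assume "\<eta> \<in> E" "\<omega> \<in> space (P \<eta>)"
  moreover from this have "Y n \<in> P \<eta> \<rightarrow>\<^sub>M count_space E" using chain by (simp add: jump_hold_chain_def)
  ultimately show "Y n \<omega> \<in> E" by (auto dest: measurable_space)
qed

lemma measurable_T [measurable]: "\<eta> \<in> E \<Longrightarrow> T n \<in> borel_measurable (P \<eta>)"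
  using chain by (simp add: jump_hold_chain_def)

lemma pred_Y [measurable]: "\<eta> \<in> E \<Longrightarrow> Measurable.pred (P \<eta>) (\<lambda>\<omega>. Y n \<omega> \<in> A)"
proof -
  assume "\<eta> \<in> E"
  hence "Y n \<in> P \<eta> \<rightarrow>\<^sub>M count_space E" using chain by (simp add: jump_hold_chain_def)
  from measurable_compose[OF this, of "\<lambda>y. y \<in> A"] show ?thesis by simp
qed

lemma pred_Y_eq [measurable]: "\<eta> \<in> E \<Longrightarrow> Measurable.pred (P \<eta>) (\<lambda>\<omega>. Y n \<omega> = y)"
  using pred_Y[of \<eta> n "{y}"] by simp

lemma prefix_Int_space [simp]: "prefix \<eta> k x t \<inter> space (P \<eta>) = prefix \<eta> k x t"
  unfolding prefix_def by blast

lemma prefix_sets [measurable]: "\<eta> \<in> E \<Longrightarrow> prefix \<eta> k x t \<in> sets (P \<eta>)"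
  unfolding prefix_def by measurable

lemma measure_prefix:
  assumes "\<eta> \<in> E" "\<And>i. i \<le> k \<Longrightarrow> x i \<in> E \<and> 0 \<le> t i"
  shows "measure (P \<eta>) (prefix \<eta> k x t) = (if x 0 = \<eta> then 1 else 0) *
    (\<Prod>i<k. jump_prob R (x i) (x (Suc i))) * (\<Prod>i\<le>k. exp (- rate (x i) * t i))"
  using chain assms unfolding jump_hold_chain_def prefix_def by blast

lemma rate_nonneg: "\<eta> \<in> E \<Longrightarrow> 0 \<le> rate \<eta>"
  using rates by (auto simp: rate_matrix_def holding_rate_def)

text \<open>A state with rate 0 would have an infinite holding time, which a real-valued
  \<open>T 0\<close> excludes: the events that \<open>T 0\<close> exceeds \<open>n\<close> would all
  have probability 1 although their intersection is empty.\<close>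

lemma rate_pos:
  assumes \<eta>: "\<eta> \<in> E"
  shows "0 < rate \<eta>"
proof (rule ccontr)
  interpret prob_space "P \<eta>" by (rule prob_space_P[OF \<eta>])
  assume "\<not> 0 < rate \<eta>"
  hence z: "rate \<eta> = 0" using rate_nonneg[OF \<eta>] by simp
  let ?A = "\<lambda>n::nat. prefix \<eta> 0 (\<lambda>_. \<eta>) (\<lambda>_. real n)"
  have "decseq ?A" by (auto simp: prefix_def decseq_def intro: le_less_trans)
  hence "(\<lambda>n. measure (P \<eta>) (?A n)) \<longlonglongrightarrow> measure (P \<eta>) (\<Inter>n. ?A n)"
    using \<eta> by (intro finite_Lim_measure_decseq) auto
  moreover have "measure (P \<eta>) (?A n) = 1" for n
    by (subst measure_prefix) (use \<eta> z in auto)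
  moreover have "(\<Inter>n. ?A n) = {}"
  proof (intro equals0I)
    fix \<omega> assume "\<omega> \<in> (\<Inter>n. ?A n)"
    hence "real n < T 0 \<omega>" for n by (auto simp: prefix_def)
    thus False using reals_Archimedean2[of "T 0 \<omega>"] by (meson less_asym)
  qed
  ultimately show False by (simp add: LIMSEQ_const_iff)
qed

lemma jump_prob_has_sum:
  assumes \<eta>: "\<eta> \<in> E"
  shows "(jump_prob R \<eta> has_sum 1) E"
proof -
  have "(R \<eta> has_sum 0) E" using rates \<eta> by (auto simp: rate_matrix_def)
  hence "(R \<eta> has_sum (0 - R \<eta> \<eta>)) (E - {\<eta>})"
    using has_sum_Diff[of "R \<eta>" E 0 "{\<eta>}" "R \<eta> \<eta>"] \<eta>
      has_sum_finite[of "{\<eta>}" "R \<eta>"] by simp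
  hence "((\<lambda>\<xi>. R \<eta> \<xi> * inverse (rate \<eta>)) has_sum ((0 - R \<eta> \<eta>) * inverse (rate \<eta>))) (E - {\<eta>})"
    by (rule has_sum_cmult_left)
  also have "(0 - R \<eta> \<eta>) * inverse (rate \<eta>) = 1"
    using rate_pos[OF \<eta>] by (simp add: holding_rate_def)
  finally show ?thesis
    by (rule iffD1[OF has_sum_cong_neutral, rotated -1]) (auto simp: jump_prob_def divide_inverse)
qed

lemma jump_prob_nonneg: "\<eta> \<in> E \<Longrightarrow> \<xi> \<in> E \<Longrightarrow> 0 \<le> jump_prob R \<eta> \<xi>"
  using rates rate_nonneg[of \<eta>] by (auto simp: jump_prob_def rate_matrix_def)

lemma pmf_J:
  assumes \<eta>: "\<eta> \<in> E"
  shows "pmf (J \<eta>) \<xi> = (if \<xi> \<in> E then jump_prob R \<eta> \<xi> else 0)"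
proof -
  let ?f = "\<lambda>\<xi>. if \<xi> \<in> E then jump_prob R \<eta> \<xi> else 0"
  have "(?f has_sum 1) UNIV"
    by (rule iffD1[OF has_sum_cong_neutral jump_prob_has_sum[OF \<eta>]]) auto
  hence "(\<integral>\<^sup>+\<xi>. ?f \<xi> \<partial>count_space UNIV) = 1"
    by (subst nonneg_has_sum_nn_integral) (use \<eta> jump_prob_nonneg in auto)
  thus ?thesis
    unfolding J_def using \<eta> jump_prob_nonneg by (simp add: pmf_embed_pmf)
qed

lemma set_pmf_J: "\<eta> \<in> E \<Longrightarrow> set_pmf (J \<eta>) \<subseteq> E"
  by (auto simp: set_pmf_iff pmf_J split: if_splits)

lemma measure_prefix_Suc:
  assumes "\<eta> \<in> E" "\<And>i. i \<le> k \<Longrightarrow> x i \<in> E \<and> 0 \<le> t i" "\<zeta> \<in> E" "0 \<le> \<tau>"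
  shows "measure (P \<eta>) (prefix \<eta> (Suc k) (x(Suc k := \<zeta>)) (t(Suc k := \<tau>))) =
    measure (P \<eta>) (prefix \<eta> k x t) * (pmf (J (x k)) \<zeta> * exp (- rate \<zeta> * \<tau>))"
proof -
  have p: "(\<Prod>i<k. jump_prob R ((x(Suc k := \<zeta>)) i) ((x(Suc k := \<zeta>)) (Suc i))) =
      (\<Prod>i<k. jump_prob R (x i) (x (Suc i)))"
    by (rule prod.cong) auto
  have e: "(\<Prod>i\<le>k. exp (- rate ((x(Suc k := \<zeta>)) i) * (t(Suc k := \<tau>)) i)) =
      (\<Prod>i\<le>k. exp (- rate (x i) * t i))"
    by (rule prod.cong) auto
  show ?thesis
    by (subst (1 2) measure_prefix)
      (use assms in \<open>auto simp: p[simplified] e[simplified] pmf_J le_Suc_eq\<close>)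
qed

lemma prefix_Suc_disjoint:
  "disjoint_family_on (\<lambda>\<zeta>. prefix \<eta> (Suc k) (x(Suc k := \<zeta>)) t \<inter> Z) A"
proof -
  have "Y (Suc k) \<omega> = \<zeta>" if "\<omega> \<in> prefix \<eta> (Suc k) (x(Suc k := \<zeta>)) t" for \<omega> \<zeta>
    using that by (auto simp: prefix_def dest: spec[of _ "Suc k"])
  thus ?thesis unfolding disjoint_family_on_def by blast
qed

text \<open>Total probability over the next state. The additional requirement that the next holding
  time be positive loses only a null set, because the jump probabilities sum to 1.\<close>

lemma measure_prefix_Int_has_sum:
  assumes \<eta>: "\<eta> \<in> E" and x: "\<And>i. i \<le> k \<Longrightarrow> x i \<in> E \<and> 0 \<le> t i" and Z: "Z \<in> sets (P \<eta>)"
  shows "((\<lambda>\<zeta>. measure (P \<eta>) (prefix \<eta> (Suc k) (x(Suc k := \<zeta>)) (t(Suc k := 0)) \<inter> Z)) has_sum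
    measure (P \<eta>) (prefix \<eta> k x t \<inter> Z)) E"
proof -
  interpret prob_space "P \<eta>" by (rule prob_space_P[OF \<eta>])
  let ?X = "\<lambda>\<zeta>. prefix \<eta> (Suc k) (x(Suc k := \<zeta>)) (t(Suc k := 0))"
  let ?U = "\<Union>\<zeta>\<in>E. ?X \<zeta>"
  have sum: "((\<lambda>\<zeta>. measure (P \<eta>) (?X \<zeta> \<inter> W)) has_sum measure (P \<eta>) (\<Union>\<zeta>\<in>E. ?X \<zeta> \<inter> W)) E"
    if "W \<in> sets (P \<eta>)" for W
    by (rule measure_has_sum[OF countable_E _ prefix_Suc_disjoint]) (use \<eta> that in auto)
  have U: "?U \<in> sets (P \<eta>)"
    using \<eta> countable_E by (intro sets.countable_UN') auto
  have sub: "?U \<subseteq> prefix \<eta> k x t"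
  proof
    fix \<omega> assume "\<omega> \<in> ?U"
    then obtain \<zeta> where "\<omega> \<in> space (P \<eta>)"
      and *: "\<And>i. i \<le> Suc k \<Longrightarrow> Y i \<omega> = (x(Suc k := \<zeta>)) i \<and> (t(Suc k := 0)) i < T i \<omega>"
      by (auto simp: prefix_def)
    moreover have "Y i \<omega> = x i \<and> t i < T i \<omega>" if "i \<le> k" for i
      using *[of i] that by auto
    ultimately show "\<omega> \<in> prefix \<eta> k x t" by (auto simp: prefix_def)
  qed
  have "((\<lambda>\<zeta>. measure (P \<eta>) (?X \<zeta>)) has_sum measure (P \<eta>) ?U) E"
    using sum[OF sets.top] by simp
  moreover have "((\<lambda>\<zeta>. measure (P \<eta>) (?X \<zeta>)) has_sum measure (P \<eta>) (prefix \<eta> k x t)) E"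
  proof -
    have "((\<lambda>\<zeta>. measure (P \<eta>) (prefix \<eta> k x t) * jump_prob R (x k) \<zeta>) has_sum
        measure (P \<eta>) (prefix \<eta> k x t) * 1) E"
      using x by (intro has_sum_cmult_right jump_prob_has_sum) auto
    thus ?thesis
      by (subst has_sum_cong[where g = "\<lambda>\<zeta>. measure (P \<eta>) (prefix \<eta> k x t) * jump_prob R (x k) \<zeta>"])
        (use \<eta> x in \<open>auto simp: measure_prefix_Suc pmf_J\<close>)
  qed
  ultimately have "measure (P \<eta>) ?U = measure (P \<eta>) (prefix \<eta> k x t)" by (rule has_sum_unique)
  hence "measure (P \<eta>) (prefix \<eta> k x t - ?U) = 0"
    using finite_measure_Diff[OF prefix_sets[OF \<eta>] U sub] by simp
  hence null: "prefix \<eta> k x t - ?U \<in> null_sets (P \<eta>)"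
    using U prefix_sets[OF \<eta>] by (auto simp: null_sets_def emeasure_eq_measure)
  have "measure (P \<eta>) (prefix \<eta> k x t \<inter> Z) = measure (P \<eta>) (?U \<inter> Z)"
  proof (rule measure_eq_AE)
    show "AE \<omega> in P \<eta>. \<omega> \<in> prefix \<eta> k x t \<inter> Z \<longleftrightarrow> \<omega> \<in> ?U \<inter> Z"
      using AE_not_in[OF null] by eventually_elim (use sub in blast)
  qed (use \<eta> U Z in auto)
  moreover have "(\<Union>\<zeta>\<in>E. ?X \<zeta> \<inter> Z) = ?U \<inter> Z" by auto
  ultimately show ?thesis using sum[OF Z] by simp
qed

text \<open>The joint law is given on cylinders that fix all states, so positivity of later holding
  times is obtained by summing over the next state, one index at a time.\<close>

lemma measure_prefix_later_pos:
  assumes \<eta>: "\<eta> \<in> E" and "\<And>i. i \<le> k \<Longrightarrow> x i \<in> E \<and> 0 \<le> t i"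
  shows "measure (P \<eta>) (prefix \<eta> k x t \<inter> {\<omega> \<in> space (P \<eta>). \<forall>i\<in>{k<..k + N}. 0 < T i \<omega>}) =
    measure (P \<eta>) (prefix \<eta> k x t)"
  using assms(2)
proof (induction N arbitrary: k x t)
  case 0
  show ?case by simp
next
  case (Suc N)
  let ?Z = "\<lambda>k N. {\<omega> \<in> space (P \<eta>). \<forall>i\<in>{k<..k + N}. 0 < T i \<omega>}"
  let ?X = "\<lambda>\<zeta>. prefix \<eta> (Suc k) (x(Suc k := \<zeta>)) (t(Suc k := 0))"
  have Z: "?Z k N \<in> sets (P \<eta>)" for k N
    using \<eta> by measurable
  have sum1: "((\<lambda>\<zeta>. measure (P \<eta>) (?X \<zeta> \<inter> ?Z k (Suc N))) has_sum
      measure (P \<eta>) (prefix \<eta> k x t \<inter> ?Z k (Suc N))) E"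
    by (rule measure_prefix_Int_has_sum[OF \<eta> _ Z]) (use Suc.prems in auto)
  have sum2: "((\<lambda>\<zeta>. measure (P \<eta>) (?X \<zeta> \<inter> space (P \<eta>))) has_sum
      measure (P \<eta>) (prefix \<eta> k x t \<inter> space (P \<eta>))) E"
    by (rule measure_prefix_Int_has_sum[OF \<eta>]) (use Suc.prems in auto)
  have eq: "measure (P \<eta>) (?X \<zeta> \<inter> ?Z k (Suc N)) = measure (P \<eta>) (?X \<zeta> \<inter> space (P \<eta>))"
    if "\<zeta> \<in> E" for \<zeta>
  proof -
    have "?X \<zeta> \<inter> ?Z k (Suc N) = ?X \<zeta> \<inter> ?Z (Suc k) N"
    proof -
      have "0 < T (Suc k) \<omega>" if "\<omega> \<in> ?X \<zeta>" for \<omega>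
        using that by (auto simp: prefix_def dest: spec[of _ "Suc k"])
      moreover have "{k<..k + Suc N} = insert (Suc k) {Suc k<..Suc k + N}" by auto
      ultimately show ?thesis by auto
    qed
    moreover have "measure (P \<eta>) (?X \<zeta> \<inter> ?Z (Suc k) N) = measure (P \<eta>) (?X \<zeta>)"
      by (rule Suc.IH) (use Suc.prems that in \<open>auto simp: le_Suc_eq\<close>)
    ultimately show ?thesis by simp
  qed
  have "measure (P \<eta>) (prefix \<eta> k x t \<inter> ?Z k (Suc N)) =
      measure (P \<eta>) (prefix \<eta> k x t \<inter> space (P \<eta>))"
    by (rule has_sum_unique[OF iffD1[OF has_sum_cong[OF eq] sum1] sum2])
  thus ?case by simp
qed

lemma AE_regular:
  assumes \<eta>: "\<eta> \<in> E"
  shows "AE \<omega> in P \<eta>. Y 0 \<omega> = \<eta> \<and> (\<forall>i. 0 < T i \<omega>)"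
proof -
  interpret prob_space "P \<eta>" by (rule prob_space_P[OF \<eta>])
  let ?p = "prefix \<eta> 0 (\<lambda>_. \<eta>) (\<lambda>_. 0)"
  let ?Z = "\<lambda>N. {\<omega> \<in> space (P \<eta>). \<forall>i\<in>{0<..0 + N}. 0 < T i \<omega>}"
  have "AE \<omega> in P \<eta>. Y 0 \<omega> = \<eta> \<and> (\<forall>i\<le>N. 0 < T i \<omega>)" for N
  proof -
    have "prob (?p \<inter> ?Z N) = prob ?p"
      by (rule measure_prefix_later_pos[OF \<eta>]) (use \<eta> in auto)
    also have "\<dots> = 1" by (subst measure_prefix) (use \<eta> in auto)
    finally have "prob (?p \<inter> ?Z N) = 1" .
    moreover have "?p \<inter> ?Z N \<in> sets (P \<eta>)" using \<eta> by measurable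
    ultimately have "AE \<omega> in P \<eta>. \<omega> \<in> ?p \<inter> ?Z N" by (simp add: prob_eq_1)
    thus ?thesis
    proof eventually_elim
      fix \<omega> assume *: "\<omega> \<in> ?p \<inter> ?Z N"
      have "0 < T i \<omega>" if "i \<le> N" for i
        using * that by (cases "i = 0") (auto simp: prefix_def)
      thus "Y 0 \<omega> = \<eta> \<and> (\<forall>i\<le>N. 0 < T i \<omega>)" using * by (auto simp: prefix_def)
    qed
  qed
  hence "AE \<omega> in P \<eta>. \<forall>N. Y 0 \<omega> = \<eta> \<and> (\<forall>i\<le>N. 0 < T i \<omega>)" by (simp add: AE_all_countable)
  thus ?thesis by eventually_elim blast
qed

text \<open>First entrance into \<open>D\<close> after index \<open>k\<close>, within
  \<open>N\<close> jumps, located in \<open>B\<close> and followed by a sojourn longer than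
  \<open>\<tau>\<close>. The offset \<open>k\<close> lets the induction condition on a longer and
  longer prefix.\<close>

definition return_within :: "'a set \<Rightarrow> 'a set \<Rightarrow> real \<Rightarrow> nat \<Rightarrow> nat \<Rightarrow> 'w \<Rightarrow> bool" where
  "return_within D B \<tau> k N \<omega> \<longleftrightarrow>
    (\<exists>n\<in>{k<..k + N}. (\<forall>i\<in>{k<..<n}. Y i \<omega> \<notin> D) \<and> Y n \<omega> \<in> B \<and> \<tau> < T n \<omega>)"

lemma pred_return_within [measurable]:
  "\<eta> \<in> E \<Longrightarrow> Measurable.pred (P \<eta>) (return_within D B \<tau> k N)"
  unfolding return_within_def[abs_def] by measurable

lemma return_within_Suc:
  assumes "B \<subseteq> D"
  shows "return_within D B \<tau> k (Suc N) \<omega> \<longleftrightarrow>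
    (if Y (Suc k) \<omega> \<in> D then Y (Suc k) \<omega> \<in> B \<and> \<tau> < T (Suc k) \<omega>
     else return_within D B \<tau> (Suc k) N \<omega>)"
proof (cases "Y (Suc k) \<omega> \<in> D")
  case True
  hence "return_within D B \<tau> k (Suc N) \<omega> \<longleftrightarrow>
      (\<exists>n\<in>{k<..k + Suc N}. n = Suc k \<and> (\<forall>i\<in>{k<..<n}. Y i \<omega> \<notin> D) \<and> Y n \<omega> \<in> B \<and> \<tau> < T n \<omega>)"
    unfolding return_within_def
    by (intro bex_cong refl) (metis Suc_lessI greaterThanAtMost_iff greaterThanLessThan_iff lessI)
  thus ?thesis using True by auto
next
  case False
  have *: "{k<..k + Suc N} = insert (Suc k) {Suc k<..Suc k + N}" by auto
  have **: "(\<forall>i\<in>{k<..<n}. Y i \<omega> \<notin> D) \<longleftrightarrow> (\<forall>i\<in>{Suc k<..<n}. Y i \<omega> \<notin> D)" for n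
    using False by (metis Suc_lessI greaterThanLessThan_iff lessI less_trans)
  have "Y (Suc k) \<omega> \<notin> B" using False assms by blast
  thus ?thesis
    unfolding return_within_def * ** by (simp add: False)
qed

lemma discount_bounds:
  assumes "B \<subseteq> E" "0 \<le> \<tau>"
  shows "0 \<le> indicator B \<zeta> * exp (- rate \<zeta> * \<tau>)" "indicator B \<zeta> * exp (- rate \<zeta> * \<tau>) \<le> 1"
  using assms rate_nonneg[of \<zeta>] by (auto simp: indicator_def)

text \<open>First step analysis on the next state: in \<open>B\<close> the event is a cylinder, in
  \<open>D - B\<close> it is empty, and off \<open>D\<close> the induction hypothesis applies to the
  prolonged prefix. This reproduces the recursion of \<open>hit_within\<close>.\<close>

lemma measure_return_within:
  assumes \<eta>: "\<eta> \<in> E" and B: "B \<subseteq> D" and BE: "B \<subseteq> E" and \<tau>: "0 \<le> \<tau>" and "\<And>i. i \<le> k \<Longrightarrow> x i \<in> E \<and> 0 \<le> t i"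
  shows "measure (P \<eta>) (prefix \<eta> k x t \<inter> {\<omega> \<in> space (P \<eta>). return_within D B \<tau> k N \<omega>}) =
    measure (P \<eta>) (prefix \<eta> k x t) * K (hit_within D (\<lambda>\<zeta>. indicator B \<zeta> * exp (- rate \<zeta> * \<tau>)) N) (x k)"
  using assms(5)
proof (induction N arbitrary: k x t)
  case 0
  show ?case by (simp add: return_within_def K_def)
next
  case (Suc N)
  interpret prob_space "P \<eta>" by (rule prob_space_P[OF \<eta>])
  let ?g = "\<lambda>\<zeta>. indicator B \<zeta> * exp (- rate \<zeta> * \<tau>) :: real"
  let ?Z = "\<lambda>k N. {\<omega> \<in> space (P \<eta>). return_within D B \<tau> k N \<omega>}"
  let ?X = "\<lambda>\<zeta>. prefix \<eta> (Suc k) (x(Suc k := \<zeta>)) (t(Suc k := 0))"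
  let ?p = "measure (P \<eta>) (prefix \<eta> k x t)"
  have xk: "x k \<in> E" using Suc.prems by simp
  have Z: "?Z k N \<in> sets (P \<eta>)" for k N using \<eta> by measurable
  have sum: "((\<lambda>\<zeta>. measure (P \<eta>) (?X \<zeta> \<inter> ?Z k (Suc N))) has_sum
      measure (P \<eta>) (prefix \<eta> k x t \<inter> ?Z k (Suc N))) E"
    by (rule measure_prefix_Int_has_sum[OF \<eta> _ Z]) (use Suc.prems in auto)
  have term_eq: "measure (P \<eta>) (?X \<zeta> \<inter> ?Z k (Suc N)) = ?p * (pmf (J (x k)) \<zeta> * hit_within D ?g (Suc N) \<zeta>)"
    if \<zeta>: "\<zeta> \<in> E" for \<zeta>
  proof -
    have YX: "Y (Suc k) \<omega> = \<zeta>" if "\<omega> \<in> ?X \<zeta>" for \<omega>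
      using that by (auto simp: prefix_def dest: spec[of _ "Suc k"])
    show ?thesis
    proof (cases "\<zeta> \<in> D")
      case True
      show ?thesis
      proof (cases "\<zeta> \<in> B")
        case True
        \<comment> \<open>Asking for a sojourn longer than \<open>\<tau>\<close> at the point of
          return replaces the threshold 0 by \<open>\<tau>\<close> in the last coordinate; this is
          the origin of the exponential discount.\<close>
        have "?X \<zeta> \<inter> ?Z k (Suc N) = prefix \<eta> (Suc k) (x(Suc k := \<zeta>)) (t(Suc k := \<tau>))"
        proof -
          have "\<omega> \<in> ?X \<zeta> \<inter> ?Z k (Suc N) \<longleftrightarrow> \<omega> \<in> ?X \<zeta> \<and> \<tau> < T (Suc k) \<omega>" for \<omega>
            using YX[of \<omega>] True B return_within_Suc[OF B, of \<tau> k N \<omega>]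
            by (auto simp: prefix_def)
          moreover have "\<omega> \<in> ?X \<zeta> \<and> \<tau> < T (Suc k) \<omega> \<longleftrightarrow>
              \<omega> \<in> prefix \<eta> (Suc k) (x(Suc k := \<zeta>)) (t(Suc k := \<tau>))" for \<omega>
            using \<tau> by (auto simp: prefix_def le_Suc_eq all_conj_distrib)
          ultimately show ?thesis by blast
        qed
        thus ?thesis
          using True B measure_prefix_Suc[of \<eta> k x t \<zeta> \<tau>, OF \<eta> Suc.prems \<zeta> \<tau>] by auto
      next
        case False
        hence "?X \<zeta> \<inter> ?Z k (Suc N) = {}"
          using YX \<open>\<zeta> \<in> D\<close> return_within_Suc[OF B, of \<tau> k N] by auto
        thus ?thesis using False \<open>\<zeta> \<in> D\<close> by simp
      qed
    next
      case False
      hence "?X \<zeta> \<inter> ?Z k (Suc N) = ?X \<zeta> \<inter> ?Z (Suc k) N"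
        using YX return_within_Suc[OF B, of \<tau> k N] by auto
      moreover have "measure (P \<eta>) (?X \<zeta> \<inter> ?Z (Suc k) N) =
          measure (P \<eta>) (?X \<zeta>) * K (hit_within D ?g N) ((x(Suc k := \<zeta>)) (Suc k))"
        by (rule Suc.IH) (use Suc.prems \<zeta> in \<open>auto simp: le_Suc_eq\<close>)
      ultimately show ?thesis
        using False measure_prefix_Suc[of \<eta> k x t \<zeta> 0, OF \<eta> Suc.prems \<zeta>] by simp
    qed
  qed
  have "integrable (measure_pmf (J (x k))) (hit_within D ?g (Suc N))"
    by (rule pmf_integrable_bounded)
      (use hit_within_bounds[of ?g D "Suc N"] discount_bounds[OF BE \<tau>] in
        \<open>auto simp: bounded_real_image_iff simp del: hit_within.simps intro!: exI[of _ 1]\<close>)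
  from pmf_expectation_has_sum[OF this set_pmf_J[OF xk]]
  have "((\<lambda>\<zeta>. ?p * (pmf (J (x k)) \<zeta> * hit_within D ?g (Suc N) \<zeta>)) has_sum
      ?p * K (hit_within D ?g (Suc N)) (x k)) E"
    unfolding K_def by (rule has_sum_cmult_right)
  moreover have "((\<lambda>\<zeta>. ?p * (pmf (J (x k)) \<zeta> * hit_within D ?g (Suc N) \<zeta>)) has_sum
      measure (P \<eta>) (prefix \<eta> k x t \<inter> ?Z k (Suc N))) E"
    using sum by (subst (asm) has_sum_cong[OF term_eq]) auto
  ultimately show ?case by (rule has_sum_unique[symmetric])
qed

end

lemma returns_at_unique: "returns_at Y D n \<omega> \<Longrightarrow> returns_at Y D n' \<omega> \<Longrightarrow> n = n'"
  unfolding returns_at_def by (meson linorder_neqE_nat)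

section \<open>Small time asymptotics of the first return\<close>

context jump_hold_process
begin

abbreviation returns :: "'a set \<Rightarrow> 'a set \<Rightarrow> real \<Rightarrow> 'w \<Rightarrow> bool" where
  "returns D B \<tau> \<omega> \<equiv> \<exists>n. returns_at Y D n \<omega> \<and> Y n \<omega> \<in> B \<and> \<tau> < T n \<omega>"

text \<open>The factor \<open>exp (- rate \<zeta> * \<tau>)\<close> is the probability that the sojourn at the point \<open>\<zeta>\<close> of return
  lasts longer than \<open>\<tau>\<close>.\<close>

definition return_value :: "'a \<Rightarrow> 'a set \<Rightarrow> 'a set \<Rightarrow> real \<Rightarrow> real" where
  "return_value \<eta> D B \<tau> = K (hit D (\<lambda>\<zeta>. indicator B \<zeta> * exp (- rate \<zeta> * \<tau>))) \<eta>"

definition return_event :: "'a \<Rightarrow> 'a set \<Rightarrow> 'a set \<Rightarrow> real \<Rightarrow> real \<Rightarrow> 'w set" where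
  "return_event \<eta> D B s \<tau> = {\<omega> \<in> space (P \<eta>). Y 0 \<omega> = \<eta> \<and> s < T 0 \<omega> \<and> returns D B \<tau> \<omega>}"

lemma pred_returns [measurable]: "\<eta> \<in> E \<Longrightarrow> Measurable.pred (P \<eta>) (returns D B \<tau>)"
  unfolding returns_at_def[abs_def] by measurable

lemma return_event_sets [measurable]: "\<eta> \<in> E \<Longrightarrow> return_event \<eta> D B s \<tau> \<in> sets (P \<eta>)"
  unfolding return_event_def by measurable

lemma return_value_0: "return_value \<eta> D B 0 = K (hit_prob D B) \<eta>"
  by (simp add: return_value_def hit_prob_def)

lemma ex_return_within_iff:
  assumes "B \<subseteq> D"
  shows "(\<exists>N. return_within D B \<tau> 0 N \<omega>) \<longleftrightarrow> returns D B \<tau> \<omega>"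
proof
  assume "\<exists>N. return_within D B \<tau> 0 N \<omega>"
  thus "returns D B \<tau> \<omega>"
    using assms unfolding return_within_def returns_at_def by fastforce
next
  assume "returns D B \<tau> \<omega>"
  then obtain n where "returns_at Y D n \<omega>" "Y n \<omega> \<in> B" "\<tau> < T n \<omega>" by blast
  hence "return_within D B \<tau> 0 n \<omega>"
    unfolding return_within_def returns_at_def by (intro bexI[of _ n]) auto
  thus "\<exists>N. return_within D B \<tau> 0 N \<omega>" ..
qed

text \<open>Let the number of allowed jumps tend to infinity in
  \<open>measure_return_within\<close>: the events increase to \<open>return_event\<close>, and the
  iterated kernels converge by \<open>K_hit_within_LIMSEQ\<close>.\<close>

lemma measure_return_event:
  assumes \<eta>: "\<eta> \<in> E" and B: "B \<subseteq> D" "B \<subseteq> E" and s: "0 \<le> s" and \<tau>: "0 \<le> \<tau>"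
  shows "measure (P \<eta>) (return_event \<eta> D B s \<tau>) = exp (- rate \<eta> * s) * return_value \<eta> D B \<tau>"
proof -
  interpret prob_space "P \<eta>" by (rule prob_space_P[OF \<eta>])
  let ?g = "\<lambda>\<zeta>. indicator B \<zeta> * exp (- rate \<zeta> * \<tau>) :: real"
  let ?p = "prefix \<eta> 0 (\<lambda>_. \<eta>) (\<lambda>_. s)"
  let ?A = "\<lambda>N. ?p \<inter> {\<omega> \<in> space (P \<eta>). return_within D B \<tau> 0 N \<omega>}"
  have p: "measure (P \<eta>) ?p = exp (- rate \<eta> * s)"
    by (subst measure_prefix) (use \<eta> s in auto)
  have "incseq ?A"
  proof (rule incseq_SucI)
    show "?A N \<subseteq> ?A (Suc N)" for N
      unfolding return_within_def by fastforce
  qed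
  hence lim: "(\<lambda>N. measure (P \<eta>) (?A N)) \<longlonglongrightarrow> measure (P \<eta>) (\<Union>N. ?A N)"
    using \<eta> by (intro finite_Lim_measure_incseq) (auto simp: image_subset_iff)
  have union: "(\<Union>N. ?A N) = return_event \<eta> D B s \<tau>"
    using ex_return_within_iff[OF B(1), of \<tau>]
    by (auto simp: return_event_def prefix_def)
  have "measure (P \<eta>) (?A N) = exp (- rate \<eta> * s) * K (hit_within D ?g N) \<eta>" for N
    by (subst measure_return_within) (use \<eta> B \<tau> s p in auto)
  hence "(\<lambda>N. exp (- rate \<eta> * s) * K (hit_within D ?g N) \<eta>) \<longlonglongrightarrow>
      measure (P \<eta>) (return_event \<eta> D B s \<tau>)"
    using lim unfolding union by simp
  moreover have "(\<lambda>N. exp (- rate \<eta> * s) * K (hit_within D ?g N) \<eta>) \<longlonglongrightarrow>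
      exp (- rate \<eta> * s) * return_value \<eta> D B \<tau>"
    unfolding return_value_def
    by (intro tendsto_intros K_hit_within_LIMSEQ discount_bounds[OF B(2) \<tau>])
  ultimately show ?thesis
    by (rule LIMSEQ_unique)
qed

text \<open>The rates may be unbounded on \<open>B\<close>, so no uniform estimate of the discount
  is available. Instead the value is read as the probability of an event that increases as
  \<open>\<tau>\<close> decreases to 0, and continuity from below applies.\<close>

lemma return_value_tendsto:
  assumes \<eta>: "\<eta> \<in> E" and B: "B \<subseteq> D" "B \<subseteq> E"
  shows "(return_value \<eta> D B \<longlongrightarrow> K (hit_prob D B) \<eta>) (at_right 0)"
proof (rule tendsto_at_right_sequentially[of 0 1])
  interpret prob_space "P \<eta>" by (rule prob_space_P[OF \<eta>])
  fix S :: "nat \<Rightarrow> real"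
  assume S: "\<And>n. 0 < S n" "decseq S" "S \<longlonglongrightarrow> 0"
  have eq: "return_value \<eta> D B \<tau> = measure (P \<eta>) (return_event \<eta> D B 0 \<tau>)" if "0 \<le> \<tau>" for \<tau>
    using measure_return_event[OF \<eta> B order_refl that] by simp
  let ?A = "\<lambda>n. return_event \<eta> D B 0 (S n)"
  have "incseq ?A"
  proof (rule incseq_SucI)
    show "?A n \<subseteq> ?A (Suc n)" for n
      using decseqD[OF S(2), of n "Suc n"] unfolding return_event_def by fastforce
  qed
  hence "(\<lambda>n. measure (P \<eta>) (?A n)) \<longlonglongrightarrow> measure (P \<eta>) (\<Union>n. ?A n)"
    using \<eta> by (intro finite_Lim_measure_incseq) (auto simp: image_subset_iff)
  moreover have "(\<Union>n. ?A n) = return_event \<eta> D B 0 0"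
  proof (intro equalityI subsetI)
    fix \<omega> assume "\<omega> \<in> (\<Union>n. ?A n)"
    then obtain n k where "\<omega> \<in> space (P \<eta>)" "Y 0 \<omega> = \<eta>" "0 < T 0 \<omega>"
      "returns_at Y D k \<omega>" "Y k \<omega> \<in> B" "S n < T k \<omega>" by (auto simp: return_event_def)
    moreover from this have "0 < T k \<omega>" using S(1)[of n] by linarith
    ultimately show "\<omega> \<in> return_event \<eta> D B 0 0" by (auto simp: return_event_def)
  next
    fix \<omega> assume "\<omega> \<in> return_event \<eta> D B 0 0"
    then obtain k where k: "\<omega> \<in> space (P \<eta>)" "Y 0 \<omega> = \<eta>" "0 < T 0 \<omega>"
      "returns_at Y D k \<omega>" "Y k \<omega> \<in> B" "0 < T k \<omega>" by (auto simp: return_event_def)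
    from order_tendstoD(2)[OF S(3) k(6)] obtain n where "S n < T k \<omega>"
      by (auto simp: eventually_sequentially)
    thus "\<omega> \<in> (\<Union>n. ?A n)" using k by (auto simp: return_event_def)
  qed
  ultimately show "(\<lambda>n. return_value \<eta> D B (S n)) \<longlonglongrightarrow> K (hit_prob D B) \<eta>"
    using eq[of 0] eq[OF less_imp_le[OF S(1)]] by (simp add: return_value_0)
qed simp

lemma jump_before_rate:
  "((\<lambda>t. (1 - exp (- rate \<eta> * t)) / t) \<longlongrightarrow> rate \<eta>) (at_right 0)"
proof -
  have "((\<lambda>t. 1 - exp (- rate \<eta> * t)) has_real_derivative rate \<eta>) (at 0)"
    by (auto intro!: derivative_eq_intros)
  hence "((\<lambda>t. (1 - exp (- rate \<eta> * t)) / t) \<longlongrightarrow> rate \<eta>) (at 0)"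
    by (simp add: DERIV_def)
  thus ?thesis by (rule filterlim_mono) (auto simp: at_within_le_at)
qed

lemma jump_before_le: "1 - exp (- rate \<eta> * t) \<le> rate \<eta> * t"
  using exp_ge_add_one_self[of "- rate \<eta> * t"] by simp

lemma measure_jump_before:
  assumes \<eta>: "\<eta> \<in> E" and t: "0 \<le> t"
  shows "measure (P \<eta>) {\<omega> \<in> space (P \<eta>). T 0 \<omega> \<le> t} = 1 - exp (- rate \<eta> * t)"
proof -
  interpret prob_space "P \<eta>" by (rule prob_space_P[OF \<eta>])
  have "prob (prefix \<eta> 0 (\<lambda>_. \<eta>) (\<lambda>_. t)) = exp (- rate \<eta> * t)"
    by (subst measure_prefix) (use \<eta> t in auto)
  moreover have "prob (prefix \<eta> 0 (\<lambda>_. \<eta>) (\<lambda>_. t)) = prob {\<omega> \<in> space (P \<eta>). \<not> T 0 \<omega> \<le> t}"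
  proof (rule measure_eq_AE)
    show "AE \<omega> in P \<eta>. \<omega> \<in> prefix \<eta> 0 (\<lambda>_. \<eta>) (\<lambda>_. t) \<longleftrightarrow> \<omega> \<in> {\<omega> \<in> space (P \<eta>). \<not> T 0 \<omega> \<le> t}"
      using AE_regular[OF \<eta>] by eventually_elim (auto simp: prefix_def)
  qed (use \<eta> in measurable)
  moreover have "{\<omega> \<in> space (P \<eta>). T 0 \<omega> \<le> t} = space (P \<eta>) - {\<omega> \<in> space (P \<eta>). \<not> T 0 \<omega> \<le> t}"
    by auto
  moreover have "{\<omega> \<in> space (P \<eta>). \<not> T 0 \<omega> \<le> t} \<in> events" using \<eta> by measurable
  ultimately show ?thesis by (simp add: prob_compl)
qed

text \<open>A sandwich: \<open>lower\<close> bounds the probability of \<open>W t\<close> below by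
  that of a jump before \<open>t\<close> and a return to \<open>B\<close> with sojourn longer than
  \<open>t\<close>; \<open>upper\<close> bounds it above by a jump and a return to \<open>B\<close>,
  plus a jump and a return followed by a sojourn of length at most \<open>t\<close>. It serves both
  the trace and the process itself.\<close>

lemma jump_rate_limit:
  fixes W :: "real \<Rightarrow> 'w set"
  assumes \<eta>: "\<eta> \<in> E" and B: "B \<subseteq> D" and D: "D \<subseteq> E"
    and W [measurable]: "\<And>t. 0 < t \<Longrightarrow> W t \<in> sets (P \<eta>)"
    and lower: "\<And>t \<omega>. 0 < t \<Longrightarrow> \<omega> \<in> space (P \<eta>) \<Longrightarrow> Y 0 \<omega> = \<eta> \<Longrightarrow> (\<And>i. 0 < T i \<omega>) \<Longrightarrow>
      T 0 \<omega> \<le> t \<Longrightarrow> returns D B t \<omega> \<Longrightarrow> \<omega> \<in> W t"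
    and upper: "\<And>t \<omega>. 0 < t \<Longrightarrow> \<omega> \<in> space (P \<eta>) \<Longrightarrow> Y 0 \<omega> = \<eta> \<Longrightarrow> (\<And>i. 0 < T i \<omega>) \<Longrightarrow>
      \<omega> \<in> W t \<Longrightarrow> T 0 \<omega> \<le> t \<and> (\<exists>n. returns_at Y D n \<omega> \<and> (Y n \<omega> \<in> B \<or> T n \<omega> \<le> t))"
  shows "((\<lambda>t. measure (P \<eta>) (W t) / t) \<longlongrightarrow> rate \<eta> * K (hit_prob D B) \<eta>) (at_right 0)"
proof -
  interpret prob_space "P \<eta>" by (rule prob_space_P[OF \<eta>])
  have BE: "B \<subseteq> E" using B D by blast
  define F where "F = (\<lambda>t. 1 - exp (- rate \<eta> * t))"
  \<comment> \<open>First jump in the interval from 0 to \<open>t\<close>, then a return to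
    \<open>D\<close> located in \<open>C\<close> with sojourn longer than
    \<open>\<tau>\<close>.\<close>
  define X where "X = (\<lambda>C t \<tau>. return_event \<eta> D C 0 \<tau> - return_event \<eta> D C t \<tau>)"
  have X_sets: "X C t \<tau> \<in> events" for C t \<tau> unfolding X_def using \<eta> by measurable
  have X_prob: "prob (X C t \<tau>) = F t * return_value \<eta> D C \<tau>"
    if "C \<subseteq> D" "C \<subseteq> E" "0 \<le> t" "0 \<le> \<tau>" for C t \<tau>
  proof -
    have "return_event \<eta> D C t \<tau> \<subseteq> return_event \<eta> D C 0 \<tau>"
      using that by (auto simp: return_event_def)
    hence "prob (X C t \<tau>) = prob (return_event \<eta> D C 0 \<tau>) - prob (return_event \<eta> D C t \<tau>)"
      unfolding X_def using \<eta> by (intro finite_measure_Diff) auto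
    thus ?thesis
      using that \<eta> by (simp add: measure_return_event F_def algebra_simps)
  qed
  have X_iff: "\<omega> \<in> X C t \<tau> \<longleftrightarrow> Y 0 \<omega> = \<eta> \<and> 0 < T 0 \<omega> \<and> T 0 \<omega> \<le> t \<and> returns D C \<tau> \<omega>"
    if "\<omega> \<in> space (P \<eta>)" for \<omega> C t \<tau>
    using that by (auto simp: X_def return_event_def)
  have lo: "F t / t * return_value \<eta> D B t \<le> prob (W t) / t" if t: "0 < t" for t
  proof -
    have "prob (X B t t) \<le> prob (W t)"
    proof (rule finite_measure_mono_AE)
      show "AE \<omega> in P \<eta>. \<omega> \<in> X B t t \<longrightarrow> \<omega> \<in> W t"
        using AE_regular[OF \<eta>] AE_space
      proof eventually_elim
        fix \<omega> assume "Y 0 \<omega> = \<eta> \<and> (\<forall>i. 0 < T i \<omega>)" "\<omega> \<in> space (P \<eta>)"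
        thus "\<omega> \<in> X B t t \<longrightarrow> \<omega> \<in> W t"
          using lower[OF t] by (simp add: X_iff)
      qed
    qed (rule W[OF t])
    thus ?thesis using t X_prob[OF B BE, of t t] by (simp add: divide_right_mono)
  qed
  have up: "prob (W t) / t \<le> F t / t *
      (return_value \<eta> D B 0 + (return_value \<eta> D D 0 - return_value \<eta> D D t))" if t: "0 < t" for t
  proof -
    have sub: "X D t t \<subseteq> X D t 0"
    proof
      fix \<omega> assume \<omega>: "\<omega> \<in> X D t t"
      hence s: "\<omega> \<in> space (P \<eta>)" by (simp add: X_def return_event_def)
      from \<omega> obtain n where "returns_at Y D n \<omega>" "Y n \<omega> \<in> D" "t < T n \<omega>"
        by (auto simp: X_iff[OF s])
      hence "returns D D 0 \<omega>" using t by (meson less_trans)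
      thus "\<omega> \<in> X D t 0" using \<omega> by (simp add: X_iff[OF s])
    qed
    \<comment> \<open>The difference \<open>X D t 0 - X D t t\<close> is the event of two short
      holding times. Divided by \<open>t\<close>, its probability still tends to 0, since
      \<open>return_value \<eta> D D t\<close> tends to its value at 0.\<close>
    have "prob (W t) \<le> prob (X B t 0 \<union> (X D t 0 - X D t t))"
    proof (rule finite_measure_mono_AE)
      show "AE \<omega> in P \<eta>. \<omega> \<in> W t \<longrightarrow> \<omega> \<in> X B t 0 \<union> (X D t 0 - X D t t)"
        using AE_regular[OF \<eta>] AE_space
      proof eventually_elim
        fix \<omega> assume 1: "Y 0 \<omega> = \<eta> \<and> (\<forall>i. 0 < T i \<omega>)" and 2: "\<omega> \<in> space (P \<eta>)"
        show "\<omega> \<in> W t \<longrightarrow> \<omega> \<in> X B t 0 \<union> (X D t 0 - X D t t)"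
        proof
          assume "\<omega> \<in> W t"
          with upper[OF t 2] 1 obtain n where n: "T 0 \<omega> \<le> t" "returns_at Y D n \<omega>"
            "Y n \<omega> \<in> B \<or> T n \<omega> \<le> t" by blast
          show "\<omega> \<in> X B t 0 \<union> (X D t 0 - X D t t)"
          proof (cases "Y n \<omega> \<in> B")
            case True
            thus ?thesis using n 1 by (auto simp: X_iff[OF 2])
          next
            case False
            hence "\<not> returns D D t \<omega>"
              using n returns_at_unique by (metis not_less)
            moreover have "returns D D 0 \<omega>"
              using n(2) 1 unfolding returns_at_def by blast
            ultimately show ?thesis using n 1 by (auto simp: X_iff[OF 2])
          qed
        qed
      qed
    qed (use X_sets in auto)
    also have "\<dots> \<le> prob (X B t 0) + prob (X D t 0 - X D t t)"
      using X_sets by (intro measure_Un_le) auto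
    also have "prob (X D t 0 - X D t t) = prob (X D t 0) - prob (X D t t)"
      using X_sets sub by (intro finite_measure_Diff) auto
    finally have "prob (W t) \<le> F t * (return_value \<eta> D B 0 + (return_value \<eta> D D 0 - return_value \<eta> D D t))"
      using X_prob[OF B BE, of t 0] X_prob[OF order_refl D, of t 0] X_prob[OF order_refl D, of t t] t
      by (simp add: algebra_simps)
    thus ?thesis using t by (simp add: divide_right_mono)
  qed
  have F: "((\<lambda>t. F t / t) \<longlongrightarrow> rate \<eta>) (at_right 0)"
    unfolding F_def by (rule jump_before_rate)
  show ?thesis
  proof (rule tendsto_sandwich)
    show "\<forall>\<^sub>F t in at_right 0. F t / t * return_value \<eta> D B t \<le> prob (W t) / t"
      using lo by (simp add: eventually_at_right_less eventually_mono[OF eventually_at_right_less])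
    show "\<forall>\<^sub>F t in at_right 0. prob (W t) / t \<le> F t / t *
        (return_value \<eta> D B 0 + (return_value \<eta> D D 0 - return_value \<eta> D D t))"
      using up by (simp add: eventually_mono[OF eventually_at_right_less])
    show "((\<lambda>t. F t / t * return_value \<eta> D B t) \<longlongrightarrow> rate \<eta> * K (hit_prob D B) \<eta>) (at_right 0)"
      by (intro tendsto_mult F return_value_tendsto \<eta> B BE)
    have "((\<lambda>t. F t / t * (return_value \<eta> D B 0 + (return_value \<eta> D D 0 - return_value \<eta> D D t))) \<longlongrightarrow>
        rate \<eta> * (return_value \<eta> D B 0 + (return_value \<eta> D D 0 - K (hit_prob D D) \<eta>))) (at_right 0)"
      by (intro tendsto_intros F return_value_tendsto \<eta> D order_refl)
    thus "((\<lambda>t. F t / t * (return_value \<eta> D B 0 + (return_value \<eta> D D 0 - return_value \<eta> D D t))) \<longlongrightarrow>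
        rate \<eta> * K (hit_prob D B) \<eta>) (at_right 0)"
      by (simp add: return_value_0)
  qed
qed

text \<open>\<open>hit_prob_UN\<close> covers finite families only; countable additivity comes from
  the disjoint events of a return at the single points of \<open>B\<close>.\<close>

lemma K_hit_prob_has_sum:
  assumes \<eta>: "\<eta> \<in> E" and B: "B \<subseteq> D" "B \<subseteq> E"
  shows "((\<lambda>\<xi>. K (hit_prob D {\<xi>}) \<eta>) has_sum K (hit_prob D B) \<eta>) B"
proof -
  interpret prob_space "P \<eta>" by (rule prob_space_P[OF \<eta>])
  have eq: "K (hit_prob D C) \<eta> = prob (return_event \<eta> D C 0 0)" if "C \<subseteq> D" "C \<subseteq> E" for C
    using measure_return_event[OF \<eta> that order_refl order_refl] by (simp add: return_value_0)
  have "((\<lambda>\<xi>. prob (return_event \<eta> D {\<xi>} 0 0)) has_sum prob (\<Union>\<xi>\<in>B. return_event \<eta> D {\<xi>} 0 0)) B"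
  proof (rule measure_has_sum)
    show "countable B" using countable_E B(2) by (rule countable_subset[rotated])
    show "disjoint_family_on (\<lambda>\<xi>. return_event \<eta> D {\<xi>} 0 0) B"
      unfolding disjoint_family_on_def return_event_def
      by (auto dest: returns_at_unique)
  qed (use \<eta> in auto)
  also have "(\<Union>\<xi>\<in>B. return_event \<eta> D {\<xi>} 0 0) = return_event \<eta> D B 0 0"
    unfolding return_event_def by auto
  finally have "((\<lambda>\<xi>. prob (return_event \<eta> D {\<xi>} 0 0)) has_sum K (hit_prob D B) \<eta>) B"
    by (simp add: eq[OF B])
  thus ?thesis
    by (rule iffD2[OF has_sum_cong, rotated]) (rule eq; use B in blast)
qed

end

section \<open>Jump rates of the process and of its trace\<close>

context jump_hold_process
begin

text \<open>Joint measurability in time and path is required because the state is integrated over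
  time in \<open>time_in\<close> and evaluated at a random time in \<open>trace_at\<close>.\<close>

lemma measurable_process_at:
  assumes \<eta>: "\<eta> \<in> E"
  shows "Measurable.pred (borel \<Otimes>\<^sub>M P \<eta>) (\<lambda>z. process_at Y T (fst z) (snd z) \<in> Some ` G)"
proof -
  have [measurable]: "(\<lambda>z. T n (snd z)) \<in> borel_measurable (borel \<Otimes>\<^sub>M P \<eta>)" for n
    using \<eta> by measurable
  have [measurable]: "Measurable.pred (borel \<Otimes>\<^sub>M P \<eta>) (\<lambda>z. Y n (snd z) \<in> G)" for n
    by (rule measurable_compose[OF measurable_snd pred_Y[OF \<eta>]])
  show ?thesis unfolding process_at_mem_iff by measurable
qed

lemma pred_process_at [measurable]:
  assumes \<eta>: "\<eta> \<in> E" and f [measurable]: "f \<in> borel_measurable (P \<eta>)"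
  shows "Measurable.pred (P \<eta>) (\<lambda>\<omega>. process_at Y T (f \<omega>) \<omega> = Some \<xi>)"
proof -
  have "(\<lambda>\<omega>. (f \<omega>, \<omega>)) \<in> P \<eta> \<rightarrow>\<^sub>M borel \<Otimes>\<^sub>M P \<eta>" by measurable
  from measurable_compose[OF this measurable_process_at[OF \<eta>, of "{\<xi>}"]] show ?thesis
    unfolding process_at_eq_Some_iff by simp
qed

lemma measurable_time_in [measurable]:
  assumes \<eta>: "\<eta> \<in> E"
  shows "time_in Y T D s \<in> borel_measurable (P \<eta>)"
proof -
  have "Measurable.pred (borel \<Otimes>\<^sub>M P \<eta>) (\<lambda>z. process_at Y T (fst z) (snd z) \<in> Some ` D)"
    by (rule measurable_process_at[OF \<eta>])
  from measurable_compose[OF measurable_pair_swap' this]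
  have [measurable]: "Measurable.pred (P \<eta> \<Otimes>\<^sub>M lborel) (\<lambda>z. process_at Y T (snd z) (fst z) \<in> Some ` D)"
    by (simp add: case_prod_beta cong: measurable_cong_sets)
  have "(\<lambda>z. indicator {0..s} (snd z) *\<^sub>R indicator (Some ` D) (process_at Y T (snd z) (fst z)) :: real)
      \<in> borel_measurable (P \<eta> \<Otimes>\<^sub>M lborel)"
    unfolding indicator_def[of "Some ` D"] of_bool_def by measurable
  hence "(\<lambda>\<omega>. \<integral>u. indicator {0..s} u *\<^sub>R (indicator (Some ` D) (process_at Y T u \<omega>) :: real) \<partial>lborel)
      \<in> borel_measurable (P \<eta>)"
    by (intro lborel.borel_measurable_lebesgue_integral) (simp add: case_prod_beta)
  thus ?thesis by (simp add: time_in_def[abs_def] set_lebesgue_integral_def)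
qed

lemma pred_trace_at:
  assumes \<eta>: "\<eta> \<in> E" and t: "0 \<le> t"
  shows "{\<omega> \<in> space (P \<eta>). trace_at Y T D t \<omega> = Some \<xi>} \<in> sets (P \<eta>)"
proof -
  let ?A = "\<lambda>\<omega>. {s. 0 \<le> s \<and> time_in Y T D s \<omega> \<le> t}"
  \<comment> \<open>The inverse clock, set to 0 where the supremum is not over a bounded set; its
    superlevel sets are described by \<open>le_Sup_time_in_iff\<close>.\<close>
  let ?\<sigma> = "\<lambda>\<omega>. if \<exists>n::nat. t < time_in Y T D n \<omega> then Sup (?A \<omega>) else 0"
  note bdd = bdd_above_time_in_iff[OF t, of Y T D]
  note [measurable] = measurable_time_in[OF \<eta>]
  have "{\<omega> \<in> space (P \<eta>). a \<le> ?\<sigma> \<omega>} \<in> sets (P \<eta>)" for a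
  proof (cases "a \<le> 0")
    case True
    have "0 \<le> ?\<sigma> \<omega>" for \<omega>
    proof (cases "\<exists>n::nat. t < time_in Y T D n \<omega>")
      case b: True
      have "time_in Y T D 0 \<omega> \<le> t" using time_in_le[of 0 0 Y T D \<omega>] t by auto
      thus ?thesis using le_Sup_time_in_iff[OF t, of Y T D \<omega> 0] b bdd[of \<omega>] by simp
    qed simp
    hence "{\<omega> \<in> space (P \<eta>). a \<le> ?\<sigma> \<omega>} = space (P \<eta>)" using True order_trans by blast
    thus ?thesis by simp
  next
    case False
    have "a \<le> ?\<sigma> \<omega> \<longleftrightarrow> (\<exists>n::nat. t < time_in Y T D n \<omega>) \<and> time_in Y T D a \<omega> \<le> t" for \<omega>
      using le_Sup_time_in_iff[OF t, of Y T D \<omega> a] bdd[of \<omega>] False by auto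
    moreover have "{\<omega> \<in> space (P \<eta>). (\<exists>n::nat. t < time_in Y T D n \<omega>) \<and> time_in Y T D a \<omega> \<le> t}
        \<in> sets (P \<eta>)" by measurable
    ultimately show ?thesis by simp
  qed
  hence [measurable]: "?\<sigma> \<in> borel_measurable (P \<eta>)"
    unfolding borel_measurable_iff_ge by blast
  have "{\<omega> \<in> space (P \<eta>). trace_at Y T D t \<omega> = Some \<xi>} =
      {\<omega> \<in> space (P \<eta>). (\<exists>n::nat. t < time_in Y T D n \<omega>) \<and> process_at Y T (?\<sigma> \<omega>) \<omega> = Some \<xi>}"
    using bdd by (auto simp: trace_at_def)
  also have "\<dots> \<in> sets (P \<eta>)" using \<eta> by measurable
  finally show ?thesis .
qed

lemma trace_rate_eq:
  assumes D: "D \<subseteq> E" and \<eta>: "\<eta> \<in> D" and \<xi>: "\<xi> \<in> D" "\<eta> \<noteq> \<xi>"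
  shows "trace_rate P Y T D \<eta> \<xi> = rate \<eta> * K (hit_prob D {\<xi>}) \<eta>"
proof -
  have \<eta>E: "\<eta> \<in> E" using D \<eta> by blast
  let ?W = "\<lambda>t. {\<omega> \<in> space (P \<eta>). trace_at Y T D t \<omega> = Some \<xi>}"
  have "((\<lambda>t. measure (P \<eta>) (?W t) / t) \<longlongrightarrow> rate \<eta> * K (hit_prob D {\<xi>}) \<eta>) (at_right 0)"
  proof (rule jump_rate_limit[OF \<eta>E _ D])
    fix t :: real and \<omega>
    assume t: "0 < t" and \<omega>: "\<omega> \<in> space (P \<eta>)" "Y 0 \<omega> = \<eta>" and pos: "\<And>i. 0 < T i \<omega>"
    show "\<omega> \<in> ?W t" if "T 0 \<omega> \<le> t" "returns D {\<xi>} t \<omega>"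
      using that trace_at_after_return[where T = T and \<omega> = \<omega>, OF pos, of Y D t] \<omega> \<eta> by auto
    show "T 0 \<omega> \<le> t \<and> (\<exists>n. returns_at Y D n \<omega> \<and> (Y n \<omega> \<in> {\<xi>} \<or> T n \<omega> \<le> t))" if "\<omega> \<in> ?W t"
      using trace_at_SomeD[where T = T and \<omega> = \<omega>, OF pos, of Y D \<xi> t] \<omega> \<eta> \<xi> t that by auto
  qed (use \<xi> \<eta>E pred_trace_at in auto)
  thus ?thesis unfolding trace_rate_def by (intro tendsto_Lim) auto
qed

text \<open>The case \<open>D = E\<close> of \<open>jump_rate_limit\<close>: every jump is a return,
  so the first return has index 1. Requiring a jump before \<open>t\<close> removes the paths that
  stay put, which lets \<open>\<xi> = \<eta>\<close> be included.\<close>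

lemma process_rate_limit:
  assumes \<eta>: "\<eta> \<in> E" and \<xi>: "\<xi> \<in> E"
  shows "((\<lambda>t. measure (P \<eta>) {\<omega> \<in> space (P \<eta>). T 0 \<omega> \<le> t \<and> process_at Y T t \<omega> = Some \<xi>} / t)
    \<longlongrightarrow> rate \<eta> * pmf (J \<eta>) \<xi>) (at_right 0)"
proof -
  let ?W = "\<lambda>t. {\<omega> \<in> space (P \<eta>). T 0 \<omega> \<le> t \<and> process_at Y T t \<omega> = Some \<xi>}"
  have "((\<lambda>t. measure (P \<eta>) (?W t) / t) \<longlongrightarrow> rate \<eta> * K (hit_prob E {\<xi>}) \<eta>) (at_right 0)"
  proof (rule jump_rate_limit[OF \<eta> _ order_refl])
    show "?W t \<in> sets (P \<eta>)" for t using \<eta> by measurable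
    fix t :: real and \<omega>
    assume t: "0 < t" and \<omega>: "\<omega> \<in> space (P \<eta>)" "Y 0 \<omega> = \<eta>" and pos: "\<And>i. 0 < T i \<omega>"
    have ret: "returns_at Y E n \<omega> \<longleftrightarrow> n = 1" for n
    proof
      assume n: "returns_at Y E n \<omega>"
      show "n = 1"
      proof (rule ccontr)
        assume "n \<noteq> 1"
        hence "Y 1 \<omega> \<notin> E" using n by (simp add: returns_at_def)
        thus False using Y_in_E[OF \<eta> \<omega>(1)] by blast
      qed
    qed (use Y_in_E[OF \<eta> \<omega>(1)] in \<open>auto simp: returns_at_def\<close>)
    show "\<omega> \<in> ?W t" if "T 0 \<omega> \<le> t" "returns E {\<xi>} t \<omega>"
      using that process_at_after_jump[where T = T and \<omega> = \<omega>, OF pos, of t Y] \<omega> by (auto simp: ret)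
    show "T 0 \<omega> \<le> t \<and> (\<exists>n. returns_at Y E n \<omega> \<and> (Y n \<omega> \<in> {\<xi>} \<or> T n \<omega> \<le> t))" if "\<omega> \<in> ?W t"
      using process_at_SomeD[where T = T and \<omega> = \<omega>, OF pos, of Y t \<xi>] t that by (auto simp: ret)
  qed (use \<xi> in auto)
  also have "K (hit_prob E {\<xi>}) \<eta> = measure_pmf.expectation (J \<eta>) (indicator {\<xi>})"
    unfolding K_def by (rule pmf_expectation_cong) (use set_pmf_J[OF \<eta>] hit_prob_on in blast)
  also have "\<dots> = pmf (J \<eta>) \<xi>" by (simp add: measure_pmf_single)
  finally show ?thesis .
qed

text \<open>The balance equation is the derivative at time 0 of the invariance of
  \<open>\<mu>\<close>. Summation and limit are interchanged by dominated convergence, with the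
  integrable holding rates as dominating function.\<close>

lemma stationary_balance:
  assumes stat: "stationary_distribution E P Y T \<mu>"
    and int: "(\<lambda>\<eta>. rate \<eta> * pmf \<mu> \<eta>) summable_on E" and \<xi>: "\<xi> \<in> E"
  shows "measure_pmf.expectation \<mu> (\<lambda>\<eta>. rate \<eta> * pmf (J \<eta>) \<xi>) = pmf \<mu> \<xi> * rate \<xi>"
proof -
  have sub: "set_pmf \<mu> \<subseteq> E" using stat by (simp add: stationary_distribution_def)
  let ?W = "\<lambda>t \<eta>. {\<omega> \<in> space (P \<eta>). T 0 \<omega> \<le> t \<and> process_at Y T t \<omega> = Some \<xi>}"
  let ?p = "\<lambda>t \<eta>. measure (P \<eta>) {\<omega> \<in> space (P \<eta>). process_at Y T t \<omega> = Some \<xi>}"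
  let ?g = "\<lambda>t \<eta>. measure (P \<eta>) (?W t \<eta>)"
  let ?F = "\<lambda>t. 1 - exp (- rate \<xi> * t)"
  have g_le: "?g t \<eta> \<le> rate \<eta> * t" if "\<eta> \<in> E" "0 \<le> t" for t \<eta>
  proof -
    interpret prob_space "P \<eta>" by (rule prob_space_P[OF that(1)])
    have "?g t \<eta> \<le> measure (P \<eta>) {\<omega> \<in> space (P \<eta>). T 0 \<omega> \<le> t}"
      by (rule finite_measure_mono) (use that in \<open>auto, measurable\<close>)
    thus ?thesis using measure_jump_before[OF that] jump_before_le[of \<eta> t] by simp
  qed
  \<comment> \<open>Either no jump occurs before \<open>t\<close>, which contributes only for
    \<open>\<eta> = \<xi>\<close>, or at least one does.\<close>
  have split: "?p t \<eta> = indicator {\<xi>} \<eta> * (1 - ?F t) + ?g t \<eta>" if \<eta>: "\<eta> \<in> E" and t: "0 \<le> t" for t \<eta>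
  proof -
    interpret prob_space "P \<eta>" by (rule prob_space_P[OF \<eta>])
    let ?V = "if \<eta> = \<xi> then {\<omega> \<in> space (P \<eta>). \<not> T 0 \<omega> \<le> t} else {}"
    have V: "?V \<in> events" using \<eta> by auto
    have W: "?W t \<eta> \<in> events" using \<eta> by measurable
    have "?p t \<eta> = prob (?V \<union> ?W t \<eta>)"
    proof (rule measure_eq_AE)
      show "AE \<omega> in P \<eta>. \<omega> \<in> {\<omega> \<in> space (P \<eta>). process_at Y T t \<omega> = Some \<xi>} \<longleftrightarrow> \<omega> \<in> ?V \<union> ?W t \<eta>"
        using AE_regular[OF \<eta>]
      proof eventually_elim
        fix \<omega> assume *: "Y 0 \<omega> = \<eta> \<and> (\<forall>i. 0 < T i \<omega>)"
        have "process_at Y T t \<omega> = Some \<eta>" if "t < T 0 \<omega>"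
          using process_at_eqI[where T = T and \<omega> = \<omega>, of 0 t Y] * that t by auto
        thus "\<omega> \<in> {\<omega> \<in> space (P \<eta>). process_at Y T t \<omega> = Some \<xi>} \<longleftrightarrow> \<omega> \<in> ?V \<union> ?W t \<eta>"
          by (cases "t < T 0 \<omega>") auto
      qed
      show "{\<omega> \<in> space (P \<eta>). process_at Y T t \<omega> = Some \<xi>} \<in> events" using \<eta> by measurable
    qed (use V W in blast)
    also have "\<dots> = prob ?V + prob (?W t \<eta>)"
      by (rule finite_measure_Union[OF V W]) (auto split: if_splits)
    also have "prob ?V = indicator {\<xi>} \<eta> * (1 - ?F t)"
    proof -
      have "{\<omega> \<in> space (P \<eta>). \<not> T 0 \<omega> \<le> t} = space (P \<eta>) - {\<omega> \<in> space (P \<eta>). T 0 \<omega> \<le> t}" by auto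
      moreover have "{\<omega> \<in> space (P \<eta>). T 0 \<omega> \<le> t} \<in> events" using \<eta> by measurable
      ultimately have "prob {\<omega> \<in> space (P \<eta>). \<not> T 0 \<omega> \<le> t} = exp (- rate \<eta> * t)"
        using measure_jump_before[OF \<eta> t] by (simp add: prob_compl)
      thus ?thesis by (cases "\<eta> = \<xi>") auto
    qed
    finally show ?thesis .
  qed
  have balance: "measure_pmf.expectation \<mu> (\<lambda>\<eta>. ?g t \<eta> / t) = pmf \<mu> \<xi> * (?F t / t)" if t: "0 < t" for t
  proof -
    have g_bdd: "\<bar>?g t \<eta>\<bar> \<le> 1" if "\<eta> \<in> E" for \<eta>
      using prob_space.prob_le_1[OF prob_space_P[OF that]] by simp
    have int_g: "integrable (measure_pmf \<mu>) (?g t)"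
      by (rule pmf_integrable_bounded) (use g_bdd sub in \<open>auto simp: bounded_real_image_iff\<close>)
    have int_i: "integrable (measure_pmf \<mu>) (\<lambda>\<eta>. indicator {\<xi>} \<eta> * (1 - ?F t))"
      by (rule pmf_integrable_bounded) (intro bounded_comps, simp_all)
    have "((\<lambda>\<eta>. pmf \<mu> \<eta> * (indicator {\<xi>} \<eta> * (1 - ?F t) + ?g t \<eta>)) has_sum
        measure_pmf.expectation \<mu> (\<lambda>\<eta>. indicator {\<xi>} \<eta> * (1 - ?F t) + ?g t \<eta>)) E"
      by (rule pmf_expectation_has_sum[OF _ sub]) (intro Bochner_Integration.integrable_add int_g int_i)
    moreover have "((\<lambda>\<eta>. pmf \<mu> \<eta> * ?p t \<eta>) has_sum pmf \<mu> \<xi>) E"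
      using stat t \<xi> by (simp add: stationary_distribution_def)
    hence "((\<lambda>\<eta>. pmf \<mu> \<eta> * (indicator {\<xi>} \<eta> * (1 - ?F t) + ?g t \<eta>)) has_sum pmf \<mu> \<xi>) E"
      by (rule iffD1[OF has_sum_cong, rotated]) (use split t in auto)
    ultimately have "measure_pmf.expectation \<mu> (\<lambda>\<eta>. indicator {\<xi>} \<eta> * (1 - ?F t) + ?g t \<eta>) = pmf \<mu> \<xi>"
      by (rule has_sum_unique)
    hence "pmf \<mu> \<xi> * (1 - ?F t) + measure_pmf.expectation \<mu> (?g t) = pmf \<mu> \<xi>"
      by (subst (asm) Bochner_Integration.integral_add[OF int_i int_g]) (simp add: measure_pmf_single)
    hence "measure_pmf.expectation \<mu> (?g t) = pmf \<mu> \<xi> * ?F t" by (simp add: algebra_simps)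
    thus ?thesis by simp
  qed
  let ?t = "\<lambda>n::nat. inverse (real (Suc n))"
  have t0: "filterlim ?t (at_right 0) sequentially"
    by (rule tendsto_imp_filterlim_at_right[OF LIMSEQ_inverse_real_of_nat]) simp
  have "(\<lambda>n. measure_pmf.expectation \<mu> (\<lambda>\<eta>. ?g (?t n) \<eta> / ?t n)) \<longlonglongrightarrow>
      measure_pmf.expectation \<mu> (\<lambda>\<eta>. rate \<eta> * pmf (J \<eta>) \<xi>)"
  proof (rule integral_dominated_convergence[where w = rate])
    show "integrable (measure_pmf \<mu>) rate"
      by (rule pmf_integrable_summable[OF _ sub])
        (use int rate_nonneg in \<open>simp_all add: mult.commute\<close>)
    show "AE \<eta> in \<mu>. (\<lambda>n. ?g (?t n) \<eta> / ?t n) \<longlonglongrightarrow> rate \<eta> * pmf (J \<eta>) \<xi>"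
      unfolding AE_measure_pmf_iff
      using sub filterlim_compose[OF process_rate_limit[OF _ \<xi>] t0] by blast
    show "AE \<eta> in \<mu>. norm (?g (?t n) \<eta> / ?t n) \<le> rate \<eta>" for n
    proof -
      have "?g (?t n) \<eta> / ?t n \<le> rate \<eta>" if "\<eta> \<in> E" for \<eta>
      proof -
        have pos: "0 < ?t n" by simp
        show ?thesis
          unfolding pos_divide_le_eq[OF pos] by (rule g_le[OF that less_imp_le[OF pos]])
      qed
      thus ?thesis unfolding AE_measure_pmf_iff using sub by auto
    qed
  qed auto
  moreover have "(\<lambda>n. measure_pmf.expectation \<mu> (\<lambda>\<eta>. ?g (?t n) \<eta> / ?t n)) \<longlonglongrightarrow> pmf \<mu> \<xi> * rate \<xi>"
  proof -
    have "(\<lambda>n. pmf \<mu> \<xi> * (?F (?t n) / ?t n)) \<longlonglongrightarrow> pmf \<mu> \<xi> * rate \<xi>"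
      by (intro tendsto_intros filterlim_compose[OF jump_before_rate t0])
    thus ?thesis by (subst balance) auto
  qed
  ultimately show ?thesis by (rule LIMSEQ_unique)
qed

end

section \<open>The variational problem of the process\<close>

locale stationary_jump_hold_process = jump_hold_process +
  fixes \<mu> :: "'a pmf"
  assumes irreducible: "irreducible_rates E R"
    and stationary_\<mu>: "stationary_distribution E P Y T \<mu>"
    and rate_summable: "(\<lambda>\<eta>. rate \<eta> * pmf \<mu> \<eta>) summable_on E"
begin

lemma set_\<mu>: "set_pmf \<mu> \<subseteq> E"
  using stationary_\<mu> by (simp add: stationary_distribution_def)

lemma integrable_rate: "integrable (measure_pmf \<mu>) rate"
  by (rule pmf_integrable_summable[OF _ set_\<mu>])
    (use rate_summable rate_nonneg in \<open>simp_all add: mult.commute\<close>)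

lemma rate_J: "\<eta> \<in> E \<Longrightarrow> \<xi> \<in> E \<Longrightarrow> \<eta> \<noteq> \<xi> \<Longrightarrow> rate \<eta> * pmf (J \<eta>) \<xi> = R \<eta> \<xi>"
  using rate_pos[of \<eta>] by (simp add: pmf_J jump_prob_def)

lemma R_pos_imp:
  assumes "\<eta> \<in> E" "\<xi> \<in> E" "0 < R \<eta> \<xi>"
  shows "\<eta> \<noteq> \<xi>" "\<xi> \<in> set_pmf (J \<eta>)"
proof -
  show "\<eta> \<noteq> \<xi>" using assms rates by (force simp: rate_matrix_def)
  hence "0 < rate \<eta> * pmf (J \<eta>) \<xi>" using assms rate_J by simp
  thus "\<xi> \<in> set_pmf (J \<eta>)" by (auto simp: set_pmf_iff)
qed

lemma integrable_rate_J:
  "integrable (measure_pmf \<mu>) (\<lambda>\<eta>. rate \<eta> * pmf (J \<eta>) \<xi>)"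
proof (rule Bochner_Integration.integrable_bound[OF integrable_rate])
  show "AE \<eta> in \<mu>. norm (rate \<eta> * pmf (J \<eta>) \<xi>) \<le> norm (rate \<eta>)"
    by (simp add: abs_mult pmf_le_1 mult_left_le)
qed simp

text \<open>Positivity spreads along jumps: if \<open>\<mu>\<close> vanished at \<open>b\<close>,
  the balance equation at \<open>b\<close> would force every inflow into \<open>b\<close> to vanish,
  contradicting the positive rate from \<open>a\<close>.\<close>

lemma \<mu>_pos:
  assumes "\<xi> \<in> E"
  shows "0 < pmf \<mu> \<xi>"
proof -
  obtain \<eta> where \<eta>: "\<eta> \<in> set_pmf \<mu>" using set_pmf_not_empty[of \<mu>] by blast
  hence "(\<eta>, \<xi>) \<in> {(a, b). a \<in> E \<and> b \<in> E \<and> 0 < R a b}\<^sup>*"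
    using irreducible assms set_\<mu> by (auto simp: irreducible_rates_def)
  thus ?thesis
  proof (induction rule: rtrancl_induct)
    case base
    thus ?case using \<eta> by (simp add: pmf_positive)
  next
    case (step a b)
    hence ab: "a \<in> E" "b \<in> E" "0 < R a b" by auto
    show ?case
    proof (rule ccontr)
      assume "\<not> 0 < pmf \<mu> b"
      hence "pmf \<mu> b = 0" by (simp add: pmf_nonneg order.antisym not_less)
      hence "measure_pmf.expectation \<mu> (\<lambda>\<eta>. rate \<eta> * pmf (J \<eta>) b) = 0"
        using stationary_balance[OF stationary_\<mu> rate_summable ab(2)] by simp
      moreover have "AE \<eta> in \<mu>. 0 \<le> rate \<eta> * pmf (J \<eta>) b"
        unfolding AE_measure_pmf_iff using set_\<mu> rate_nonneg by auto
      ultimately have "AE \<eta> in \<mu>. rate \<eta> * pmf (J \<eta>) b = 0"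
        using integral_nonneg_eq_0_iff_AE[OF integrable_rate_J] by simp
      hence "rate a * pmf (J a) b = 0"
        using step.IH by (simp add: AE_measure_pmf_iff set_pmf_iff)
      thus False using rate_J[OF ab(1,2)] R_pos_imp(1)[OF ab] ab(3) by simp
    qed
  qed
qed

section \<open>The embedded jump chain and the translation of the problem to it\<close>

definition Z :: real where "Z = measure_pmf.expectation \<mu> rate"

lemma \<mu>_rate_has_sum: "((\<lambda>\<eta>. pmf \<mu> \<eta> * rate \<eta>) has_sum Z) E"
  unfolding Z_def by (rule pmf_expectation_has_sum[OF integrable_rate set_\<mu>])

lemma Z_pos: "0 < Z"
proof -
  have nn: "AE \<eta> in \<mu>. 0 \<le> rate \<eta>"
    unfolding AE_measure_pmf_iff using set_\<mu> rate_nonneg by auto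
  have "Z \<noteq> 0"
  proof
    assume "Z = 0"
    hence "AE \<eta> in \<mu>. rate \<eta> = 0"
      using integral_nonneg_eq_0_iff_AE[OF integrable_rate nn] by (simp add: Z_def)
    moreover obtain \<eta> where "\<eta> \<in> set_pmf \<mu>" using set_pmf_not_empty[of \<mu>] by blast
    ultimately show False
      using rate_pos[of \<eta>] set_\<mu> by (auto simp: AE_measure_pmf_iff)
  qed
  moreover have "0 \<le> Z" unfolding Z_def by (rule integral_nonneg_AE[OF nn])
  ultimately show ?thesis by simp
qed

text \<open>The stationary law of the jump chain: weighting \<open>\<mu>\<close> by the holding
  rates absorbs the factor \<open>rate\<close> of the generator into the measure, so that bounded
  kernels replace possibly unbounded rates.\<close>

definition m :: "'a pmf" where
  "m = embed_pmf (\<lambda>\<eta>. if \<eta> \<in> E then pmf \<mu> \<eta> * rate \<eta> / Z else 0)"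

lemma pmf_m: "pmf m \<eta> = (if \<eta> \<in> E then pmf \<mu> \<eta> * rate \<eta> / Z else 0)"
proof -
  let ?f = "\<lambda>\<eta>. if \<eta> \<in> E then pmf \<mu> \<eta> * rate \<eta> / Z else 0"
  have nn: "0 \<le> ?f \<eta>" for \<eta>
    using rate_nonneg Z_pos by (auto intro!: divide_nonneg_pos mult_nonneg_nonneg pmf_nonneg)
  have "((\<lambda>\<eta>. pmf \<mu> \<eta> * rate \<eta> * inverse Z) has_sum (Z * inverse Z)) E"
    by (rule has_sum_cmult_left[OF \<mu>_rate_has_sum])
  also have "Z * inverse Z = 1" using Z_pos by simp
  finally have "(?f has_sum 1) UNIV"
    by (rule iffD1[OF has_sum_cong_neutral, rotated -1]) (auto simp: divide_inverse)
  hence "(\<integral>\<^sup>+\<eta>. ?f \<eta> \<partial>count_space UNIV) = 1"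
    by (subst nonneg_has_sum_nn_integral) (use nn in auto)
  thus ?thesis
    unfolding m_def by (intro pmf_embed_pmf nn)
qed

lemma set_m: "set_pmf m = E"
proof (rule set_eqI)
  show "\<eta> \<in> set_pmf m \<longleftrightarrow> \<eta> \<in> E" for \<eta>
    using \<mu>_pos[of \<eta>] rate_pos[of \<eta>] Z_pos by (auto simp: set_pmf_iff pmf_m)
qed

lemma m_has_sum:
  assumes "bounded (f ` E)"
  shows "((\<lambda>\<eta>. pmf \<mu> \<eta> * rate \<eta> * f \<eta>) has_sum Z * measure_pmf.expectation m f) E"
proof -
  have "((\<lambda>\<eta>. Z * (pmf m \<eta> * f \<eta>)) has_sum Z * measure_pmf.expectation m f) E"
    by (intro has_sum_cmult_right pmf_expectation_has_sum pmf_integrable_bounded)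
      (use assms in \<open>simp_all add: set_m\<close>)
  thus ?thesis
    by (rule iffD1[OF has_sum_cong, rotated]) (use Z_pos in \<open>simp add: pmf_m\<close>)
qed

text \<open>The balance equation divided by \<open>Z\<close>.\<close>

lemma bind_m_J: "bind_pmf m J = m"
proof (rule pmf_eqI)
  fix \<xi>
  have b: "bounded ((\<lambda>\<eta>. pmf (J \<eta>) \<xi>) ` E)"
    unfolding bounded_real_image_iff by (intro exI[of _ 1]) (simp add: pmf_le_1)
  have "measure_pmf.expectation m (\<lambda>\<eta>. pmf (J \<eta>) \<xi>) = pmf m \<xi>"
  proof (cases "\<xi> \<in> E")
    case True
    have "((\<lambda>\<eta>. pmf \<mu> \<eta> * rate \<eta> * pmf (J \<eta>) \<xi>) has_sum pmf \<mu> \<xi> * rate \<xi>) E"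
      using pmf_expectation_has_sum[OF integrable_rate_J set_\<mu>, of \<xi>]
        stationary_balance[OF stationary_\<mu> rate_summable True] by (simp add: mult.assoc)
    with m_has_sum[OF b] have "Z * measure_pmf.expectation m (\<lambda>\<eta>. pmf (J \<eta>) \<xi>) = pmf \<mu> \<xi> * rate \<xi>"
      by (rule has_sum_unique)
    thus ?thesis using True Z_pos by (simp add: pmf_m field_simps)
  next
    case False
    have "measure_pmf.expectation m (\<lambda>\<eta>. pmf (J \<eta>) \<xi>) = measure_pmf.expectation m (\<lambda>\<eta>. 0)"
      by (rule pmf_expectation_cong) (use False in \<open>simp add: set_m pmf_J\<close>)
    thus ?thesis using False by (simp add: pmf_m)
  qed
  thus "pmf (bind_pmf m J) \<xi> = pmf m \<xi>" by (simp add: pmf_bind)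
qed

sublocale stationary_chain m J
proof
  show "bind_pmf m J = m" by (rule bind_m_J)
  fix v :: "'a \<Rightarrow> real"
  assume v: "\<And>\<eta> \<xi>. \<eta> \<in> set_pmf m \<Longrightarrow> \<xi> \<in> set_pmf (J \<eta>) \<Longrightarrow> v \<xi> = v \<eta>"
  have "v \<xi> = v \<eta>" if "(\<eta>, \<xi>) \<in> {(a, b). a \<in> E \<and> b \<in> E \<and> 0 < R a b}\<^sup>*" for \<eta> \<xi>
    using that
  proof (induction rule: rtrancl_induct)
    case (step a b)
    thus ?case using v[of a b] R_pos_imp(2)[of a b] by (auto simp: set_m)
  qed simp
  moreover obtain \<eta> where "\<eta> \<in> E" using set_pmf_not_empty[of m] by (auto simp: set_m)
  ultimately show "\<exists>c. \<forall>\<xi>\<in>set_pmf m. v \<xi> = c"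
    using irreducible by (intro exI[of _ "v \<eta>"]) (auto simp: set_m irreducible_rates_def)
qed

lemma generator_eq:
  assumes h: "bounded (h ` E)" and \<eta>: "\<eta> \<in> E"
  shows "generator E R h \<eta> = rate \<eta> * (K h \<eta> - h \<eta>)"
proof -
  have int: "integrable (measure_pmf (J \<eta>)) h"
    by (rule integrable_J) (use h \<eta> in \<open>simp_all add: set_m\<close>)
  have "((\<lambda>\<xi>. pmf (J \<eta>) \<xi> * (h \<xi> - h \<eta>)) has_sum
      measure_pmf.expectation (J \<eta>) (\<lambda>\<xi>. h \<xi> - h \<eta>)) E"
    by (rule pmf_expectation_has_sum[OF _ set_pmf_J[OF \<eta>]]) (simp add: int)
  also have "measure_pmf.expectation (J \<eta>) (\<lambda>\<xi>. h \<xi> - h \<eta>) = K h \<eta> - h \<eta>"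
    by (simp add: int K_def)
  finally have "((\<lambda>\<xi>. rate \<eta> * (pmf (J \<eta>) \<xi> * (h \<xi> - h \<eta>))) has_sum rate \<eta> * (K h \<eta> - h \<eta>)) E"
    by (rule has_sum_cmult_right)
  \<comment> \<open>At \<open>\<xi> = \<eta>\<close> the increment of \<open>h\<close> is 0, so the
    diagonal entries, which differ, do no harm.\<close>
  moreover have "rate \<eta> * (pmf (J \<eta>) \<xi> * (h \<xi> - h \<eta>)) = R \<eta> \<xi> * (h \<xi> - h \<eta>)" if "\<xi> \<in> E" for \<xi>
    using rate_J[OF \<eta> that] by (cases "\<eta> = \<xi>") (auto simp: mult.assoc[symmetric])
  ultimately have "((\<lambda>\<xi>. R \<eta> \<xi> * (h \<xi> - h \<eta>)) has_sum rate \<eta> * (K h \<eta> - h \<eta>)) E"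
    using has_sum_cong[of E "\<lambda>\<xi>. rate \<eta> * (pmf (J \<eta>) \<xi> * (h \<xi> - h \<eta>))"] by simp
  thus ?thesis unfolding generator_def by (rule infsumI)
qed

lemma scalar_product_generator:
  assumes f: "bounded (f ` E)" and h: "bounded (h ` E)"
  shows "scalar_product E \<mu> f (generator E R h) = Z * form f h"
proof -
  have "bounded ((\<lambda>\<eta>. f \<eta> * (K h \<eta> - h \<eta>)) ` E)"
    using bounded_K[of h] f h by (intro bounded_comps) (simp_all add: set_m)
  from m_has_sum[OF this]
  have "((\<lambda>\<eta>. f \<eta> * generator E R h \<eta> * pmf \<mu> \<eta>) has_sum Z * form f h) E"
    unfolding form_def
    by (rule iffD1[OF has_sum_cong, rotated]) (simp add: generator_eq[OF h])
  thus ?thesis unfolding scalar_product_def by (rule infsumI)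
qed

lemma objective_eq:
  assumes f: "bounded (f ` E)" and h: "bounded (h ` E)"
  shows "objective E R \<mu> f h = Z * (2 * form f h + form h h)"
proof -
  have "scalar_product E \<mu> h (\<lambda>\<eta>. - generator E R h \<eta>) = - scalar_product E \<mu> h (generator E R h)"
    by (simp add: scalar_product_def infsum_uminus)
  thus ?thesis
    using scalar_product_generator[OF f h] scalar_product_generator[OF h h]
    by (simp add: objective_def algebra_simps)
qed

text \<open>The trace rates from \<open>\<eta>\<close> to the points of \<open>B\<close> add up to
  \<open>rate \<eta>\<close> times the return probability to \<open>B\<close>, and the rate is
  absorbed into \<open>m\<close>. Disjointness of \<open>A\<close> and \<open>B\<close> keeps the
  sum off the diagonal, where \<open>trace_rate_eq\<close> applies.\<close>

lemma mean_rate_eq: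
  assumes D: "D \<subseteq> E" and AB: "A \<subseteq> D" "B \<subseteq> D" "A \<inter> B = {}"
  shows "mean_rate P Y T \<mu> D A B = Z * flux D A B / measure_pmf.prob \<mu> A"
proof -
  let ?q = "\<lambda>\<eta>. K (hit_prob D B) \<eta>"
  have inner: "(\<Sum>\<^sub>\<infinity>\<xi>\<in>B. trace_rate P Y T D \<eta> \<xi>) = rate \<eta> * ?q \<eta>" if \<eta>: "\<eta> \<in> A" for \<eta>
  proof -
    have "\<eta> \<in> E" "B \<subseteq> E" using \<eta> D AB by auto
    hence "((\<lambda>\<xi>. rate \<eta> * K (hit_prob D {\<xi>}) \<eta>) has_sum rate \<eta> * ?q \<eta>) B"
      using AB(2) by (intro has_sum_cmult_right K_hit_prob_has_sum)
    hence "((\<lambda>\<xi>. trace_rate P Y T D \<eta> \<xi>) has_sum rate \<eta> * ?q \<eta>) B"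
      by (rule iffD2[OF has_sum_cong, rotated]) (rule trace_rate_eq[OF D]; use \<eta> AB in blast)
    thus ?thesis by (rule infsumI)
  qed
  have "bounded ((\<lambda>\<eta>. indicator A \<eta> * ?q \<eta>) ` E)"
    using bounded_K[of "hit_prob D B"] by (intro bounded_comps) (simp_all add: set_m)
  from m_has_sum[OF this]
  have "((\<lambda>\<eta>. pmf \<mu> \<eta> * rate \<eta> * (indicator A \<eta> * ?q \<eta>)) has_sum Z * flux D A B) E"
    by (simp add: flux_def)
  hence "((\<lambda>\<eta>. pmf \<mu> \<eta> * (\<Sum>\<^sub>\<infinity>\<xi>\<in>B. trace_rate P Y T D \<eta> \<xi>)) has_sum Z * flux D A B) A"
    by (rule iffD1[OF has_sum_cong_neutral, rotated -1])
      (use AB D in \<open>auto simp: inner\<close>)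
  thus ?thesis by (simp add: mean_rate_def infsumI)
qed

end


section \<open>The statement for the whole sequence of chains\<close>

theorem proposition2p2:
  fixes E :: "nat \<Rightarrow> 'a set"
    and R :: "nat \<Rightarrow> 'a \<Rightarrow> 'a \<Rightarrow> real"
    and P :: "nat \<Rightarrow> 'a \<Rightarrow> 'w measure"
    and Y :: "nat \<Rightarrow> nat \<Rightarrow> 'w \<Rightarrow> 'a"
    and T :: "nat \<Rightarrow> nat \<Rightarrow> 'w \<Rightarrow> real"
    and \<mu> :: "nat \<Rightarrow> 'a pmf"
    and \<kappa> :: nat
    and \<E>s :: "nat \<Rightarrow> nat \<Rightarrow> 'a set"
    and \<E> :: "nat \<Rightarrow> 'a set"
    and x y :: nat
  assumes "\<And>N. N \<ge> 1 \<Longrightarrow> countable (E N)"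
    and "\<And>N. N \<ge> 1 \<Longrightarrow> rate_matrix (E N) (R N)"
    and "\<And>N. N \<ge> 1 \<Longrightarrow> jump_hold_chain (E N) (R N) (P N) (Y N) (T N)"
    and "\<And>N. N \<ge> 1 \<Longrightarrow> irreducible_rates (E N) (R N)"
    and "\<And>N. N \<ge> 1 \<Longrightarrow> positive_recurrent (E N) (P N) (Y N) (T N)"
    and "\<And>N. N \<ge> 1 \<Longrightarrow> stationary_distribution (E N) (P N) (Y N) (T N) (\<mu> N)"
    and "\<And>N. N \<ge> 1 \<Longrightarrow> (\<lambda>\<eta>. holding_rate (R N) \<eta> * pmf (\<mu> N) \<eta>) summable_on E N"
    and "\<kappa> \<ge> 2"
    and "\<And>N z. N \<ge> 1 \<Longrightarrow> z \<in> {1..\<kappa>} \<Longrightarrow> \<E>s N z \<subseteq> E N"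
    and "\<And>N. N \<ge> 1 \<Longrightarrow> disjoint_family_on (\<E>s N) {1..\<kappa>}"
    and "\<And>N. N \<ge> 1 \<Longrightarrow> \<E> N = (\<Union>z\<in>{1..\<kappa>}. \<E>s N z)"
    and "x \<in> {1..\<kappa>}" and "y \<in> {1..\<kappa>}" and "x \<noteq> y"
  shows "\<forall>N\<ge>1.
    let r = mean_rate (P N) (Y N) (T N) (\<mu> N) (\<E> N);
        A = \<E>s N x;
        B = \<E>s N y;
        ratio = r A B / (\<Sum>z\<in>{1..\<kappa>} - {x}. r A (\<E>s N z));
        opt_f = optimal_f (E N) (R N) (\<mu> N) (\<E> N) A B;
        opt_h = optimal_h (E N) (R N) (\<mu> N) (\<E> N) A B
    in (\<exists>f. opt_f f) \<and>
       (\<forall>f. opt_f f \<longrightarrow>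
          (\<exists>h. opt_h f h \<and> (\<forall>\<eta>\<in>A. h \<eta> = - ratio)) \<and>
          (\<E> N - (A \<union> B) \<noteq> {} \<longrightarrow>
             (\<forall>h. opt_h f h \<longrightarrow> (\<forall>\<eta>\<in>A. h \<eta> = - ratio))))"
proof (intro allI impI)
  fix N :: nat assume N: "N \<ge> 1"
  interpret stationary_jump_hold_process "E N" "R N" "P N" "Y N" "T N" "\<mu> N"
    by unfold_locales (use assms N in auto)
  let ?A = "\<E>s N x" and ?B = "\<E>s N y" and ?D = "\<E> N"
  let ?r = "mean_rate (P N) (Y N) (T N) (\<mu> N) ?D"
  let ?ratio = "?r ?A ?B / (\<Sum>z\<in>{1..\<kappa>} - {x}. ?r ?A (\<E>s N z))"
  have disj: "\<E>s N z \<inter> \<E>s N z' = {}" if "z \<in> {1..\<kappa>}" "z' \<in> {1..\<kappa>}" "z \<noteq> z'" for z z'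
    using assms(10)[OF N] that by (auto simp: disjoint_family_on_def)
  have subD: "\<E>s N z \<subseteq> ?D" if "z \<in> {1..\<kappa>}" for z
    using assms(11)[OF N] that by blast
  have D: "?D \<subseteq> E N" using assms(9)[OF N] assms(11)[OF N] by blast
  note AB = disj[OF assms(12-14)] subD[OF assms(12)] subD[OF assms(13)]
  \<comment> \<open>A point of \<open>A\<close> ensures that \<open>A\<close> has positive mass; the
    factor \<open>Z\<close> over this mass is then nonzero and cancels from the quotient of mean
    rates. For empty \<open>A\<close> the claims about values on \<open>A\<close> are
    vacuous.\<close>
  have ratio: "?ratio = flux ?D ?A ?B / flux ?D ?A (?D - ?A)" if \<eta>: "\<eta> \<in> ?A" for \<eta>
  proof -
    have "0 < measure_pmf.prob (\<mu> N) ?A"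
      using \<eta> \<mu>_pos[of \<eta>] AB(2) D by (intro measure_pmf_posI[of \<eta>]) (auto simp: set_pmf_iff)
    hence c: "Z / measure_pmf.prob (\<mu> N) ?A \<noteq> 0" using Z_pos by simp
    have "(\<Union>z\<in>{1..\<kappa>} - {x}. \<E>s N z) = ?D - ?A"
      using assms(11)[OF N] disj assms(12) by fastforce
    moreover have "flux ?D ?A (\<Union>z\<in>{1..\<kappa>} - {x}. \<E>s N z) = (\<Sum>z\<in>{1..\<kappa>} - {x}. flux ?D ?A (\<E>s N z))"
    proof (rule flux_UN)
      show "disjoint_family_on (\<E>s N) ({1..\<kappa>} - {x})"
        using disj by (auto simp: disjoint_family_on_def)
      show "?D \<inter> set_pmf m \<noteq> {}" using \<eta> AB(2) D by (auto simp: set_m)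
    qed simp
    moreover have "?r ?A (\<E>s N z) = Z / measure_pmf.prob (\<mu> N) ?A * flux ?D ?A (\<E>s N z)"
      if "z \<in> {1..\<kappa>}" "z \<noteq> x" for z
      using mean_rate_eq[OF D AB(2) subD[OF that(1)]] disj[OF assms(12) that(1)] that(2) by simp
    ultimately have "(\<Sum>z\<in>{1..\<kappa>} - {x}. ?r ?A (\<E>s N z)) =
        Z / measure_pmf.prob (\<mu> N) ?A * flux ?D ?A (?D - ?A)"
      by (simp add: sum_distrib_left)
    moreover have "?r ?A ?B = Z / measure_pmf.prob (\<mu> N) ?A * flux ?D ?A ?B"
      using mean_rate_eq[OF D AB(2,3,1)] by simp
    ultimately show ?thesis by (simp only: mult_divide_mult_cancel_left[OF c])
  qed
  have DS: "?D \<subseteq> set_pmf m" using D by (simp add: set_m)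
  note var = variational_problem[OF AB DS Z_pos, of "R N" "\<mu> N", unfolded set_m, OF objective_eq]
  show "let r = ?r; A = ?A; B = ?B;
        ratio = r A B / (\<Sum>z\<in>{1..\<kappa>} - {x}. r A (\<E>s N z));
        opt_f = optimal_f (E N) (R N) (\<mu> N) (\<E> N) A B;
        opt_h = optimal_h (E N) (R N) (\<mu> N) (\<E> N) A B
    in (\<exists>f. opt_f f) \<and>
       (\<forall>f. opt_f f \<longrightarrow>
          (\<exists>h. opt_h f h \<and> (\<forall>\<eta>\<in>A. h \<eta> = - ratio)) \<and>
          (\<E> N - (A \<union> B) \<noteq> {} \<longrightarrow>
             (\<forall>h. opt_h f h \<longrightarrow> (\<forall>\<eta>\<in>A. h \<eta> = - ratio))))"
    unfolding Let_def using var ratio by (simp cong: ball_cong)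
qed

end
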